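(* Let $(X,B)\in\mathbb{K}^{n\times p}\times\mathbb{K}^{n\times p}$ and $\mathbb{S}\in\{\mathbb{J},\mathbb{L}\}$. Suppose that $\mathbb{S}(X,B)\neq\emptyset$. Then $A\in\mathbb{S}(X,B)$ if and only if $A$ is of the form $$A=\begin{cases}M^{-1}\mathcal{F}_T(X,MB)+M^{-1}(I-XX^\dagger)^TZ(I-XX^\dagger), & \text{if } M\mathbb{S}\in\{\mathsf{sym},\mathsf{skew\mbox{-}sym}\},\\ M^{-1}\mathcal{F}_H(X,MB)+M^{-1}(I-XX^\dagger)Z(I-XX^\dagger), & \text{if } M\mathbb{S}\in\{\mathsf{Herm},\mathsf{skew\mbox{-}Herm}\},\end{cases}$$ for some $Z\in M\mathbb{S}$. (a) Frobenius norm. Define $A_o:=M^{-1}\mathcal{F}_T(X,MB)$ when $M\mathbb{S}\in\{\mathsf{sym},\mathsf{skew\mbox{-}sym}\}$, and $A_o:=M^{-1}\mathcal{F}_H(X,MB)$ when $M\mathbb{S}\in\{\mathsf{Herm},\mathsf{skew\mbox{-}Herm}\}$. Then $A_o$ is the unique matrix in $\mathbb{S}(X,B)$ such that $A_oX=B$ and $$\sigma^{\mathbb{S}}(X,B)=\|A_o\|_F=\begin{cases}\sqrt{2\|BX^\dagger\|_F^2-\mathrm{Tr}\big(MBX^\dagger(MBX^\dagger)^H(XX^\dagger)^T\big)}, & \text{if } M\mathbb{S}\in\{\mathsf{sym},\mathsf{skew\mbox{-}sym}\},\\ \sqrt{2\|BX^\dagger\|_F^2-\mathrm{Tr}\big(MBX^\dagger(MBX^\dagger)^HXX^\dagger\big)},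 & \text{if } M\mathbb{S}\in\{\mathsf{Herm},\mathsf{skew\mbox{-}Herm}\},\end{cases}$$ where $\sigma^{\mathbb{S}}$ is taken with respect to the Frobenius norm. (b) Spectral norm. With $\sigma^{\mathbb{S}}$ taken with respect to the spectral norm, and $\sigma^{\rm unstruc}(X,B)$ denoting $\sigma^{\mathbb{S}}(X,B)$ for $\mathbb{S}=\mathbb{K}^{n\times n}$, $$\sigma^{\mathbb{S}}(X,B)=\|BX^\dagger\|_2=\sigma^{\rm unstruc}(X,B).$$ Suppose that $\mathrm{rank}(X)=r$. Consider the SVD $X=U\Sigma V^H$ and partition $U=[U_1\ \ U_2]$ with $U_1\in\mathbb{K}^{n\times r}$. Put $\mu=\|BX^\dagger\|_2$. Case I. If $M\mathbb{S}\in\{\mathsf{sym},\mathsf{skew\mbox{-}sym}\}$, consider $$A_o:=M^{-1}\mathcal{F}_T(X,MB)-M^{-1}(I-XX^\dagger)^TKU_1^H\overline{MBX^\dagger U_1}K^T(I-XX^\dagger)+M^{-1}f(Z),$$ where $f(Z)=\mu\overline{U}_2(I-U_2^TKK^H\overline{U}_2)^{1/2}Z(I-U_2^H\overline{K}K^TU_2)^{1/2}U_2^H$, $$K=\begin{cases}MBX^\dagger U_1(\mu^2I-U_1^H\overline{MBX^\dagger}MBX^\dagger U_1)^{-1/2}, & M\mathbb{S}=\mathsf{sym},\\ MBX^\dagger U_1(\mu^2I+U_1^H\overline{MBX^\dagger}MBX^\dagger U_1)^{-1/2}, & M\mathbb{S}=\mathsf{skew\mbox{-}sym},\end{cases}$$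 and $Z$ is an arbitrary contraction such that $Z=Z^T$ (resp. $Z=-Z^T$) when $M\mathbb{S}=\mathsf{sym}$ (resp. $M\mathbb{S}=\mathsf{skew\mbox{-}sym}$). Then $A_o\in\mathbb{S}(X,B)$ and $\|A_o\|_2=\sigma^{\mathbb{S}}(X,B)$. Case II. If $M\mathbb{S}=\mathsf{Herm}$, consider $$A_o:=M^{-1}\mathcal{F}_H(X,MB)-M^{-1}(I-XX^\dagger)KU_1^HMBX^\dagger U_1K^H(I-XX^\dagger)+M^{-1}f(Z),$$ where $f(Z)=\mu U_2(I-U_2^HKK^HU_2)^{1/2}Z(I-U_2^HKK^HU_2)^{1/2}U_2^H$, $K=MBX^\dagger U_1(\mu^2I-U_1^HMBX^\dagger MBX^\dagger U_1)^{-1/2}$, and $Z=Z^H$ is an arbitrary contraction. Then $A_o\in\mathbb{S}(X,B)$ and $\|A_o\|_2=\sigma^{\mathbb{S}}(X,B)$. If $M\mathbb{S}=\mathsf{skew\mbox{-}Herm}$, define $A_o:=-i\,\mathcal{G}(X,iB)$, where $\mathcal{G}(Y,D)$ denotes a matrix in $\mathbb{S}'(Y,D)$ with $\|\mathcal{G}(Y,D)\|_2=\sigma^{\mathbb{S}'}(Y,D)$ for the class $\mathbb{S}'$ with $M\mathbb{S}'=\mathsf{Herm}$. Then $A_o\in\mathbb{S}(X,B)$ and $\|A_o\|_2=\sigma^{\mathbb{S}}(X,B)$.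
   Context: $\mathbb{K}=\mathbb{R}$ or $\mathbb{C}$; $X^T$, $X^H$, $\overline{X}$, $X^\dagger$ denote transpose, conjugate transpose, complex conjugate and Moore-Penrose pseudoinverse; $\mathrm{Tr}$ is the trace. A contraction is a matrix $Z$ with $\|Z\|_2\le 1$; here $Z$ has size $(n-r)\times(n-r)$ and entries in $\mathbb{K}$ in part (b). Let $M\in\mathbb{K}^{n\times n}$ be unitary. Consider the scalar product on $\mathbb{K}^n$ given by $\langle x,y\rangle_M=y^TMx$ (bilinear form; then $M^T=\pm M$) or $\langle x,y\rangle_M=y^HMx$ (sesquilinear form; $\mathbb{K}=\mathbb{C}$ and $M^H=\pm M$). The adjoint is $A^\star=M^{-1}A^TM$ (bilinear) or $A^\star=M^{-1}A^HM$ (sesquilinear). $\mathbb{L}=\{A\in\mathbb{K}^{n\times n}:A^\star=-A\}$, $\mathbb{J}=\{A\in\mathbb{K}^{n\times n}:A^\star=A\}$. $M\mathbb{S}:=\{MA:A\in\mathbb{S}\}$. $\mathsf{sym}$, $\mathsf{skew\mbox{-}sym}$ are the sets of $A\in\mathbb{K}^{n\times n}$ with $A^T=A$, $A^T=-A$; $\mathsf{Herm}$, $\mathsf{skew\mbox{-}Herm}$ are the sets of $A\in\mathbb{C}^{n\times n}$ with $A^H=A$, $A^H=-A$. For $\mathbb{S}\in\{\mathbb{J},\mathbb{L}\}$ one has $M\mathbb{S}\in\{\mathsf{sym},\mathsf{skew\mbox{-}sym}\}$ in the bilinear case and $M\mathbb{S}\in\{\mathsf{Herm},\mathsf{skew\mbox{-}Herm}\}$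 in the sesquilinear case. $\mathbb{S}(X,B):=\{A\in\mathbb{S}:AX=B\}$ and $\sigma^{\mathbb{S}}(X,B):=\inf\{\|A\|:A\in\mathbb{S}(X,B)\}$ for the norm under consideration. For $*\in\{T,H\}$ the map $\mathcal{F}_*:\mathbb{K}^{n\times p}\times\mathbb{K}^{n\times p}\to\mathbb{K}^{n\times n}$ is $$\mathcal{F}_*(X,B)=\begin{cases}BX^\dagger+(BX^\dagger)^*-(X^\dagger)^*(X^*B)X^\dagger, & \text{if }(X^*B)^*=X^*B,\\ BX^\dagger-(BX^\dagger)^*-(X^\dagger)^*(X^*B)X^\dagger, & \text{if }(X^*B)^*=-X^*B,\\ BX^\dagger, & \text{otherwise.}\end{cases}$$ If both of the first two conditions hold, the first formula is used when $M\mathbb{S}\in\{\mathsf{sym},\mathsf{Herm}\}$ and the second when $M\mathbb{S}\in\{\mathsf{skew\mbox{-}sym},\mathsf{skew\mbox{-}Herm}\}$. When the matrix whose inverse square root appears in $K$ is singular, the inverse is replaced by the Moore-Penrose pseudoinverse. *)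

theory Defs
  imports
    Jordan_Normal_Form.Schur_Decomposition
    Jordan_Normal_Form.DL_Rank
    Jordan_Normal_Form.Gauss_Jordan_Elimination
begin

text \<open>
  A matrix over \<open>\<real>\<close> or \<open>\<complex>\<close> is a complex matrix all of whose entries lie in the scalar field
  \<open>\<KK>\<close>, which is a subset of \<open>\<complex>\<close>: either \<open>\<real>\<close> or \<open>UNIV\<close>.  Carrier-based matrices are needed
  because block sizes such as \<open>n \<times> r\<close> with \<open>r = rank X\<close> occur, and \<open>r = 0\<close> and \<open>r = n\<close> are possible.
\<close>

definition kmat :: "complex set \<Rightarrow> nat \<Rightarrow> nat \<Rightarrow> complex mat set" where
  "kmat \<KK> m n = {A \<in> carrier_mat m n. elements_mat A \<subseteq> \<KK>}"

subsection \<open>Basic matrix operations\<close>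

notation mat_adjoint (\<open>(_\<^sup>H)\<close> [1000] 999)

abbreviation conj_mat :: "complex mat \<Rightarrow> complex mat" where
  "conj_mat A \<equiv> map_mat cnj A"

definition tr_mat :: "complex mat \<Rightarrow> complex" where
  "tr_mat A = (\<Sum>i<dim_row A. A $$ (i, i))"

definition inv_mat :: "complex mat \<Rightarrow> complex mat" where
  "inv_mat A = the (mat_inverse A)"

definition unitary_mat :: "complex mat \<Rightarrow> bool" where
  "unitary_mat U \<longleftrightarrow> square_mat U \<and> inverts_mat (U\<^sup>H) U \<and> inverts_mat U (U\<^sup>H)"

definition pinv_mat :: "complex mat \<Rightarrow> complex mat" (\<open>(_\<^sup>\<dagger>)\<close> [1000] 999) where
  "X\<^sup>\<dagger> = (THE Y. Y \<in> carrier_mat (dim_col X) (dim_row X) \<and>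
     X * Y * X = X \<and> Y * X * Y = Y \<and> (X * Y)\<^sup>H = X * Y \<and> (Y * X)\<^sup>H = Y * X)"

definition psd_mat :: "complex mat \<Rightarrow> bool" where
  "psd_mat A \<longleftrightarrow> square_mat A \<and> A\<^sup>H = A \<and>
     (\<forall>x \<in> carrier_vec (dim_row A). 0 \<le> Re ((A *\<^sub>v x) \<bullet>c x))"

definition sqrt_mat :: "complex mat \<Rightarrow> complex mat" where
  "sqrt_mat A = (THE S. S \<in> carrier_mat (dim_row A) (dim_row A) \<and> psd_mat S \<and> S * S = A)"

definition inv_sqrt_mat :: "complex mat \<Rightarrow> complex mat" where
  "inv_sqrt_mat A =
     (if invertible_mat A then inv_mat (sqrt_mat A) else (sqrt_mat A)\<^sup>\<dagger>)"

subsection \<open>Norms\<close>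

definition frob_norm :: "complex mat \<Rightarrow> real" where
  "frob_norm A = sqrt (\<Sum>i<dim_row A. \<Sum>j<dim_col A. (cmod (A $$ (i, j)))\<^sup>2)"

definition l2_norm_vec :: "complex vec \<Rightarrow> real" where
  "l2_norm_vec x = sqrt (\<Sum>i<dim_vec x. (cmod (vec_index x i))\<^sup>2)"

text \<open>The quotient form (as in \<open>onorm\<close>, with \<open>0 / 0 = 0\<close>) also covers matrices without columns.\<close>

definition spectral_norm :: "complex mat \<Rightarrow> real" where
  "spectral_norm A =
     (SUP x \<in> carrier_vec (dim_col A). l2_norm_vec (A *\<^sub>v x) / l2_norm_vec x)"

definition contraction_mat :: "complex set \<Rightarrow> nat \<Rightarrow> complex mat \<Rightarrow> bool" where
  "contraction_mat \<KK> m Z \<longleftrightarrow> Z \<in> kmat \<KK> m m \<and> spectral_norm Z \<le> 1"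

subsection \<open>Singular value decomposition\<close>

text \<open>
  The singular values \<open>s i\<close> are in decreasing order, so the first \<open>rank X\<close> columns of \<open>U\<close> are
  the left singular vectors for the nonzero singular values.
\<close>

definition is_svd ::
  "complex set \<Rightarrow> nat \<Rightarrow> nat \<Rightarrow> complex mat \<Rightarrow> complex mat \<Rightarrow> complex mat \<Rightarrow> complex mat \<Rightarrow> bool"
where
  "is_svd \<KK> n p X U \<Sigma> V \<longleftrightarrow>
     U \<in> kmat \<KK> n n \<and> unitary_mat U \<and> V \<in> kmat \<KK> p p \<and> unitary_mat V \<and>
     (\<exists>s :: nat \<Rightarrow> real.
        (\<forall>i < min n p. 0 \<le> s i) \<and> (\<forall>i j. i \<le> j \<and> j < min n p \<longrightarrow> s j \<le> s i) \<and>
        \<Sigma> = mat n p (\<lambda>(i, j). if i = j then complex_of_real (s i) else 0)) \<and>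
     X = U * \<Sigma> * V\<^sup>H"

definition left_cols :: "nat \<Rightarrow> complex mat \<Rightarrow> complex mat" where
  "left_cols r U = mat (dim_row U) r (\<lambda>(i, j). U $$ (i, j))"

definition right_cols :: "nat \<Rightarrow> complex mat \<Rightarrow> complex mat" where
  "right_cols r U = mat (dim_row U) (dim_col U - r) (\<lambda>(i, j). U $$ (i, j + r))"

subsection \<open>Scalar products, Jordan and Lie algebras\<close>

datatype sp_kind = Bilinear | Sesquilinear

fun star_mat :: "sp_kind \<Rightarrow> complex mat \<Rightarrow> complex mat" where
  "star_mat Bilinear A = A\<^sup>T"
| "star_mat Sesquilinear A = A\<^sup>H"

definition scalar_product :: "complex set \<Rightarrow> nat \<Rightarrow> sp_kind \<Rightarrow> complex mat \<Rightarrow> bool" where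
  "scalar_product \<KK> n k M \<longleftrightarrow>
     M \<in> kmat \<KK> n n \<and> unitary_mat M \<and> (star_mat k M = M \<or> star_mat k M = - M) \<and>
     (k = Sesquilinear \<longrightarrow> \<KK> = UNIV)"

definition sp_adjoint :: "sp_kind \<Rightarrow> complex mat \<Rightarrow> complex mat \<Rightarrow> complex mat" where
  "sp_adjoint k M A = inv_mat M * star_mat k A * M"

definition Lie_alg :: "complex set \<Rightarrow> nat \<Rightarrow> sp_kind \<Rightarrow> complex mat \<Rightarrow> complex mat set" where
  "Lie_alg \<KK> n k M = {A \<in> kmat \<KK> n n. sp_adjoint k M A = - A}"

definition Jordan_alg :: "complex set \<Rightarrow> nat \<Rightarrow> sp_kind \<Rightarrow> complex mat \<Rightarrow> complex mat set" where
  "Jordan_alg \<KK> n k M = {A \<in> kmat \<KK> n n. sp_adjoint k M A = A}"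

definition lmult :: "complex mat \<Rightarrow> complex mat set \<Rightarrow> complex mat set" where
  "lmult M \<S> = (\<lambda>A. M * A) ` \<S>"

definition sym_mats :: "complex set \<Rightarrow> nat \<Rightarrow> complex mat set" where
  "sym_mats \<KK> n = {A \<in> kmat \<KK> n n. A\<^sup>T = A}"

definition skew_sym_mats :: "complex set \<Rightarrow> nat \<Rightarrow> complex mat set" where
  "skew_sym_mats \<KK> n = {A \<in> kmat \<KK> n n. A\<^sup>T = - A}"

definition Herm_mats :: "nat \<Rightarrow> complex mat set" where
  "Herm_mats n = {A \<in> carrier_mat n n. A\<^sup>H = A}"

definition skew_Herm_mats :: "nat \<Rightarrow> complex mat set" where
  "skew_Herm_mats n = {A \<in> carrier_mat n n. A\<^sup>H = - A}"

subsection \<open>The structured Procrustes problem\<close>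

definition proc_sols :: "complex mat set \<Rightarrow> complex mat \<Rightarrow> complex mat \<Rightarrow> complex mat set" where
  "proc_sols \<S> X B = {A \<in> \<S>. A * X = B}"

definition proc_dist ::
  "(complex mat \<Rightarrow> real) \<Rightarrow> complex mat set \<Rightarrow> complex mat \<Rightarrow> complex mat \<Rightarrow> real"
where
  "proc_dist \<nu> \<S> X B = Inf (\<nu> ` proc_sols \<S> X B)"

text \<open>
  The argument \<open>W\<close> stands for the set \<open>M\<S>\<close>; it only decides which formula is used when
  \<open>X\<^sup>*B\<close> is both \<open>*\<close>-symmetric and \<open>*\<close>-skew-symmetric, i.e.\ when \<open>X\<^sup>*B = 0\<close>.
\<close>

definition proc_map ::
  "complex set \<Rightarrow> nat \<Rightarrow> complex mat set \<Rightarrow> sp_kind \<Rightarrow> complex mat \<Rightarrow> complex mat \<Rightarrow> complex mat"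
where
  "proc_map \<KK> n W k X B =
    (let G = star_mat k X * B;
         is_sym = (star_mat k G = G);
         is_skew = (star_mat k G = - G);
         F1 = B * X\<^sup>\<dagger> + star_mat k (B * X\<^sup>\<dagger>) - star_mat k (X\<^sup>\<dagger>) * G * X\<^sup>\<dagger>;
         F2 = B * X\<^sup>\<dagger> - star_mat k (B * X\<^sup>\<dagger>) - star_mat k (X\<^sup>\<dagger>) * G * X\<^sup>\<dagger>
     in if is_sym \<and> is_skew then (if W \<in> {sym_mats \<KK> n, Herm_mats n} then F1 else F2)
        else if is_sym then F1
        else if is_skew then F2
        else B * X\<^sup>\<dagger>)"

end

theory Submission
  imports Defs "Jordan_Normal_Form.Spectral_Radius"
begin

text \<open>
  Multiplication by the unitary matrix \<open>M\<close> preserves both norms and turns the structure into \<open>H\<^sup>* = \<plusminus>H\<close> for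
  \<open>H = M A\<close>. With \<open>P = X X\<^sup>\<dagger>\<close>, the equation \<open>A X = B\<close> prescribes \<open>H P\<close> and, by the symmetry of \<open>H\<close>, also
  \<open>P\<^sup>* H\<close>; only the block \<open>(1 - P)\<^sup>* H (1 - P)\<close> is free. The blocks are orthogonal for the Frobenius inner
  product, so the unique Frobenius minimiser has free block zero. For the spectral norm,
  \<open>\<parallel>H P\<parallel> = \<mu>\<close> is a lower bound, and the Davis--Kahan--Weinberger completion of the free block attains it.
\<close>

section \<open>Matrix algebra with dimension side conditions\<close>

text \<open>The matrix under the inverse square root may be singular. The (2,1) block then has to be
  factored as \<open>Y * S\<close> through a pseudoinverse, and it is the domination of
  \<open>B\<close> by \<open>S\<close> that makes this factorisation exact and \<open>Y\<close> a
  contraction. The symmetry of \<open>H\<close> supplies the rest: the (1,2) block is the mirror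
  image of \<open>Y * S\<close>, so the defect operators of the two sides are \<open>cj k\<close>
  images of each other, and the completed block stays in the class as soon as \<open>Z\<close> does.

  Real scalars are treated inside complex matrices as invariance under conjugation. Pseudoinverses
  and positive roots are unique, hence commute with conjugation, so a minimiser built from real data
  is real without a separate real spectral theorem.

  The statement selects its cases by the set \<open>lmult M \<S>\<close>, not by the kind of the
  form, and one set can carry two names. Sign and kind are recovered from membership of two test
  matrices, the identity and \<i> times the identity.\<close>

lemma adjoint_dim [simp]: "dim_row (A\<^sup>H) = dim_col A" "dim_col (A\<^sup>H) = dim_row A"
  by (auto simp: mat_adjoint_def)

lemma adjoint_carrier [simp]: "A \<in> carrier_mat n m \<Longrightarrow> A\<^sup>H \<in> carrier_mat m n"
  by (intro carrier_matI) auto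

lemma adjoint_index [simp]:
  fixes A :: "complex mat"
  shows "i < dim_col A \<Longrightarrow> j < dim_row A \<Longrightarrow> A\<^sup>H $$ (i, j) = cnj (A $$ (j, i))"
  by (simp add: mat_adjoint_def mat_of_rows_def)

lemma mult_index:
  "i < dim_row A \<Longrightarrow> j < dim_col B \<Longrightarrow> dim_col A = dim_row B \<Longrightarrow>
    (A * B) $$ (i, j) = (\<Sum>l<dim_col A. A $$ (i, l) * B $$ (l, j))"
  by (auto simp: scalar_prod_def lessThan_atLeast0 intro!: sum.cong)

lemma adjoint_mult:
  fixes A :: "complex mat"
  assumes "dim_col A = dim_row B"
  shows "(A * B)\<^sup>H = B\<^sup>H * A\<^sup>H"
  using assms
  by (intro eq_matI) (auto simp: mult_index mult.commute simp del: index_mult_mat(1) intro!: sum.cong)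

lemma adjoint_adjoint [simp]: "(A\<^sup>H)\<^sup>H = (A :: complex mat)"
  by (intro eq_matI) auto

lemma adjoint_add:
  fixes A :: "complex mat"
  shows "dim_row A = dim_row B \<Longrightarrow> dim_col A = dim_col B \<Longrightarrow> (A + B)\<^sup>H = A\<^sup>H + B\<^sup>H"
  by (intro eq_matI) auto

lemma adjoint_minus:
  fixes A :: "complex mat"
  shows "dim_row A = dim_row B \<Longrightarrow> dim_col A = dim_col B \<Longrightarrow> (A - B)\<^sup>H = A\<^sup>H - B\<^sup>H"
  by (intro eq_matI) auto

lemma adjoint_smult: "(c \<cdot>\<^sub>m A)\<^sup>H = cnj c \<cdot>\<^sub>m A\<^sup>H"
  by (intro eq_matI) auto

lemma adjoint_one [simp]: "(1\<^sub>m n :: complex mat)\<^sup>H = 1\<^sub>m n"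
  by (intro eq_matI) auto

lemma adjoint_zero [simp]: "(0\<^sub>m n m :: complex mat)\<^sup>H = 0\<^sub>m m n"
  by (intro eq_matI) auto

section \<open>Ring laws of matrices under equations between dimensions\<close>

lemma mult_assoc_dim:
  fixes A :: "complex mat"
  shows "dim_col A = dim_row B \<Longrightarrow> dim_col B = dim_row C \<Longrightarrow> A * B * C = A * (B * C)"
  by (rule assoc_mult_mat[of _ "dim_row A" "dim_col A" _ "dim_col B" _ "dim_col C"]) auto

lemma add_mult_dim:
  fixes A :: "complex mat"
  shows "dim_row A = dim_row B \<Longrightarrow> dim_col A = dim_col B \<Longrightarrow> dim_col A = dim_row C \<Longrightarrow>
    (A + B) * C = A * C + B * C"
  by (rule add_mult_distrib_mat[of _ "dim_row A" "dim_col A" _ _ "dim_col C"]) auto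

lemma mult_add_dim:
  fixes A :: "complex mat"
  shows "dim_row B = dim_row C \<Longrightarrow> dim_col B = dim_col C \<Longrightarrow> dim_col A = dim_row B \<Longrightarrow>
    A * (B + C) = A * B + A * C"
  by (rule mult_add_distrib_mat[of _ "dim_row A" "dim_col A" _ "dim_col C"]) auto

lemma minus_mult_dim:
  fixes A :: "complex mat"
  shows "dim_row A = dim_row B \<Longrightarrow> dim_col A = dim_col B \<Longrightarrow> dim_col A = dim_row C \<Longrightarrow>
    (A - B) * C = A * C - B * C"
  by (rule minus_mult_distrib_mat[of _ "dim_row A" "dim_col A" _ _ "dim_col C"]) auto

lemma mult_minus_dim:
  fixes A :: "complex mat"
  shows "dim_row B = dim_row C \<Longrightarrow> dim_col B = dim_col C \<Longrightarrow> dim_col A = dim_row B \<Longrightarrow>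
    A * (B - C) = A * B - A * C"
  by (rule mult_minus_distrib_mat[of _ "dim_row A" "dim_col A" _ "dim_col C"]) auto

lemma smult_mult_dim:
  fixes A :: "complex mat"
  shows "dim_col A = dim_row B \<Longrightarrow> (c \<cdot>\<^sub>m A) * B = c \<cdot>\<^sub>m (A * B)"
  by (rule mult_smult_assoc_mat[of _ "dim_row A" "dim_col A" _ "dim_col B"]) auto

lemma mult_smult_dim:
  fixes A :: "complex mat"
  shows "dim_col A = dim_row B \<Longrightarrow> A * (c \<cdot>\<^sub>m B) = c \<cdot>\<^sub>m (A * B)"
  by (rule mult_smult_distrib[of _ "dim_row A" "dim_col A" _ "dim_col B"]) auto

lemma smult_add_dim:
  fixes A :: "complex mat"
  shows "dim_row A = dim_row B \<Longrightarrow> dim_col A = dim_col B \<Longrightarrow>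
    c \<cdot>\<^sub>m (A + B) = c \<cdot>\<^sub>m A + c \<cdot>\<^sub>m B"
  by (intro eq_matI) (auto simp: algebra_simps)

lemma smult_minus_dim:
  fixes A :: "complex mat"
  shows "dim_row A = dim_row B \<Longrightarrow> dim_col A = dim_col B \<Longrightarrow>
    c \<cdot>\<^sub>m (A - B) = c \<cdot>\<^sub>m A - c \<cdot>\<^sub>m B"
  by (intro eq_matI) (auto simp: algebra_simps)

lemma smult_smult_mat: "a \<cdot>\<^sub>m (b \<cdot>\<^sub>m A) = (a * b :: complex) \<cdot>\<^sub>m A"
  by (intro eq_matI) auto

lemma one_smult_mat [simp]: "(1 :: complex) \<cdot>\<^sub>m A = A"
  by (intro eq_matI) auto

lemma uminus_mat_smult: "- A = (- 1 :: complex) \<cdot>\<^sub>m A"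
  by (intro eq_matI) auto

lemma one_mult_dim [simp]:
  fixes A :: "complex mat"
  shows "dim_row A = n \<Longrightarrow> 1\<^sub>m n * A = A" "dim_col A = n \<Longrightarrow> A * 1\<^sub>m n = A"
  by (auto intro: left_mult_one_mat right_mult_one_mat)

lemma zero_mult_dim [simp]:
  fixes A :: "complex mat"
  shows "dim_row A = m \<Longrightarrow> 0\<^sub>m n m * A = 0\<^sub>m n (dim_col A)"
    "dim_col A = n \<Longrightarrow> A * 0\<^sub>m n m = 0\<^sub>m (dim_row A) m"
  by (auto intro: left_mult_zero_mat right_mult_zero_mat)

lemma minus_self_dim [simp]:
  fixes A :: "complex mat"
  shows "dim_row A = n \<Longrightarrow> dim_col A = m \<Longrightarrow> A - A = 0\<^sub>m n m"
  by (intro eq_matI) auto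

lemma add_zero_dim [simp]:
  fixes A :: "complex mat"
  shows "dim_row A = n \<Longrightarrow> dim_col A = m \<Longrightarrow> A + 0\<^sub>m n m = A"
  by (intro eq_matI) auto

lemma minus_eq_zero_mat:
  fixes A :: "complex mat"
  assumes "A - B = 0\<^sub>m n m" "dim_row A = dim_row B" "dim_col A = dim_col B"
  shows "A = B"
proof (rule eq_matI)
  fix i j assume ij: "i < dim_row B" "j < dim_col B"
  have "(A - B) $$ (i, j) = 0"
    using assms ij by (metis index_minus_mat(2,3) index_zero_mat)
  then show "A $$ (i, j) = B $$ (i, j)" using ij by simp
qed (use assms in auto)

lemmas mat_expand =
  mult_assoc_dim add_mult_dim mult_add_dim minus_mult_dim mult_minus_dim
  smult_mult_dim mult_smult_dim smult_add_dim smult_minus_dim smult_smult_mat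
  adjoint_mult adjoint_add adjoint_minus adjoint_smult

section \<open>Matrix-vector products\<close>

lemma mult_mat_vec_assoc_dim:
  fixes A :: "complex mat"
  shows "dim_col A = dim_row B \<Longrightarrow> dim_vec x = dim_col B \<Longrightarrow> (A * B) *\<^sub>v x = A *\<^sub>v (B *\<^sub>v x)"
  by (rule assoc_mult_mat_vec[of _ "dim_row A" "dim_col A" _ "dim_col B"]) (auto intro: carrier_vecI)

lemma add_mult_mat_vec_dim:
  fixes A :: "complex mat"
  shows "dim_row A = dim_row B \<Longrightarrow> dim_col A = dim_col B \<Longrightarrow> dim_vec x = dim_col B \<Longrightarrow>
    (A + B) *\<^sub>v x = A *\<^sub>v x + B *\<^sub>v x"
  by (rule add_mult_distrib_mat_vec[of _ "dim_row A" "dim_col A"]) (auto intro: carrier_vecI)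

lemma minus_mult_mat_vec_dim:
  fixes A :: "complex mat"
  shows "dim_row A = dim_row B \<Longrightarrow> dim_col A = dim_col B \<Longrightarrow> dim_vec x = dim_col B \<Longrightarrow>
    (A - B) *\<^sub>v x = A *\<^sub>v x - B *\<^sub>v x"
  by (rule minus_mult_distrib_mat_vec[of _ "dim_row A" "dim_col A"]) (auto intro: carrier_vecI)

lemma mult_mat_vec_add_dim:
  fixes A :: "complex mat"
  shows "dim_vec x = dim_col A \<Longrightarrow> dim_vec y = dim_col A \<Longrightarrow>
    A *\<^sub>v (x + y) = A *\<^sub>v x + A *\<^sub>v y"
  by (rule mult_add_distrib_mat_vec[of _ "dim_row A" "dim_col A"]) (auto intro: carrier_vecI)

lemma mult_mat_vec_minus_dim:
  fixes A :: "complex mat"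
  shows "dim_vec x = dim_col A \<Longrightarrow> dim_vec y = dim_col A \<Longrightarrow>
    A *\<^sub>v (x - y) = A *\<^sub>v x - A *\<^sub>v y"
  by (rule mult_minus_distrib_mat_vec[of _ "dim_row A" "dim_col A"]) (auto intro: carrier_vecI)

lemma smult_mult_mat_vec_dim:
  fixes A :: "complex mat"
  shows "dim_vec x = dim_col A \<Longrightarrow> (c \<cdot>\<^sub>m A) *\<^sub>v x = c \<cdot>\<^sub>v (A *\<^sub>v x)"
  by (intro eq_vecI) (auto simp: scalar_prod_def sum_distrib_left mult.assoc intro!: sum.cong)

lemma mult_mat_vec_smult_dim:
  fixes A :: "complex mat"
  shows "dim_vec x = dim_col A \<Longrightarrow> A *\<^sub>v (c \<cdot>\<^sub>v x) = c \<cdot>\<^sub>v (A *\<^sub>v x)"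
  by (rule mult_mat_vec[of _ "dim_row A" "dim_col A"]) (auto intro: carrier_vecI)

lemma one_mult_mat_vec_dim [simp]: "dim_vec (x :: complex vec) = n \<Longrightarrow> 1\<^sub>m n *\<^sub>v x = x"
  by (rule one_mult_mat_vec) (auto intro: carrier_vecI)

lemmas vec_expand =
  mult_mat_vec_assoc_dim add_mult_mat_vec_dim minus_mult_mat_vec_dim mult_mat_vec_add_dim
  mult_mat_vec_minus_dim smult_mult_mat_vec_dim mult_mat_vec_smult_dim

text \<open>The Euclidean inner product of the underlying real space. It is symmetric, so squared
  norms expand with a single real cross term.\<close>

definition rip :: "complex vec \<Rightarrow> complex vec \<Rightarrow> real" where
  "rip x y = Re (x \<bullet>c y)"

lemma rip_sum: "dim_vec x = dim_vec y \<Longrightarrow> rip x y = (\<Sum>i<dim_vec x. Re (x $ i * cnj (y $ i)))"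
  by (simp add: rip_def scalar_prod_def lessThan_atLeast0)

lemma rip_commute: "dim_vec x = dim_vec y \<Longrightarrow> rip x y = rip y x"
  by (simp add: rip_sum algebra_simps)

lemma rip_add:
  "dim_vec x = dim_vec y \<Longrightarrow> dim_vec z = dim_vec y \<Longrightarrow> rip (x + y) z = rip x z + rip y z"
  "dim_vec x = dim_vec y \<Longrightarrow> dim_vec z = dim_vec y \<Longrightarrow> rip z (x + y) = rip z x + rip z y"
  by (auto simp: rip_sum algebra_simps sum.distrib)

lemma rip_minus:
  "dim_vec x = dim_vec y \<Longrightarrow> dim_vec z = dim_vec y \<Longrightarrow> rip (x - y) z = rip x z - rip y z"
  "dim_vec x = dim_vec y \<Longrightarrow> dim_vec z = dim_vec y \<Longrightarrow> rip z (x - y) = rip z x - rip z y"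
  by (auto simp: rip_sum algebra_simps sum.distrib sum_subtractf)

lemma rip_smult:
  "dim_vec x = dim_vec y \<Longrightarrow> rip (complex_of_real c \<cdot>\<^sub>v x) y = c * rip x y"
  "dim_vec x = dim_vec y \<Longrightarrow> rip y (complex_of_real c \<cdot>\<^sub>v x) = c * rip y x"
  by (auto simp: rip_sum algebra_simps sum_distrib_left)

lemma rip_adjoint:
  assumes "dim_vec x = dim_col A" "dim_vec y = dim_row A"
  shows "rip (A *\<^sub>v x) y = rip x (A\<^sup>H *\<^sub>v y)"
proof -
  have "rip (A *\<^sub>v x) y = (\<Sum>i<dim_row A. \<Sum>j<dim_col A. Re (A $$ (i, j) * x $ j * cnj (y $ i)))"
    using assms
    by (simp add: rip_sum scalar_prod_def sum_distrib_right lessThan_atLeast0 flip: Re_sum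
        del: times_complex.sel)
  also have "\<dots> = (\<Sum>j<dim_col A. \<Sum>i<dim_row A. Re (A $$ (i, j) * x $ j * cnj (y $ i)))"
    by (rule sum.swap)
  also have "\<dots> = rip x (A\<^sup>H *\<^sub>v y)"
    using assms
    by (simp add: rip_sum scalar_prod_def sum_distrib_left lessThan_atLeast0 mult_ac flip: Re_sum
        del: times_complex.sel)
  finally show ?thesis .
qed

abbreviation nsq :: "complex vec \<Rightarrow> real" where
  "nsq x \<equiv> rip x x"

lemma nsq_sum: "nsq x = (\<Sum>i<dim_vec x. (cmod (x $ i))\<^sup>2)"
  by (simp add: rip_sum complex_norm_square[symmetric] flip: of_real_power)

lemma nsq_nonneg [simp]: "0 \<le> nsq x"
  by (simp add: nsq_sum sum_nonneg)

lemma l2_norm_vec_nsq: "l2_norm_vec x = sqrt (nsq x)"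
  by (simp add: l2_norm_vec_def nsq_sum)

lemma nsq_eq_0: "nsq x = 0 \<longleftrightarrow> x = 0\<^sub>v (dim_vec x)"
  by (auto simp: nsq_sum sum_nonneg_eq_0_iff intro!: eq_vecI) (metis index_zero_vec(1) lessThan_iff)

lemma nsq_zero [simp]: "nsq (0\<^sub>v n) = 0"
  by (simp add: nsq_eq_0)

lemma nsq_add:
  "dim_vec x = dim_vec y \<Longrightarrow> nsq (x + y) = nsq x + 2 * rip x y + nsq y"
  by (simp add: rip_add rip_commute[of y x])

lemma nsq_minus:
  "dim_vec x = dim_vec y \<Longrightarrow> nsq (x - y) = nsq x - 2 * rip x y + nsq y"
  by (simp add: rip_minus rip_commute[of y x])

lemma nsq_smult: "nsq (complex_of_real c \<cdot>\<^sub>v x) = c\<^sup>2 * nsq x"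
  by (simp add: rip_smult power2_eq_square)

lemma nsq_smult_complex: "nsq (c \<cdot>\<^sub>v x) = (cmod c)\<^sup>2 * nsq x"
  by (simp add: nsq_sum norm_mult power_mult_distrib sum_distrib_left)

lemma nsq_mult_mat_vec:
  assumes "dim_vec x = dim_col A"
  shows "nsq (A *\<^sub>v x) = rip ((A\<^sup>H * A) *\<^sub>v x) x"
proof -
  have "nsq (A *\<^sub>v x) = rip x (A\<^sup>H *\<^sub>v (A *\<^sub>v x))"
    using assms by (intro rip_adjoint) auto
  also have "\<dots> = rip (A\<^sup>H *\<^sub>v (A *\<^sub>v x)) x"
    using assms by (intro rip_commute) auto
  finally show ?thesis using assms by (simp add: vec_expand)
qed

lemma psd_mat_iff:
  "psd_mat A \<longleftrightarrow> square_mat A \<and> A\<^sup>H = A \<and> (\<forall>x. dim_vec x = dim_row A \<longrightarrow> 0 \<le> rip (A *\<^sub>v x) x)"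
  unfolding psd_mat_def rip_def by (metis carrier_vecD carrier_vecI)

section \<open>Spectral norm bounds\<close>

lemma mat_eq_zeroI:
  fixes A :: "complex mat"
  assumes "\<And>x. dim_vec x = dim_col A \<Longrightarrow> A *\<^sub>v x = 0\<^sub>v (dim_row A)"
  shows "A = 0\<^sub>m (dim_row A) (dim_col A)"
proof (rule eq_matI)
  fix i j assume "i < dim_row (0\<^sub>m (dim_row A) (dim_col A) :: complex mat)"
    "j < dim_col (0\<^sub>m (dim_row A) (dim_col A) :: complex mat)"
  then have ij: "i < dim_row A" "j < dim_col A" by auto
  have "(A *\<^sub>v unit_vec (dim_col A) j) $ i = A $$ (i, j)"
    using ij by simp
  then show "A $$ (i, j) = 0\<^sub>m (dim_row A) (dim_col A) $$ (i, j)"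
    using assms[of "unit_vec (dim_col A) j"] ij by simp
qed auto

lemma mat_eq_zero_if_gram_zero:
  fixes A :: "complex mat"
  assumes "A\<^sup>H * A = 0\<^sub>m (dim_col A) (dim_col A)"
  shows "A = 0\<^sub>m (dim_row A) (dim_col A)"
proof (rule mat_eq_zeroI)
  fix x :: "complex vec" assume x: "dim_vec x = dim_col A"
  have "nsq (A *\<^sub>v x) = rip (0\<^sub>m (dim_col A) (dim_col A) *\<^sub>v x) x"
    by (simp only: nsq_mult_mat_vec[OF x] assms)
  also have "0\<^sub>m (dim_col A) (dim_col A) *\<^sub>v x = 0\<^sub>v (dim_col A)"
    using x by (intro eq_vecI) (auto simp: scalar_prod_def)
  also have "rip (0\<^sub>v (dim_col A)) x = 0"
    using x by (simp add: rip_sum)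
  finally show "A *\<^sub>v x = 0\<^sub>v (dim_row A)" by (simp add: nsq_eq_0)
qed

text \<open>A matrix and its Gram matrix have the same kernel: the Gram matrix of
  \<open>A * B\<close> is \<open>B\<^sup>H\<close> times the product that is assumed to
  vanish.\<close>

lemma mult_eq_zero_if_gram_mult_zero:
  fixes A :: "complex mat"
  assumes "dim_col A = dim_row B" "(A\<^sup>H * A) * B = 0\<^sub>m (dim_col A) (dim_col B)"
  shows "A * B = 0\<^sub>m (dim_row A) (dim_col B)"
proof -
  have "(A * B)\<^sup>H * (A * B) = B\<^sup>H * ((A\<^sup>H * A) * B)"
    using assms(1) by (simp add: mat_expand)
  then have "(A * B)\<^sup>H * (A * B) = 0\<^sub>m (dim_col (A * B)) (dim_col (A * B))"
    using assms by simp
  from mat_eq_zero_if_gram_zero[OF this] show ?thesis by simp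
qed

text \<open>An operator bound without a supremum, so that bounds compose by plain inequalities. Only
  the square of \<open>c\<close> enters; \<open>0 \<le> c\<close> is asked for when the bound is
  turned into one on \<open>spectral_norm\<close>.\<close>

definition l2_bound :: "real \<Rightarrow> complex mat \<Rightarrow> bool" where
  "l2_bound c A \<longleftrightarrow> (\<forall>x. dim_vec x = dim_col A \<longrightarrow> nsq (A *\<^sub>v x) \<le> c\<^sup>2 * nsq x)"

lemma l2_boundD:
  "l2_bound c A \<Longrightarrow> dim_vec x = dim_col A \<Longrightarrow> nsq (A *\<^sub>v x) \<le> c\<^sup>2 * nsq x"
  by (auto simp only: l2_bound_def)

text \<open>With \<open>y = A\<^sup>H *\<^sub>v x\<close> the cross term of
  \<open>nsq (A *\<^sub>v y - x)\<close> is \<open>nsq y\<close>, so the nonnegativity of this one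
  square gives the bound.\<close>

lemma l2_bound_adjoint:
  assumes "l2_bound 1 A"
  shows "l2_bound 1 (A\<^sup>H)"
  unfolding l2_bound_def
proof (intro allI impI)
  fix x :: "complex vec" assume "dim_vec x = dim_col (A\<^sup>H)"
  then have x: "dim_vec x = dim_row A" by simp
  define y where "y = A\<^sup>H *\<^sub>v x"
  have y: "dim_vec y = dim_col A" by (simp add: y_def)
  have "0 \<le> nsq (A *\<^sub>v y - x)" by simp
  also have "\<dots> = nsq (A *\<^sub>v y) - 2 * nsq y + nsq x"
    using x y by (simp add: nsq_minus rip_adjoint flip: y_def)
  finally have "2 * nsq y \<le> nsq (A *\<^sub>v y) + nsq x" by simp
  moreover have "nsq (A *\<^sub>v y) \<le> nsq y"
    using l2_boundD[OF assms y] by simp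
  ultimately show "nsq (A\<^sup>H *\<^sub>v x) \<le> 1\<^sup>2 * nsq x"
    unfolding y_def[symmetric] by simp
qed

lemma l2_bound_mult:
  assumes "l2_bound a A" "l2_bound b B" "dim_col A = dim_row B"
  shows "l2_bound (a * b) (A * B)"
  unfolding l2_bound_def
proof (intro allI impI)
  fix x :: "complex vec" assume x: "dim_vec x = dim_col (A * B)"
  have "nsq ((A * B) *\<^sub>v x) \<le> a\<^sup>2 * nsq (B *\<^sub>v x)"
    using l2_boundD[OF assms(1), of "B *\<^sub>v x"] assms(3) x by (simp add: vec_expand)
  also have "\<dots> \<le> a\<^sup>2 * (b\<^sup>2 * nsq x)"
    using l2_boundD[OF assms(2), of x] x by (intro mult_left_mono) simp_all
  finally show "nsq ((A * B) *\<^sub>v x) \<le> (a * b)\<^sup>2 * nsq x"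
    by (simp add: power_mult_distrib)
qed

text \<open>A crude bound from the sum of all entry moduli. Its point is boundedness: it is what
  allows the supremum in \<open>spectral_norm\<close> to dominate the individual quotients.\<close>

lemma l2_bound_exists: "\<exists>c\<ge>0. l2_bound c A"
proof -
  define a where "a = (\<Sum>i<dim_row A. \<Sum>j<dim_col A. cmod (A $$ (i, j)))"
  have "nsq (A *\<^sub>v x) \<le> (\<Sum>i<dim_row A. a\<^sup>2) * nsq x" if x: "dim_vec x = dim_col A" for x
  proof -
    have le: "cmod (x $ j) \<le> sqrt (nsq x)" if "j < dim_vec x" for j
      unfolding nsq_sum using that member_le_sum[of j "{..<dim_vec x}" "\<lambda>j. (cmod (x $ j))\<^sup>2"]
      by (intro real_le_rsqrt) auto
    have row: "cmod ((A *\<^sub>v x) $ i) \<le> a * sqrt (nsq x)" if i: "i < dim_row A" for i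
    proof -
      have "cmod ((A *\<^sub>v x) $ i) \<le> (\<Sum>j<dim_col A. cmod (A $$ (i, j)) * cmod (x $ j))"
        using i x by (auto simp: scalar_prod_def lessThan_atLeast0 norm_mult intro!: sum_norm_le)
      also have "\<dots> \<le> (\<Sum>j<dim_col A. cmod (A $$ (i, j)) * sqrt (nsq x))"
        using le x by (intro sum_mono mult_left_mono) auto
      also have "\<dots> \<le> a * sqrt (nsq x)"
        unfolding sum_distrib_right[symmetric] a_def
        using i by (intro mult_right_mono member_le_sum[of i _ "\<lambda>i. \<Sum>j<dim_col A. cmod (A $$ (i, j))"])
          (auto intro!: sum_nonneg)
      finally show ?thesis .
    qed
    have "nsq (A *\<^sub>v x) = (\<Sum>i<dim_row A. (cmod ((A *\<^sub>v x) $ i))\<^sup>2)"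
      by (simp add: nsq_sum)
    also have "\<dots> \<le> (\<Sum>i<dim_row A. (a * sqrt (nsq x))\<^sup>2)"
      using row by (intro sum_mono power_mono) auto
    finally show ?thesis by (simp add: power_mult_distrib)
  qed
  then have "l2_bound (sqrt (\<Sum>i<dim_row A. a\<^sup>2)) A"
    unfolding l2_bound_def by (simp add: sum_nonneg)
  then show ?thesis by (intro exI[of _ "sqrt (\<Sum>i<dim_row A. a\<^sup>2)"]) (simp add: sum_nonneg)
qed

lemma l2_bound_quotient:
  assumes "0 \<le> c" "l2_bound c A" "x \<in> carrier_vec (dim_col A)"
  shows "l2_norm_vec (A *\<^sub>v x) / l2_norm_vec x \<le> c"
proof (cases "nsq x = 0")
  case True
  then show ?thesis using assms by (simp add: l2_norm_vec_nsq)
next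
  case False
  then have pos: "0 < nsq x" by (simp add: less_le)
  have "sqrt (nsq (A *\<^sub>v x)) \<le> sqrt (c\<^sup>2 * nsq x)"
    using assms by (intro real_sqrt_le_mono l2_boundD) auto
  then show ?thesis
    using pos assms by (simp add: l2_norm_vec_nsq real_sqrt_mult divide_simps)
qed

lemma spectral_norm_quotient_le:
  assumes "dim_vec x = dim_col A"
  shows "l2_norm_vec (A *\<^sub>v x) / l2_norm_vec x \<le> spectral_norm A"
proof -
  obtain c where "0 \<le> c" "l2_bound c A" using l2_bound_exists by blast
  then show ?thesis
    unfolding spectral_norm_def
    using assms by (intro cSUP_upper bdd_aboveI2[where M = c] l2_bound_quotient) (auto intro: carrier_vecI)
qed

text \<open>The zero vector contributes the quotient \<open>0 / 0 = 0\<close>, also for a matrix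
  without columns.\<close>

lemma spectral_norm_nonneg [simp]: "0 \<le> spectral_norm A"
  using spectral_norm_quotient_le[of "0\<^sub>v (dim_col A)" A] by (simp add: l2_norm_vec_nsq)

lemma l2_bound_spectral_norm: "l2_bound (spectral_norm A) A"
  unfolding l2_bound_def
proof (intro allI impI)
  fix x :: "complex vec" assume x: "dim_vec x = dim_col A"
  show "nsq (A *\<^sub>v x) \<le> (spectral_norm A)\<^sup>2 * nsq x"
  proof (cases "nsq x = 0")
    case True
    then have "x = 0\<^sub>v (dim_col A)" using x by (simp add: nsq_eq_0)
    then have "A *\<^sub>v x = 0\<^sub>v (dim_row A)" by (intro eq_vecI) auto
    then show ?thesis using True by simp
  next
    case False
    then have pos: "0 < nsq x" by (simp add: less_le)
    have "sqrt (nsq (A *\<^sub>v x)) \<le> spectral_norm A * sqrt (nsq x)"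
      using spectral_norm_quotient_le[OF x] pos by (simp add: l2_norm_vec_nsq divide_simps)
    then have "(sqrt (nsq (A *\<^sub>v x)))\<^sup>2 \<le> (spectral_norm A * sqrt (nsq x))\<^sup>2"
      by (intro power_mono) auto
    then show ?thesis by (simp add: power_mult_distrib)
  qed
qed

lemma spectral_norm_le:
  assumes "0 \<le> c" "l2_bound c A"
  shows "spectral_norm A \<le> c"
  unfolding spectral_norm_def
  using assms l2_bound_quotient
  by (intro cSUP_least) (auto intro: zero_carrier_vec)

lemma spectral_norm_mult_le:
  assumes "dim_col A = dim_row B" "l2_bound 1 B"
  shows "spectral_norm (A * B) \<le> spectral_norm A"
  using l2_bound_mult[OF l2_bound_spectral_norm[of A] assms(2,1)]
  by (intro spectral_norm_le) simp_all

lemma spectral_norm_isometry_mult: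
  assumes "M\<^sup>H * M = 1\<^sub>m (dim_row A)" "dim_col M = dim_row A"
  shows "spectral_norm (M * A) = spectral_norm A"
proof -
  have "nsq ((M * A) *\<^sub>v x) = nsq (A *\<^sub>v x)" if "dim_vec x = dim_col A" for x
    using that assms by (simp add: vec_expand nsq_mult_mat_vec[of "A *\<^sub>v x" M])
  then have "l2_norm_vec ((M * A) *\<^sub>v x) / l2_norm_vec x = l2_norm_vec (A *\<^sub>v x) / l2_norm_vec x"
    if "x \<in> carrier_vec (dim_col A)" for x
    using that by (simp add: l2_norm_vec_nsq)
  then show ?thesis unfolding spectral_norm_def by (intro SUP_cong) simp_all
qed

lemma spectral_norm_smult:
  assumes "cmod c = 1"
  shows "spectral_norm (c \<cdot>\<^sub>m A) = spectral_norm A"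
proof -
  have "l2_norm_vec ((c \<cdot>\<^sub>m A) *\<^sub>v x) / l2_norm_vec x = l2_norm_vec (A *\<^sub>v x) / l2_norm_vec x"
    if "x \<in> carrier_vec (dim_col A)" for x
    using that assms by (simp add: l2_norm_vec_nsq vec_expand nsq_smult_complex)
  then show ?thesis unfolding spectral_norm_def by (intro SUP_cong) simp_all
qed

section \<open>Spectral theorem and square roots\<close>

text \<open>The block diagonal matrix \<open>diag(a, X)\<close>, the shape reached when one
  eigenvalue is split off.\<close>

definition border :: "complex \<Rightarrow> complex mat \<Rightarrow> complex mat" where
  "border a X = mat (Suc (dim_row X)) (Suc (dim_col X))
     (\<lambda>(i, j). if i = 0 \<and> j = 0 then a else if i = 0 \<or> j = 0 then 0 else X $$ (i - 1, j - 1))"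

lemma border_dim [simp]: "dim_row (border a X) = Suc (dim_row X)" "dim_col (border a X) = Suc (dim_col X)"
  by (simp_all add: border_def)

lemma border_mult:
  assumes "dim_col X = dim_row Y"
  shows "border a X * border b Y = border (a * b) (X * Y)"
proof (rule eq_matI)
  fix i j assume ij: "i < dim_row (border (a * b) (X * Y))" "j < dim_col (border (a * b) (X * Y))"
  show "(border a X * border b Y) $$ (i, j) = border (a * b) (X * Y) $$ (i, j)"
    using ij assms
    by (cases i; cases j)
      (auto simp: mult_index border_def sum.lessThan_Suc_shift simp del: index_mult_mat(1) sum.lessThan_Suc)
qed auto

lemma border_adjoint: "(border a X)\<^sup>H = border (cnj a) (X\<^sup>H)"
  by (intro eq_matI) (auto simp: border_def)

lemma border_one: "border 1 (1\<^sub>m n) = 1\<^sub>m (Suc n)"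
  by (intro eq_matI) (auto simp: border_def)

lemma border_diag: "border a (mat_diag n f) = mat_diag (Suc n) (case_nat a f)"
  by (intro eq_matI) (auto simp: border_def mat_diag_def split: nat.split)

lemma mat_diag_dims [simp]: "dim_row (mat_diag n f) = n" "dim_col (mat_diag n f) = n"
  by (simp_all add: mat_diag_def)

lemma mat_diag_adjoint_real: "(mat_diag n (\<lambda>i. complex_of_real (d i)))\<^sup>H = mat_diag n (\<lambda>i. complex_of_real (d i))"
  by (intro eq_matI) (auto simp: mat_diag_def)

lemma self_cscalar_prod: "x \<bullet>c x = complex_of_real (nsq x)"
proof -
  have "x \<bullet>c x = (\<Sum>i<dim_vec x. x $ i * cnj (x $ i))"
    by (simp add: scalar_prod_def lessThan_atLeast0)
  then show ?thesis by (simp add: nsq_sum complex_norm_square del: of_real_power)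
qed

text \<open>Complete \<open>v\<close> to a basis, orthogonalise starting from \<open>v\<close>, and
  normalise the columns. The first column is then proportional to \<open>v\<close>, which is all
  that an eigenvector has to satisfy.\<close>

lemma unitary_extension:
  fixes v :: "complex vec"
  assumes v: "v \<in> carrier_vec n" "v \<noteq> 0\<^sub>v n" and n: "0 < n"
  shows "\<exists>W \<in> carrier_mat n n. W\<^sup>H * W = 1\<^sub>m n \<and> W * W\<^sup>H = 1\<^sub>m n \<and> (\<exists>c. col W 0 = c \<cdot>\<^sub>v v)"
proof -
  interpret cof_vec_space n "TYPE(complex)" .
  define b where "b = basis_completion v"
  from basis_completion[OF v, folded b_def]
  have dist_b: "distinct b" and indep: "\<not> lin_dep (set b)" and b: "set b \<subseteq> carrier_vec n"
    and hdb: "hd b = v" and len_b: "length b = n" by auto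
  from hdb len_b n obtain vs where bv: "b = v # vs" by (cases b) auto
  define ws where "ws = gram_schmidt n b"
  from gram_schmidt_result[OF b dist_b indep refl, folded ws_def]
  have ws: "set ws \<subseteq> carrier_vec n" "corthogonal ws" "length ws = n" by (auto simp: len_b)
  have hdws: "hd ws = v" unfolding ws_def using gram_schmidt_hd[OF v(1), of vs, folded bv] .
  have dim: "dim_vec (ws ! i) = n" if "i < n" for i
    using ws that by (metis carrier_vecD nth_mem subsetD)
  define c where "c i = complex_of_real (1 / sqrt (nsq (ws ! i)))" for i
  define W where "W = mat n n (\<lambda>(i, j). c j * (ws ! j) $ i)"
  have W: "W \<in> carrier_mat n n" by (simp add: W_def)
  have WW: "W\<^sup>H * W = 1\<^sub>m n"
  proof (rule eq_matI)
    fix i j assume "i < dim_row (1\<^sub>m n :: complex mat)" "j < dim_col (1\<^sub>m n :: complex mat)"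
    then have ij: "i < n" "j < n" by auto
    have "(W\<^sup>H * W) $$ (i, j) = (\<Sum>l<n. c i * c j * ((ws ! j) $ l * cnj ((ws ! i) $ l)))"
      using ij by (auto simp: mult_index W_def c_def mult_ac simp del: index_mult_mat(1) intro!: sum.cong)
    also have "\<dots> = c i * c j * (ws ! j \<bullet>c ws ! i)"
      using ij dim by (simp add: scalar_prod_def lessThan_atLeast0 sum_distrib_left)
    also have "\<dots> = (if i = j then 1 else 0)"
    proof (cases "i = j")
      case True
      have ne: "nsq (ws ! i) \<noteq> 0"
        using corthogonalD[OF ws(2), of i i] ij ws(3) by (auto simp: self_cscalar_prod)
      then have "c i * c i * complex_of_real (nsq (ws ! i)) = 1"
        unfolding c_def of_real_mult[symmetric] by (simp add: divide_simps)
      then show ?thesis using True by (simp add: self_cscalar_prod)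
    next
      case False
      then show ?thesis using corthogonalD[OF ws(2), of j i] ij ws(3) by auto
    qed
    finally show "(W\<^sup>H * W) $$ (i, j) = 1\<^sub>m n $$ (i, j)" using ij by simp
  qed (simp_all add: W_def)
  have "W * W\<^sup>H = 1\<^sub>m n"
    by (rule mat_mult_left_right_inverse[OF _ W WW]) (use W in simp)
  moreover have "ws ! 0 = v" using hdws n ws(3) by (metis hd_conv_nth length_greater_0_conv)
  then have "col W 0 = c 0 \<cdot>\<^sub>v v"
    using n v by (intro eq_vecI) (auto simp: W_def)
  ultimately show ?thesis using W WW by blast
qed

text \<open>Deflation: in a unitary basis beginning with an eigenvector, the first column of the
  matrix vanishes below the corner. By Hermitian symmetry the first row vanishes beside it, and the
  remaining block is Hermitian and smaller by one.\<close>

theorem hermitian_diagonalization: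
  assumes "A \<in> carrier_mat n n" "A\<^sup>H = A"
  shows "\<exists>V d. V \<in> carrier_mat n n \<and> V\<^sup>H * V = 1\<^sub>m n \<and> V * V\<^sup>H = 1\<^sub>m n \<and>
    A = V * mat_diag n (\<lambda>i. complex_of_real (d i)) * V\<^sup>H"
  using assms
proof (induction n arbitrary: A)
  case 0
  then show ?case by (intro exI[of _ "1\<^sub>m 0"]) (auto intro!: eq_matI)
next
  case (Suc n)
  note A = Suc.prems(1)
  then have dA [simp]: "dim_row A = Suc n" "dim_col A = Suc n" by auto
  from spectrum_non_empty[OF A] obtain e where "eigenvalue A e" by (auto simp: spectrum_def)
  then obtain v where v: "v \<in> carrier_vec (Suc n)" "v \<noteq> 0\<^sub>v (Suc n)" "A *\<^sub>v v = e \<cdot>\<^sub>v v"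
    by (auto simp: eigenvalue_def eigenvector_def)
  from unitary_extension[OF v(1,2)] obtain W c where W: "W \<in> carrier_mat (Suc n) (Suc n)"
    and WW: "W\<^sup>H * W = 1\<^sub>m (Suc n)" "W * W\<^sup>H = 1\<^sub>m (Suc n)" and c: "col W 0 = c \<cdot>\<^sub>v v" by auto
  have dW [simp]: "dim_row W = Suc n" "dim_col W = Suc n" using W by auto
  have dv: "dim_vec v = Suc n" using v by auto
  define A' where "A' = W\<^sup>H * (A * W)"
  have dA' [simp]: "dim_row A' = Suc n" "dim_col A' = Suc n" by (simp_all add: A'_def)
  have A'H: "A'\<^sup>H = A'" unfolding A'_def by (simp add: mat_expand Suc.prems(2))
  have AW: "(A * W) $$ (i, 0) = e * W $$ (i, 0)" if "i < Suc n" for i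
  proof -
    have "(A * W) $$ (i, 0) = (A *\<^sub>v col W 0) $ i" using that by simp
    also have "A *\<^sub>v col W 0 = e \<cdot>\<^sub>v col W 0"
      unfolding c using v dv by (simp add: vec_expand smult_smult_assoc mult.commute)
    finally show ?thesis using that by simp
  qed
  have col0: "A' $$ (i, 0) = (if i = 0 then e else 0)" if "i < Suc n" for i
  proof -
    have "A' $$ (i, 0) = (\<Sum>l<Suc n. W\<^sup>H $$ (i, l) * (e * W $$ (l, 0)))"
      using that unfolding A'_def
      by (subst mult_index) (auto simp del: index_mult_mat(1) simp: AW intro!: sum.cong)
    also have "\<dots> = e * (W\<^sup>H * W) $$ (i, 0)"
      using that by (subst mult_index) (auto simp: sum_distrib_left mult_ac simp del: index_mult_mat(1) sum.lessThan_Suc intro!: sum.cong)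
    finally show ?thesis using that by (simp add: WW)
  qed
  have A'sym: "A' $$ (i, j) = cnj (A' $$ (j, i))" if "i < Suc n" "j < Suc n" for i j
    using that adjoint_index[of i A' j] A'H by simp
  have row0: "A' $$ (0, Suc j) = 0" if "j < n" for j
    using A'sym[of 0 "Suc j"] col0[of "Suc j"] that by simp
  define A3 where "A3 = mat n n (\<lambda>(i, j). A' $$ (Suc i, Suc j))"
  have A'b: "A' = border e A3"
  proof (rule eq_matI)
    fix i j assume "i < dim_row (border e A3)" "j < dim_col (border e A3)"
    then show "A' $$ (i, j) = border e A3 $$ (i, j)"
      using col0[of i] row0
      by (cases i; cases j) (auto simp: border_def A3_def)
  qed (simp_all add: A3_def)
  have "A3\<^sup>H = A3"
    by (intro eq_matI) (simp_all add: A3_def flip: A'sym)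
  with Suc.IH[of A3] obtain V3 d3 where V3: "V3 \<in> carrier_mat n n" "V3\<^sup>H * V3 = 1\<^sub>m n" "V3 * V3\<^sup>H = 1\<^sub>m n"
    and A3: "A3 = V3 * mat_diag n (\<lambda>i. complex_of_real (d3 i)) * V3\<^sup>H" by (auto simp: A3_def)
  have dV3 [simp]: "dim_row V3 = n" "dim_col V3 = n" using V3 by auto
  \<comment> \<open>The corner is a diagonal entry of the Hermitian matrix \<open>A'\<close>, hence
    real, as the diagonal of the result must be.\<close>
  have e: "e = complex_of_real (Re e)"
  proof -
    have "e = cnj e" using col0[of 0] A'sym[of 0 0] by (metis zero_less_Suc)
    then have "Im e = - Im e" by (metis complex_cnj_cancel_iff cnj.sel(2))
    then show ?thesis by (simp add: complex_eq_iff)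
  qed
  define B where "B = border 1 V3"
  have dB [simp]: "dim_row B = Suc n" "dim_col B = Suc n" by (simp_all add: B_def)
  have BB: "B\<^sup>H * B = 1\<^sub>m (Suc n)" "B * B\<^sup>H = 1\<^sub>m (Suc n)"
    by (simp_all add: B_def border_adjoint border_mult V3 border_one)
  define V where "V = W * B"
  define D where "D = mat_diag (Suc n) (\<lambda>i. complex_of_real (case_nat (Re e) d3 i))"
  have D: "D = border e (mat_diag n (\<lambda>i. complex_of_real (d3 i)))"
    unfolding border_diag D_def using e by (auto simp: mat_diag_def split: nat.split intro!: eq_matI)
  have dD [simp]: "dim_row D = Suc n" "dim_col D = Suc n" by (simp_all add: D_def)
  have "A' = B * D * B\<^sup>H"
    by (simp add: A'b D B_def border_adjoint border_mult A3)
  have cancel: "W * (W\<^sup>H * X) = X" "W\<^sup>H * (W * X) = X" "B * (B\<^sup>H * X) = X" "B\<^sup>H * (B * X) = X"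
    if "dim_row X = Suc n" for X
    using that by (simp_all add: WW BB flip: mult_assoc_dim)
  have "A = W * A' * W\<^sup>H" by (simp add: A'_def mat_expand cancel WW)
  also have "\<dots> = V * D * V\<^sup>H" by (simp add: \<open>A' = B * D * B\<^sup>H\<close> V_def mat_expand)
  finally have "A = V * D * V\<^sup>H" .
  moreover have "V \<in> carrier_mat (Suc n) (Suc n)" by (intro carrier_matI) (simp_all add: V_def)
  moreover have "V\<^sup>H * V = 1\<^sub>m (Suc n)" "V * V\<^sup>H = 1\<^sub>m (Suc n)"
    by (simp_all add: V_def mat_expand cancel WW BB)
  ultimately show ?case unfolding D_def by blast
qed

text \<open>At a unit vector the form of \<open>V\<^sup>H * (A * V)\<close> is a diagonal entry and
  also a value of the form of \<open>A\<close>, so the eigenvalues are nonnegative.\<close>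

lemma psd_diagonalization:
  assumes A: "A \<in> carrier_mat n n" and psd: "psd_mat A"
  obtains V d where "V \<in> carrier_mat n n" "V\<^sup>H * V = 1\<^sub>m n" "V * V\<^sup>H = 1\<^sub>m n"
    "A = V * mat_diag n (\<lambda>i. complex_of_real (d i)) * V\<^sup>H" "\<And>i. i < n \<Longrightarrow> 0 \<le> d i"
proof -
  have "A\<^sup>H = A" using psd by (simp add: psd_mat_def)
  from hermitian_diagonalization[OF A this] obtain V d where V: "V \<in> carrier_mat n n"
    and VV: "V\<^sup>H * V = 1\<^sub>m n" "V * V\<^sup>H = 1\<^sub>m n"
    and AV: "A = V * mat_diag n (\<lambda>i. complex_of_real (d i)) * V\<^sup>H" by blast
  have dV [simp]: "dim_row V = n" "dim_col V = n" using V by auto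
  define D where "D = mat_diag n (\<lambda>i. complex_of_real (d i))"
  have dD [simp]: "dim_row D = n" "dim_col D = n" by (simp_all add: D_def)
  have cancel: "V\<^sup>H * (V * X) = X" if "dim_row X = n" for X
    using that by (simp add: VV flip: mult_assoc_dim)
  have D: "D = V\<^sup>H * (A * V)" by (simp add: AV mat_expand cancel VV flip: D_def)
  have "0 \<le> d i" if i: "i < n" for i
  proof -
    define x :: "complex vec" where "x = unit_vec n i"
    have dx [simp]: "dim_vec x = n" by (simp add: x_def)
    have "rip (D *\<^sub>v x) x = rip (V\<^sup>H *\<^sub>v (A *\<^sub>v (V *\<^sub>v x))) x"
      using A by (simp add: D vec_expand)
    also have "\<dots> = rip (A *\<^sub>v (V *\<^sub>v x)) (V *\<^sub>v x)"
      using A by (subst rip_adjoint) auto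
    also have "0 \<le> \<dots>" using psd A by (auto simp: psd_mat_iff)
    also have "rip (D *\<^sub>v x) x = d i"
      using i by (simp add: rip_sum x_def D_def mat_diag_def if_distrib[of Re] if_distrib[of cnj]
          if_distrib[of "(*) _"] sum.delta cong: if_cong)
    finally show ?thesis .
  qed
  with V VV AV that show ?thesis by blast
qed

text \<open>In the two eigenbases the hypothesis says entrywise that \<open>T_ij\<close> times
  \<open>d_j\<close> squared equals \<open>T_ij\<close> times \<open>d'_i\<close> squared; where
  \<open>T_ij\<close> is nonzero, nonnegativity gives \<open>d_j = d'_i\<close>. With
  \<open>A\<close> the identity this is uniqueness of the positive root, and in the completion it
  relates the defect operators of the two sides.\<close>

lemma psd_intertwine:
  assumes S: "S \<in> carrier_mat n n" "psd_mat S" and S': "S' \<in> carrier_mat m m" "psd_mat S'"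
    and A: "A \<in> carrier_mat m n" and eq: "A * (S * S) = (S' * S') * A"
  shows "A * S = S' * A"
proof -
  obtain V d where V: "V \<in> carrier_mat n n" and VV: "V\<^sup>H * V = 1\<^sub>m n" "V * V\<^sup>H = 1\<^sub>m n"
    and SV: "S = V * mat_diag n (\<lambda>i. complex_of_real (d i)) * V\<^sup>H" and d: "\<And>i. i < n \<Longrightarrow> 0 \<le> d i"
    using psd_diagonalization[OF S] by blast
  obtain V' d' where V': "V' \<in> carrier_mat m m" and VV': "V'\<^sup>H * V' = 1\<^sub>m m" "V' * V'\<^sup>H = 1\<^sub>m m"
    and SV': "S' = V' * mat_diag m (\<lambda>i. complex_of_real (d' i)) * V'\<^sup>H" and d': "\<And>i. i < m \<Longrightarrow> 0 \<le> d' i"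
    using psd_diagonalization[OF S'] by blast
  define D where "D = mat_diag n (\<lambda>i. complex_of_real (d i))"
  define D' where "D' = mat_diag m (\<lambda>i. complex_of_real (d' i))"
  have dims [simp]: "dim_row V = n" "dim_col V = n" "dim_row V' = m" "dim_col V' = m"
    "dim_row D = n" "dim_col D = n" "dim_row D' = m" "dim_col D' = m" "dim_row A = m" "dim_col A = n"
    using V V' A by (auto simp: D_def D'_def)
  have cancel: "V\<^sup>H * (V * X) = X" "V * (V\<^sup>H * X) = X" if "dim_row X = n" for X
    using that by (simp_all add: VV flip: mult_assoc_dim)
  have cancel': "V'\<^sup>H * (V' * X) = X" "V' * (V'\<^sup>H * X) = X" if "dim_row X = m" for X
    using that by (simp_all add: VV' flip: mult_assoc_dim)
  define T where "T = V'\<^sup>H * (A * V)"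
  have T: "T \<in> carrier_mat m n" by (intro carrier_matI) (simp_all add: T_def)
  have dT [simp]: "dim_row T = m" "dim_col T = n" using T by auto
  have "V'\<^sup>H * (A * (S * S)) * V = V'\<^sup>H * ((S' * S') * A) * V" by (simp only: eq)
  then have "T * (D * D) = D' * D' * T"
    by (simp add: SV SV' T_def mat_expand cancel cancel' VV flip: D_def D'_def)
  then have "mat m n (\<lambda>(i, j). T $$ (i, j) * (complex_of_real (d j))\<^sup>2)
      = mat m n (\<lambda>(i, j). (complex_of_real (d' i))\<^sup>2 * T $$ (i, j))"
    by (simp add: D_def D'_def mat_diag_mult_left[OF T] mat_diag_mult_right[OF T] power2_eq_square)
  then have TT: "T $$ (i, j) * (complex_of_real (d j))\<^sup>2 = (complex_of_real (d' i))\<^sup>2 * T $$ (i, j)"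
    if "i < m" "j < n" for i j
    using that by (auto dest!: arg_cong[of _ _ "\<lambda>X. X $$ (i, j)"])
  have "T $$ (i, j) * complex_of_real (d j) = complex_of_real (d' i) * T $$ (i, j)"
    if ij: "i < m" "j < n" for i j
  proof (cases "T $$ (i, j) = 0")
    case False
    with TT[OF ij] have "complex_of_real ((d j)\<^sup>2) = complex_of_real ((d' i)\<^sup>2)" by simp
    then have "(d j)\<^sup>2 = (d' i)\<^sup>2" using of_real_eq_iff by blast
    then have "d j = d' i" using d[OF ij(2)] d'[OF ij(1)] by (simp add: power2_eq_iff_nonneg)
    then show ?thesis by simp
  qed simp
  then have TD: "T * D = D' * T"
    by (auto simp: D_def D'_def mat_diag_mult_left[OF T] mat_diag_mult_right[OF T] intro!: eq_matI)
  have "A * S = V' * (T * D) * V\<^sup>H"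
    by (simp add: SV T_def mat_expand cancel' flip: D_def)
  also have "\<dots> = S' * A"
    unfolding TD by (simp add: SV' T_def mat_expand cancel VV flip: D'_def)
  finally show ?thesis .
qed

section \<open>Positive square roots\<close>

lemma psd_sqrt_exists:
  assumes "A \<in> carrier_mat n n" "psd_mat A"
  shows "\<exists>S \<in> carrier_mat n n. psd_mat S \<and> S * S = A"
proof -
  obtain V d where V: "V \<in> carrier_mat n n" and VV: "V\<^sup>H * V = 1\<^sub>m n"
    and AV: "A = V * mat_diag n (\<lambda>i. complex_of_real (d i)) * V\<^sup>H" and d: "\<And>i. i < n \<Longrightarrow> 0 \<le> d i"
    using psd_diagonalization[OF assms] by blast
  define D where "D = mat_diag n (\<lambda>i. complex_of_real (sqrt (d i)))"
  \<comment> \<open>A fourth root of the eigenvalues exhibits the square root as a Gram matrix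
    \<open>F\<^sup>H * F\<close>, hence as positive semidefinite.\<close>
  define E where "E = mat_diag n (\<lambda>i. complex_of_real (sqrt (sqrt (d i))))"
  have dims [simp]: "dim_row V = n" "dim_col V = n" "dim_row D = n" "dim_col D = n" "dim_row E = n" "dim_col E = n"
    using V by (auto simp: D_def E_def)
  have DD: "D * D = mat_diag n (\<lambda>i. complex_of_real (d i))"
    unfolding D_def mat_diag_diag
    using d by (auto simp: mat_diag_def simp flip: of_real_mult intro!: eq_matI)
  have EE: "E * E = D" "E\<^sup>H = E"
    unfolding E_def D_def mat_diag_adjoint_real mat_diag_diag
    using d by (auto simp: mat_diag_def simp flip: of_real_mult intro!: eq_matI)
  have cancel: "V\<^sup>H * (V * X) = X" if "dim_row X = n" for X
    using that by (simp_all add: VV flip: mult_assoc_dim)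
  define F where "F = E * V\<^sup>H"
  have dF [simp]: "dim_row F = n" "dim_col F = n" by (simp_all add: F_def)
  have S: "V * D * V\<^sup>H = F\<^sup>H * F"
    by (simp add: F_def mat_expand EE(2) flip: EE(1))
  have "psd_mat (V * D * V\<^sup>H)"
    unfolding S psd_mat_iff
    by (auto simp: mat_expand) (metis nsq_mult_mat_vec dF(2) nsq_nonneg)
  moreover have "V * D * V\<^sup>H * (V * D * V\<^sup>H) = A"
    unfolding AV DD[symmetric] by (simp add: mat_expand cancel)
  moreover have "V * D * V\<^sup>H \<in> carrier_mat n n" by (intro carrier_matI) simp_all
  ultimately show ?thesis by blast
qed

lemma sqrt_mat_eqI:
  assumes "S \<in> carrier_mat n n" "psd_mat S" "S * S = A"
  shows "sqrt_mat A = S"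
  unfolding sqrt_mat_def
proof (rule the_equality)
  have [simp]: "dim_row A = n" using assms by auto
  show "S \<in> carrier_mat (dim_row A) (dim_row A) \<and> psd_mat S \<and> S * S = A" using assms by auto
  fix S' assume "S' \<in> carrier_mat (dim_row A) (dim_row A) \<and> psd_mat S' \<and> S' * S' = A"
  then show "S' = S"
    using psd_intertwine[of S' n S n "1\<^sub>m n"] assms by auto
qed

lemma sqrt_mat:
  assumes "A \<in> carrier_mat n n" "psd_mat A"
  shows "sqrt_mat A \<in> carrier_mat n n" "psd_mat (sqrt_mat A)" "sqrt_mat A * sqrt_mat A = A"
    "(sqrt_mat A)\<^sup>H = sqrt_mat A"
proof -
  obtain S where S: "S \<in> carrier_mat n n" "psd_mat S" "S * S = A"
    using psd_sqrt_exists[OF assms] by blast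
  then have "sqrt_mat A = S" by (rule sqrt_mat_eqI)
  with S show "sqrt_mat A \<in> carrier_mat n n" "psd_mat (sqrt_mat A)" "sqrt_mat A * sqrt_mat A = A"
    "(sqrt_mat A)\<^sup>H = sqrt_mat A" by (auto simp: psd_mat_def)
qed

section \<open>Pseudoinverses, conjugation and real matrices\<close>

definition penrose :: "complex mat \<Rightarrow> complex mat \<Rightarrow> bool" where
  "penrose X Y \<longleftrightarrow> Y \<in> carrier_mat (dim_col X) (dim_row X) \<and>
     X * Y * X = X \<and> Y * X * Y = Y \<and> (X * Y)\<^sup>H = X * Y \<and> (Y * X)\<^sup>H = Y * X"

text \<open>\<open>X * Z * X = X\<close> gives \<open>X * Y = (X * Z) * (X * Y)\<close>. Taking
  adjoints reverses the two Hermitian factors, and the reversed product collapses to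
  \<open>X * Z\<close>. The same argument on the other side gives
  \<open>Y * X = Z * X\<close>.\<close>

lemma penrose_unique:
  assumes "penrose X Y" "penrose X Z"
  shows "Y = Z"
proof -
  note Y = assms(1)[unfolded penrose_def] and Z = assms(2)[unfolded penrose_def]
  have dims [simp]: "dim_row Y = dim_col X" "dim_col Y = dim_row X" "dim_row Z = dim_col X" "dim_col Z = dim_row X"
    using Y Z by auto
  have "X * Y = (X * Z) * (X * Y)" using Z by (simp flip: mult_assoc_dim)
  then have "X * Y = ((X * Z) * (X * Y))\<^sup>H" using Y by simp
  also have "\<dots> = (X * Y) * (X * Z)" using Y Z by (simp add: adjoint_mult[of "X * Z" "X * Y"])
  also have "\<dots> = X * Z" using Y by (simp flip: mult_assoc_dim)
  finally have XY: "X * Y = X * Z" .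
  have "Y * X = (Y * X) * (Z * X)" using Z by (simp add: mult_assoc_dim)
  then have "Y * X = ((Y * X) * (Z * X))\<^sup>H" using Y by simp
  also have "\<dots> = (Z * X) * (Y * X)" using Y Z by (simp add: adjoint_mult[of "Y * X" "Z * X"])
  also have "\<dots> = Z * X" using Y by (simp add: mult_assoc_dim)
  finally have YX: "Y * X = Z * X" .
  have "Y = Y * X * Y" using Y by simp
  also have "\<dots> = Z * (X * Y)" by (simp add: YX mult_assoc_dim)
  also have "\<dots> = Z * X * Z" by (simp add: XY mult_assoc_dim)
  finally show ?thesis using Z by simp
qed

text \<open>A pseudoinverse \<open>G\<close> of the Hermitian matrix \<open>X\<^sup>H X\<close> yields the pseudoinverse \<open>G X\<^sup>H\<close> of \<open>X\<close>.\<close>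

lemma penrose_exists: "\<exists>Y. penrose X Y"
proof -
  define n where "n = dim_col X"
  define N where "N = X\<^sup>H * X"
  have N: "N \<in> carrier_mat n n" by (intro carrier_matI) (simp_all add: N_def n_def)
  have NH: "N\<^sup>H = N" by (simp add: N_def adjoint_mult)
  obtain V d where V: "V \<in> carrier_mat n n" and VV: "V\<^sup>H * V = 1\<^sub>m n"
    and NV: "N = V * mat_diag n (\<lambda>i. complex_of_real (d i)) * V\<^sup>H"
    using hermitian_diagonalization[OF N NH] by blast
  define D where "D = mat_diag n (\<lambda>i. complex_of_real (d i))"
  \<comment> \<open>Since \<open>inverse 0 = 0\<close>, this inverts exactly the nonzero
    eigenvalues, and \<open>E\<close> is the pseudoinverse of \<open>D\<close>.\<close>
  define E where "E = mat_diag n (\<lambda>i. complex_of_real (inverse (d i)))"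
  have dims [simp]: "dim_row V = n" "dim_col V = n" "dim_row D = n" "dim_col D = n"
    "dim_row E = n" "dim_col E = n" "dim_row N = n" "dim_col N = n" "dim_col X = n"
    using V N by (auto simp: D_def E_def n_def)
  have DED: "D * (E * D) = D" "E * (D * E) = E" "D * E = E * D"
    by (auto simp: D_def E_def field_simps intro!: arg_cong[where f = "mat_diag n"] ext)
  have EH: "E\<^sup>H = E" by (simp only: E_def mat_diag_adjoint_real)
  have cancel: "V\<^sup>H * (V * Y) = Y" if "dim_row Y = n" for Y
    using that by (simp_all add: VV flip: mult_assoc_dim)
  define G where "G = V * E * V\<^sup>H"
  have dG [simp]: "dim_row G = n" "dim_col G = n" by (simp_all add: G_def)
  have GH: "G\<^sup>H = G" by (simp add: G_def mat_expand EH)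
  have GNG: "G * (N * G) = G"
  proof -
    have "G * (N * G) = V * (E * (D * E)) * V\<^sup>H"
      unfolding G_def NV D_def[symmetric] by (simp add: mat_expand cancel)
    then show ?thesis by (simp only: DED(2)) (simp only: G_def)
  qed
  have NGN: "N * (G * N) = N"
  proof -
    have "N * (G * N) = V * (D * (E * D)) * V\<^sup>H"
      unfolding G_def NV D_def[symmetric] by (simp add: mat_expand cancel)
    then show ?thesis by (simp only: DED(1)) (simp only: NV D_def)
  qed
  have GN: "G * N = N * G"
  proof -
    have "G * N = V * (E * D) * V\<^sup>H" "N * G = V * (D * E) * V\<^sup>H"
      unfolding G_def NV D_def[symmetric] by (simp_all add: mat_expand cancel)
    then show ?thesis by (simp add: DED)
  qed
  \<comment> \<open>The identity \<open>N * (G * N) = N\<close> is reduced to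
    \<open>X * (G * N) = X\<close>, because \<open>X\<^sup>H * X\<close> and \<open>X\<close> have
    the same kernel.\<close>
  have "(X\<^sup>H * X) * (G * N - 1\<^sub>m n) = 0\<^sub>m (dim_col X) (dim_col (G * N - 1\<^sub>m n))"
    by (simp add: mult_minus_dim NGN flip: N_def)
  from mult_eq_zero_if_gram_mult_zero[OF _ this]
  have "X * (G * N) - X = 0\<^sub>m (dim_row X) n" by (simp add: mult_minus_dim)
  then have XGN: "X * (G * N) = X" by (rule minus_eq_zero_mat) simp_all
  have 1: "X * (G * X\<^sup>H) * X = X" using XGN by (simp add: N_def mult_assoc_dim)
  have 2: "G * X\<^sup>H * X * (G * X\<^sup>H) = G * X\<^sup>H"
  proof -
    have "G * X\<^sup>H * X * (G * X\<^sup>H) = (G * (N * G)) * X\<^sup>H" by (simp add: N_def mult_assoc_dim)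
    then show ?thesis by (simp add: GNG)
  qed
  have 3: "(G * X\<^sup>H * X)\<^sup>H = G * X\<^sup>H * X"
    using arg_cong[OF GN, of mat_adjoint] by (simp add: N_def mat_expand GH GN)
  have 4: "(X * (G * X\<^sup>H))\<^sup>H = X * (G * X\<^sup>H)" by (simp add: mat_expand GH)
  have "penrose X (G * X\<^sup>H)"
    unfolding penrose_def using 1 2 3 4 by (auto intro!: carrier_matI)
  then show ?thesis ..
qed

lemma pinv_penrose: "penrose X (X\<^sup>\<dagger>)"
proof -
  have "\<exists>!Y. penrose X Y" using penrose_exists penrose_unique by blast
  then show ?thesis unfolding pinv_mat_def penrose_def[symmetric] by (rule theI')
qed

lemma pinv_mat_eqI: "penrose X Y \<Longrightarrow> X\<^sup>\<dagger> = Y"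
  using penrose_unique pinv_penrose by blast

lemma pinv_dim [simp]: "dim_row (X\<^sup>\<dagger>) = dim_col X" "dim_col (X\<^sup>\<dagger>) = dim_row X"
  using pinv_penrose[of X] by (auto simp: penrose_def)

lemma pinv_mat_simps:
  "X * X\<^sup>\<dagger> * X = X" "X\<^sup>\<dagger> * X * X\<^sup>\<dagger> = X\<^sup>\<dagger>" "(X * X\<^sup>\<dagger>)\<^sup>H = X * X\<^sup>\<dagger>" "(X\<^sup>\<dagger> * X)\<^sup>H = X\<^sup>\<dagger> * X"
  using pinv_penrose[of X] by (auto simp: penrose_def)

lemma inv_mat_eqI:
  assumes "A \<in> carrier_mat n n" "B \<in> carrier_mat n n" "A * B = 1\<^sub>m n" "B * A = 1\<^sub>m n"
  shows "inv_mat A = B"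
proof (cases "mat_inverse A")
  case None
  from mat_inverse(1)[OF assms(1) None, where b = "()"] assms show ?thesis
    by (auto simp: Units_def ring_mat_def)
next
  case (Some C)
  from mat_inverse(2)[OF assms(1) Some] have C: "C * A = 1\<^sub>m n" "C \<in> carrier_mat n n" by auto
  have "C = C * (A * B)" using C assms by simp
  also have "\<dots> = (C * A) * B" using C assms by (intro assoc_mult_mat[symmetric]) auto
  finally show ?thesis using C assms Some by (simp add: inv_mat_def)
qed

text \<open>An inverse is a pseudoinverse, so the two branches of \<open>inv_sqrt_mat\<close> agree
  and the regular and singular cases can be treated together.\<close>

lemma inv_sqrt_mat_pinv:
  assumes R: "R \<in> carrier_mat n n" "psd_mat R"
  shows "inv_sqrt_mat R = (sqrt_mat R)\<^sup>\<dagger>"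
proof (cases "invertible_mat R")
  case True
  define S where "S = sqrt_mat R"
  have S: "S \<in> carrier_mat n n" "S * S = R" using sqrt_mat[OF R] by (auto simp: S_def)
  have dS: "dim_row S = n" "dim_col S = n" using S by auto
  from True obtain B where B: "R * B = 1\<^sub>m (dim_row R)" "B * R = 1\<^sub>m (dim_row B)"
    by (auto simp: invertible_mat_def inverts_mat_def)
  have dB: "dim_row B = n" "dim_col B = n"
    using arg_cong[OF B(2), of dim_col] arg_cong[OF B(1), of dim_col] R by auto
  \<comment> \<open>The inverse of the root comes from that of \<open>R\<close>:
    \<open>S * (S * B) = R * B = 1\<close>.\<close>
  define T where "T = S * B"
  have T: "T \<in> carrier_mat n n" using dS dB by (intro carrier_matI) (simp_all add: T_def)
  have ST: "S * T = 1\<^sub>m n"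
    using B dS dB R S(2) by (simp add: T_def flip: mult_assoc_dim)
  have TS: "T * S = 1\<^sub>m n" by (rule mat_mult_left_right_inverse[OF S(1) T ST])
  have "inv_mat S = T" by (rule inv_mat_eqI[OF S(1) T ST TS])
  moreover have "S\<^sup>\<dagger> = T"
    using S T dS by (intro pinv_mat_eqI) (simp add: penrose_def ST TS)
  ultimately show ?thesis using True by (simp add: inv_sqrt_mat_def S_def)
qed (simp add: inv_sqrt_mat_def)

text \<open>
  Since \<open>star_mat k A = (cj k A)\<^sup>H\<close> and \<open>cj k\<close> is multiplicative, both kinds of scalar products can be treated at once.
\<close>

fun cj :: "sp_kind \<Rightarrow> complex mat \<Rightarrow> complex mat" where
  "cj Bilinear A = conj_mat A"
| "cj Sesquilinear A = A"

lemma transpose_conj: "A\<^sup>T = (conj_mat A)\<^sup>H"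
  by (intro eq_matI) auto

lemma star_mat_cj: "star_mat k A = (cj k A)\<^sup>H"
  by (cases k) (simp_all add: transpose_conj)

lemma cj_dim [simp]: "dim_row (cj k A) = dim_row A" "dim_col (cj k A) = dim_col A"
  by (cases k; simp)+

lemma cj_carrier [simp]: "A \<in> carrier_mat n m \<Longrightarrow> cj k A \<in> carrier_mat n m"
  by (intro carrier_matI) auto

lemma cj_cj [simp]: "cj k (cj k A) = A"
  by (cases k) (auto intro!: eq_matI)

lemma cj_mult: "dim_col A = dim_row B \<Longrightarrow> cj k (A * B) = cj k A * cj k B"
  by (cases k) (auto simp: mult_index simp del: index_mult_mat(1) intro!: eq_matI)

lemma cj_add: "dim_row A = dim_row B \<Longrightarrow> dim_col A = dim_col B \<Longrightarrow> cj k (A + B) = cj k A + cj k B"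
  by (cases k) (auto intro!: eq_matI)

lemma cj_minus: "dim_row A = dim_row B \<Longrightarrow> dim_col A = dim_col B \<Longrightarrow> cj k (A - B) = cj k A - cj k B"
  by (cases k) (auto intro!: eq_matI)

lemma cj_smult: "cnj c = c \<Longrightarrow> cj k (c \<cdot>\<^sub>m A) = c \<cdot>\<^sub>m cj k A"
  by (cases k) (auto intro!: eq_matI)

lemma cj_adjoint: "cj k (A\<^sup>H) = (cj k A)\<^sup>H"
  by (cases k) (auto intro!: eq_matI)

lemma cj_one [simp]: "cj k (1\<^sub>m n) = 1\<^sub>m n"
  by (cases k) (auto intro!: eq_matI)

lemma cj_zero [simp]: "cj k (0\<^sub>m n m) = 0\<^sub>m n m"
  by (cases k) (auto intro!: eq_matI)

lemmas cj_expand = cj_mult cj_add cj_minus cj_smult cj_adjoint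

text \<open>The vector counterpart of \<open>cj\<close>: \<open>cj k A\<close> is \<open>A\<close>
  conjugated by this involution, which preserves \<open>rip\<close>.\<close>

definition cjv :: "sp_kind \<Rightarrow> complex vec \<Rightarrow> complex vec" where
  "cjv k x = (if k = Bilinear then conjugate x else x)"

lemma cjv_dim [simp]: "dim_vec (cjv k x) = dim_vec x"
  by (simp add: cjv_def)

lemma cj_mult_vec:
  assumes "dim_vec x = dim_col A"
  shows "cj k A *\<^sub>v x = cjv k (A *\<^sub>v cjv k x)"
  using assms
  by (cases k) (auto simp: cjv_def scalar_prod_def intro!: eq_vecI)

lemma rip_cjv: "dim_vec x = dim_vec y \<Longrightarrow> rip (cjv k x) (cjv k y) = rip x y"
  by (cases k) (auto simp: cjv_def rip_sum intro!: sum.cong)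

lemma cjv_cjv [simp]: "cjv k (cjv k x) = x"
  by (simp add: cjv_def)

lemma psd_cj: "psd_mat A \<Longrightarrow> psd_mat (cj k A)"
  unfolding psd_mat_iff
proof (intro conjI allI impI)
  assume A: "square_mat A \<and> A\<^sup>H = A \<and> (\<forall>x. dim_vec x = dim_row A \<longrightarrow> 0 \<le> rip (A *\<^sub>v x) x)"
  show "square_mat (cj k A)" "(cj k A)\<^sup>H = cj k A" using A by (simp_all flip: cj_adjoint)
  fix x :: "complex vec" assume x: "dim_vec x = dim_row (cj k A)"
  have "rip (cj k A *\<^sub>v x) x = rip (cjv k (A *\<^sub>v cjv k x)) (cjv k (cjv k x))"
    using A x by (simp add: cj_mult_vec)
  also have "\<dots> = rip (A *\<^sub>v cjv k x) (cjv k x)"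
    using A x by (intro rip_cjv) simp
  finally show "0 \<le> rip (cj k A *\<^sub>v x) x" using A x by simp
qed

text \<open>By uniqueness of the positive root. For the bilinear kind it shows that the root of a
  real matrix is real.\<close>

lemma sqrt_mat_cj:
  assumes "A \<in> carrier_mat n n" "psd_mat A"
  shows "sqrt_mat (cj k A) = cj k (sqrt_mat A)"
proof (rule sqrt_mat_eqI)
  note S = sqrt_mat[OF assms]
  show "cj k (sqrt_mat A) \<in> carrier_mat n n" using S by simp
  show "psd_mat (cj k (sqrt_mat A))" using S by (simp add: psd_cj)
  show "cj k (sqrt_mat A) * cj k (sqrt_mat A) = cj k A"
    using S by (simp flip: cj_mult)
qed

lemma pinv_cj: "(cj k X)\<^sup>\<dagger> = cj k (X\<^sup>\<dagger>)"
  by (rule pinv_mat_eqI)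
    (auto simp: penrose_def pinv_mat_simps simp flip: cj_mult cj_adjoint intro!: carrier_matI)

text \<open>Reality is expressed as invariance under conjugation, so that closure under products,
  adjoints, pseudoinverses and roots follows from the laws of \<open>cj Bilinear\<close>. Over the
  complex numbers the condition is vacuous.\<close>

definition over :: "complex set \<Rightarrow> complex mat \<Rightarrow> bool" where
  "over \<KK> A \<longleftrightarrow> (\<KK> = \<real> \<longrightarrow> conj_mat A = A)"

lemma kmat_iff:
  assumes "\<KK> = \<real> \<or> \<KK> = UNIV"
  shows "A \<in> kmat \<KK> n m \<longleftrightarrow> A \<in> carrier_mat n m \<and> over \<KK> A"
proof -
  have "(UNIV :: complex set) \<noteq> \<real>" by (metis UNIV_I complex_is_Real_iff imaginary_unit.sel(2) zero_neq_one)
  moreover have "elements_mat A \<subseteq> \<real> \<longleftrightarrow> conj_mat A = A" if A: "A \<in> carrier_mat n m"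
  proof
    assume "elements_mat A \<subseteq> \<real>"
    then show "conj_mat A = A"
      using A by (intro eq_matI) (auto simp flip: Reals_cnj_iff)
  next
    assume *: "conj_mat A = A"
    show "elements_mat A \<subseteq> \<real>"
    proof
      fix a assume "a \<in> elements_mat A"
      then obtain i j where ij: "i < dim_row A" "j < dim_col A" "a = A $$ (i, j)" by (auto simp: elements_mat_def)
      then have "conj_mat A $$ (i, j) = cnj a" by simp
      with * ij show "a \<in> \<real>" by (simp add: Reals_cnj_iff)
    qed
  qed
  ultimately show ?thesis using assms by (auto simp: kmat_def over_def)
qed

lemma over_mult: "over \<KK> A \<Longrightarrow> over \<KK> B \<Longrightarrow> dim_col A = dim_row B \<Longrightarrow> over \<KK> (A * B)"
  using cj_mult[of A B Bilinear] by (simp add: over_def)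

lemma over_add: "over \<KK> A \<Longrightarrow> over \<KK> B \<Longrightarrow> dim_row A = dim_row B \<Longrightarrow> dim_col A = dim_col B \<Longrightarrow> over \<KK> (A + B)"
  using cj_add[of A B Bilinear] by (simp add: over_def)

lemma over_minus: "over \<KK> A \<Longrightarrow> over \<KK> B \<Longrightarrow> dim_row A = dim_row B \<Longrightarrow> dim_col A = dim_col B \<Longrightarrow> over \<KK> (A - B)"
  using cj_minus[of A B Bilinear] by (simp add: over_def)

lemma over_smult: "over \<KK> A \<Longrightarrow> cnj c = c \<Longrightarrow> over \<KK> (c \<cdot>\<^sub>m A)"
  using cj_smult[of c Bilinear A] by (simp add: over_def)

lemma over_adjoint: "over \<KK> A \<Longrightarrow> over \<KK> (A\<^sup>H)"
  using cj_adjoint[of Bilinear A] by (simp add: over_def)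

lemma over_cj: "over \<KK> A \<Longrightarrow> over \<KK> (cj k A)"
  by (cases k) (simp_all add: over_def)

lemma over_one: "over \<KK> (1\<^sub>m n)"
  using cj_one[of Bilinear n] by (auto simp: over_def)

lemma over_zero: "over \<KK> (0\<^sub>m n m)"
  using cj_zero[of Bilinear n m] by (auto simp: over_def)

lemma over_pinv: "over \<KK> X \<Longrightarrow> over \<KK> (X\<^sup>\<dagger>)"
  using pinv_cj[of Bilinear X] by (auto simp: over_def)

lemma over_sqrt_mat: "over \<KK> A \<Longrightarrow> A \<in> carrier_mat n n \<Longrightarrow> psd_mat A \<Longrightarrow> over \<KK> (sqrt_mat A)"
  using sqrt_mat_cj[of A n Bilinear] by (auto simp: over_def)

lemmas over_intros = over_mult over_add over_minus over_smult over_adjoint over_cj over_one over_zero over_pinv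

section \<open>Norm-preserving dilations\<close>

text \<open>The adjoint of the row \<open>[E F]\<close> is an isometry, so the components
  \<open>E\<^sup>H *\<^sub>v w\<close> and \<open>F\<^sup>H *\<^sub>v w\<close> have total square
  \<open>nsq w\<close>. Their inner products with \<open>a\<close> and \<open>b\<close> also add up
  to \<open>nsq w\<close>, and the two squares of differences being nonnegative gives the
  bound.\<close>

lemma row_coisometry_nsq:
  assumes EF: "E * E\<^sup>H + F * F\<^sup>H = 1\<^sub>m n"
    and dims [simp]: "dim_row E = n" "dim_row F = n" "dim_vec a = dim_col E" "dim_vec b = dim_col F"
  shows "nsq (E *\<^sub>v a + F *\<^sub>v b) \<le> nsq a + nsq b"
proof -
  define w where "w = E *\<^sub>v a + F *\<^sub>v b"
  have dw [simp]: "dim_vec w = n" by (simp add: w_def)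
  have "nsq (E\<^sup>H *\<^sub>v w) + nsq (F\<^sup>H *\<^sub>v w) = rip ((E * E\<^sup>H + F * F\<^sup>H) *\<^sub>v w) w"
    by (simp add: nsq_mult_mat_vec[of w "E\<^sup>H"] nsq_mult_mat_vec[of w "F\<^sup>H"] add_mult_mat_vec_dim rip_add)
  then have 1: "nsq (E\<^sup>H *\<^sub>v w) + nsq (F\<^sup>H *\<^sub>v w) = nsq w" by (simp add: EF)
  have "nsq w = rip w (E *\<^sub>v a) + rip w (F *\<^sub>v b)"
    by (subst (2) w_def) (simp add: rip_add)
  also have "rip w (E *\<^sub>v a) = rip (E\<^sup>H *\<^sub>v w) a" using rip_adjoint[of w "E\<^sup>H" a] by simp
  also have "rip w (F *\<^sub>v b) = rip (F\<^sup>H *\<^sub>v w) b" using rip_adjoint[of w "F\<^sup>H" b] by simp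
  finally have 2: "nsq w = rip (E\<^sup>H *\<^sub>v w) a + rip (F\<^sup>H *\<^sub>v w) b" .
  have "0 \<le> nsq (E\<^sup>H *\<^sub>v w - a) + nsq (F\<^sup>H *\<^sub>v w - b)" by simp
  then show ?thesis using 1 2 by (simp add: nsq_minus flip: w_def)
qed

lemma column_isometry_nsq:
  assumes EF: "E * E\<^sup>H + F * F\<^sup>H = 1\<^sub>m n"
    and dims [simp]: "dim_row E = n" "dim_row F = n" "dim_vec x = n"
  shows "nsq (E\<^sup>H *\<^sub>v x) + nsq (F\<^sup>H *\<^sub>v x) = nsq x"
proof -
  have "nsq (E\<^sup>H *\<^sub>v x) + nsq (F\<^sup>H *\<^sub>v x) = rip ((E * E\<^sup>H + F * F\<^sup>H) *\<^sub>v x) x"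
    by (simp add: nsq_mult_mat_vec[of x "E\<^sup>H"] nsq_mult_mat_vec[of x "F\<^sup>H"] add_mult_mat_vec_dim rip_add)
  then show ?thesis by (simp add: EF)
qed

text \<open>
  Davis--Kahan--Weinberger: with \<open>[Y  D]\<close> a coisometry and \<open>[W; D']\<close> an isometry, the completed block matrix
  factors through \<open>diag(J, \<mu> Z)\<close>, where the Halmos dilation \<open>J = [[A, S'], [S, - A\<^sup>H]]\<close> is \<open>\<mu>\<close> times a unitary matrix.
\<close>

lemma halmos_nsq:
  assumes dims [simp]: "dim_row A = a" "dim_col A = b" "dim_row S = b" "dim_col S = b"
      "dim_row S' = a" "dim_col S' = a" "dim_vec x = b" "dim_vec u = a"
    and SH: "S\<^sup>H = S" "S'\<^sup>H = S'"
    and AS: "A\<^sup>H * A + S * S = complex_of_real m \<cdot>\<^sub>m 1\<^sub>m b"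
    and AS': "A * A\<^sup>H + S' * S' = complex_of_real m \<cdot>\<^sub>m 1\<^sub>m a"
    and int: "A * S = S' * A"
  shows "nsq (A *\<^sub>v x + S' *\<^sub>v u) + nsq (S *\<^sub>v x - A\<^sup>H *\<^sub>v u) = m * (nsq x + nsq u)"
proof -
  have "nsq (A *\<^sub>v x) + nsq (S *\<^sub>v x) = rip ((A\<^sup>H * A + S * S) *\<^sub>v x) x"
    by (simp add: nsq_mult_mat_vec[of x A] nsq_mult_mat_vec[of x S] add_mult_mat_vec_dim rip_add SH)
  also have "\<dots> = m * nsq x" by (simp add: AS vec_expand rip_smult)
  finally have 1: "nsq (A *\<^sub>v x) + nsq (S *\<^sub>v x) = m * nsq x" .
  have "nsq (A\<^sup>H *\<^sub>v u) + nsq (S' *\<^sub>v u) = rip ((A * A\<^sup>H + S' * S') *\<^sub>v u) u"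
    by (simp add: nsq_mult_mat_vec[of u "A\<^sup>H"] nsq_mult_mat_vec[of u S'] add_mult_mat_vec_dim rip_add SH)
  also have "\<dots> = m * nsq u" by (simp add: AS' vec_expand rip_smult)
  finally have 2: "nsq (A\<^sup>H *\<^sub>v u) + nsq (S' *\<^sub>v u) = m * nsq u" .
  \<comment> \<open>The cross terms of the two squares carry opposite signs; the intertwining
    relation makes them equal, so they cancel.\<close>
  have "rip (A *\<^sub>v x) (S' *\<^sub>v u) = rip ((S' * A) *\<^sub>v x) u"
    using rip_adjoint[of "A *\<^sub>v x" S' u] by (simp add: SH vec_expand)
  moreover have "rip (S *\<^sub>v x) (A\<^sup>H *\<^sub>v u) = rip ((A * S) *\<^sub>v x) u"
    using rip_adjoint[of "S *\<^sub>v x" A u] by (simp add: vec_expand)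
  ultimately have "rip (A *\<^sub>v x) (S' *\<^sub>v u) = rip (S *\<^sub>v x) (A\<^sup>H *\<^sub>v u)" by (simp only: int)
  with 1 2 show ?thesis by (simp add: nsq_add nsq_minus algebra_simps)
qed

lemma dkw_block_bound:
  assumes dims [simp]: "dim_row A = a" "dim_col A = b" "dim_row S = b" "dim_col S = b"
      "dim_row S' = a" "dim_col S' = a" "dim_row Y = c" "dim_col Y = b" "dim_row D = c" "dim_col D = c"
      "dim_row W = a" "dim_col W = d" "dim_row D' = d" "dim_col D' = d" "dim_row Z = c" "dim_col Z = d"
      "dim_vec x = b" "dim_vec y = d"
    and SH: "S\<^sup>H = S" "S'\<^sup>H = S'" and DH: "D\<^sup>H = D" "D'\<^sup>H = D'"
    and AS: "A\<^sup>H * A + S * S = complex_of_real (\<mu>\<^sup>2) \<cdot>\<^sub>m 1\<^sub>m b"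
    and AS': "A * A\<^sup>H + S' * S' = complex_of_real (\<mu>\<^sup>2) \<cdot>\<^sub>m 1\<^sub>m a"
    and int: "A * S = S' * A"
    and YD: "Y * Y\<^sup>H + D * D = 1\<^sub>m c" and WD: "W\<^sup>H * W + D' * D' = 1\<^sub>m d"
    and Z: "l2_bound 1 Z"
  shows "nsq (A *\<^sub>v x + (S' * W) *\<^sub>v y)
      + nsq ((Y * S) *\<^sub>v x + (complex_of_real \<mu> \<cdot>\<^sub>m (D * Z * D') - Y * A\<^sup>H * W) *\<^sub>v y)
    \<le> \<mu>\<^sup>2 * (nsq x + nsq y)"
proof -
  define u where "u = W *\<^sub>v y"
  define v where "v = D' *\<^sub>v y"
  \<comment> \<open>\<open>p\<close> is the lower output of the dilation at \<open>(x, u)\<close>,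
    and \<open>q\<close> is what passes through \<mu> times \<open>Z\<close>. The two rows become
    \<open>A x + S' u\<close> and \<open>Y p + D q\<close>.\<close>
  define p where "p = S *\<^sub>v x - A\<^sup>H *\<^sub>v u"
  define q where "q = complex_of_real \<mu> \<cdot>\<^sub>v (Z *\<^sub>v v)"
  have d [simp]: "dim_vec u = a" "dim_vec v = d" "dim_vec p = b" "dim_vec q = c"
    by (simp_all add: u_def v_def p_def q_def)
  have uv: "nsq u + nsq v = nsq y"
    using column_isometry_nsq[of "W\<^sup>H" "D'\<^sup>H" d y] WD by (simp add: u_def v_def DH)
  have *: "A *\<^sub>v x + (S' * W) *\<^sub>v y = A *\<^sub>v x + S' *\<^sub>v u"
    by (simp add: u_def vec_expand)
  have "(Y * S) *\<^sub>v x + (complex_of_real \<mu> \<cdot>\<^sub>m (D * Z * D') - Y * A\<^sup>H * W) *\<^sub>v y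
      = Y *\<^sub>v (S *\<^sub>v x) + (complex_of_real \<mu> \<cdot>\<^sub>v (D *\<^sub>v (Z *\<^sub>v v)) - Y *\<^sub>v (A\<^sup>H *\<^sub>v u))"
    by (simp add: u_def v_def vec_expand)
  also have "\<dots> = Y *\<^sub>v p + D *\<^sub>v q"
    by (simp add: p_def q_def vec_expand) (intro eq_vecI, auto simp del: index_mult_mat_vec)
  finally have **: "(Y * S) *\<^sub>v x + (complex_of_real \<mu> \<cdot>\<^sub>m (D * Z * D') - Y * A\<^sup>H * W) *\<^sub>v y = Y *\<^sub>v p + D *\<^sub>v q" .
  have "nsq (Y *\<^sub>v p + D *\<^sub>v q) \<le> nsq p + nsq q"
    using YD by (intro row_coisometry_nsq[of _ _ c]) (simp_all add: DH)
  moreover have "nsq q \<le> \<mu>\<^sup>2 * nsq v"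
    using l2_boundD[OF Z, of v] by (simp add: q_def nsq_smult mult_left_mono)
  moreover have "nsq (A *\<^sub>v x + S' *\<^sub>v u) + nsq p = \<mu>\<^sup>2 * (nsq x + nsq u)"
    unfolding p_def by (rule halmos_nsq[OF _ _ _ _ _ _ _ _ SH AS AS' int]) simp_all
  ultimately show ?thesis unfolding * ** using uv[symmetric] by (simp add: algebra_simps)
qed

text \<open>The quadratic form is \<open>nsq x - nsq (Y\<^sup>H *\<^sub>v x)\<close>, so it is
  contractivity of the adjoint that enters.\<close>

lemma psd_one_minus_gram:
  assumes "l2_bound 1 Y" "dim_row Y = c"
  shows "psd_mat (1\<^sub>m c - Y * Y\<^sup>H)"
  unfolding psd_mat_iff
proof (intro conjI allI impI)
  have d [simp]: "dim_row Y = c" by fact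
  show "square_mat (1\<^sub>m c - Y * Y\<^sup>H)" by simp
  show "(1\<^sub>m c - Y * Y\<^sup>H)\<^sup>H = 1\<^sub>m c - Y * Y\<^sup>H" by (simp add: mat_expand)
  fix x :: "complex vec" assume "dim_vec x = dim_row (1\<^sub>m c - Y * Y\<^sup>H)"
  then have x [simp]: "dim_vec x = c" by simp
  have "rip ((1\<^sub>m c - Y * Y\<^sup>H) *\<^sub>v x) x = nsq x - nsq (Y\<^sup>H *\<^sub>v x)"
    by (simp add: nsq_mult_mat_vec[of x "Y\<^sup>H"] minus_mult_mat_vec_dim rip_minus)
  then show "0 \<le> rip ((1\<^sub>m c - Y * Y\<^sup>H) *\<^sub>v x) x"
    using l2_boundD[OF l2_bound_adjoint[OF assms(1)], of x] by simp
qed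

text \<open>Douglas factorisation, with \<open>S\<close> possibly singular. Domination forces the
  kernel of \<open>S\<close> into that of \<open>B\<close>, and \<open>x\<close> minus its image
  under \<open>S\<^sup>\<dagger> * S\<close> lies in the kernel of \<open>S\<close>. For the norm
  bound, \<open>S * S\<^sup>\<dagger>\<close> is an orthogonal projection.\<close>

lemma contraction_factor:
  assumes S: "psd_mat S" "dim_row S = r" and B: "dim_col B = r"
    and dom: "\<And>x. dim_vec x = r \<Longrightarrow> nsq (B *\<^sub>v x) \<le> nsq (S *\<^sub>v x)"
  shows "B * S\<^sup>\<dagger> * S = B" "l2_bound 1 (B * S\<^sup>\<dagger>)"
proof -
  have SH: "S\<^sup>H = S" and dS [simp]: "dim_row S = r" "dim_col S = r" "dim_col B = r"
    using S B by (auto simp: psd_mat_def)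
  have "B - B * S\<^sup>\<dagger> * S = 0\<^sub>m (dim_row B) r"
  proof -
    have "(B - B * S\<^sup>\<dagger> * S) *\<^sub>v x = 0\<^sub>v (dim_row B)" if x [simp]: "dim_vec x = r" for x
    proof -
      define y where "y = x - (S\<^sup>\<dagger> * S) *\<^sub>v x"
      have dy [simp]: "dim_vec y = r" by (simp add: y_def)
      have "S *\<^sub>v y = S *\<^sub>v x - (S * S\<^sup>\<dagger> * S) *\<^sub>v x"
        by (simp add: y_def vec_expand)
      then have "S *\<^sub>v y = 0\<^sub>v r" by (simp add: pinv_mat_simps) (intro eq_vecI, auto)
      then have "nsq (B *\<^sub>v y) \<le> 0" using dom[of y] by simp
      then have "nsq (B *\<^sub>v y) = 0" by (simp add: antisym)
      moreover have "(B - B * S\<^sup>\<dagger> * S) *\<^sub>v x = B *\<^sub>v y"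
        by (simp add: y_def vec_expand)
      ultimately show ?thesis by (simp add: nsq_eq_0)
    qed
    then show ?thesis using mat_eq_zeroI[of "B - B * S\<^sup>\<dagger> * S"] by simp
  qed
  then show "B * S\<^sup>\<dagger> * S = B" by (rule minus_eq_zero_mat[symmetric]) simp_all
  show "l2_bound 1 (B * S\<^sup>\<dagger>)"
    unfolding l2_bound_def
  proof (intro allI impI)
    fix x :: "complex vec" assume "dim_vec x = dim_col (B * S\<^sup>\<dagger>)"
    then have x [simp]: "dim_vec x = r" by simp
    have "nsq ((B * S\<^sup>\<dagger>) *\<^sub>v x) \<le> nsq ((S * S\<^sup>\<dagger>) *\<^sub>v x)"
      using dom[of "S\<^sup>\<dagger> *\<^sub>v x"] by (simp add: vec_expand)
    also have "\<dots> \<le> nsq x"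
    proof -
      define E where "E = S * S\<^sup>\<dagger>"
      have dE [simp]: "dim_row E = r" "dim_col E = r" by (simp_all add: E_def)
      have E: "E\<^sup>H = E" "E * E = E"
        by (simp_all add: E_def pinv_mat_simps) (simp add: pinv_mat_simps flip: mult_assoc_dim)
      have "0 \<le> nsq (E *\<^sub>v x - x)" by simp
      moreover have "nsq (E *\<^sub>v x) = rip (E *\<^sub>v x) x"
        by (simp add: nsq_mult_mat_vec E)
      ultimately show ?thesis by (simp add: nsq_minus flip: E_def)
    qed
    finally show "nsq ((B * S\<^sup>\<dagger>) *\<^sub>v x) \<le> 1\<^sup>2 * nsq x" by simp
  qed
qed

text \<open>The blocks are only tied to the projections by
  \<open>U\<^sub>1 * U\<^sub>1\<^sup>H = P\<close> and its complement. This fits the column blocks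
  of a singular value decomposition as well as the projections themselves. The pair
  \<open>k\<close>, \<open>e\<close> encodes the symmetry class shared by \<open>H\<close> and
  \<open>Z\<close>.\<close>

locale dkw =
  fixes k :: sp_kind and e :: complex and n r m :: nat and H P U\<^sub>1 U\<^sub>2 Z :: "complex mat" and \<mu> :: real
  assumes e: "e \<in> {1, -1}"
    and H: "H \<in> carrier_mat n n" "(cj k H)\<^sup>H = e \<cdot>\<^sub>m H"
    and P: "P \<in> carrier_mat n n" "P\<^sup>H = P" "P * P = P"
    and U1: "U\<^sub>1 \<in> carrier_mat n r" "U\<^sub>1 * U\<^sub>1\<^sup>H = P"
    and U2: "U\<^sub>2 \<in> carrier_mat n m" "U\<^sub>2 * U\<^sub>2\<^sup>H = 1\<^sub>m n - P"
    and \<mu>: "0 \<le> \<mu>" "l2_bound \<mu> (H * P)"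
    and Z: "Z \<in> carrier_mat m m" "(cj k Z)\<^sup>H = e \<cdot>\<^sub>m Z" "l2_bound 1 Z"
begin

abbreviation "c \<equiv> cj k"

text \<open>\<open>A\<close> and \<open>B\<close> are the prescribed (1,1) and (2,1) blocks of
  \<open>H\<close>, with columns referred to \<open>U\<^sub>1\<close> and rows to
  \<open>c U\<^sub>1\<close> and \<open>c U\<^sub>2\<close>. Among the definitions that follow,
  \<open>S\<close> is the defect operator of \<open>A\<close> at level \<mu>, \<open>Y\<close> is
  the contraction with \<open>Y * S = B\<close>, \<open>D\<close> is the defect operator of
  \<open>Y\<^sup>H\<close>, and \<open>W\<close> is the mirror image of \<open>Y\<close> under the
  symmetry.\<close>

definition "A = (c U\<^sub>1)\<^sup>H * H * U\<^sub>1"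
definition "B = (c U\<^sub>2)\<^sup>H * H * U\<^sub>1"
definition "R = complex_of_real (\<mu>\<^sup>2) \<cdot>\<^sub>m 1\<^sub>m r - A\<^sup>H * A"
definition "S = sqrt_mat R"
definition "Y = B * S\<^sup>\<dagger>"
definition "D = sqrt_mat (1\<^sub>m m - Y * Y\<^sup>H)"
definition "W = e \<cdot>\<^sub>m (c Y)\<^sup>H"
text \<open>The term with \<open>A\<^sup>H\<close> is the corner \<open>- A\<^sup>H\<close> of the
  dilation seen through \<open>Y\<close> and \<open>W\<close>; the defects \<open>D\<close> and
  \<open>c D\<close> leave room for a contraction scaled by \<mu>.\<close>

definition "X\<^sub>2\<^sub>2 = complex_of_real \<mu> \<cdot>\<^sub>m (D * Z * c D) - Y * A\<^sup>H * W"
definition "G = H * P + c P * H - c P * H * P + c U\<^sub>2 * X\<^sub>2\<^sub>2 * U\<^sub>2\<^sup>H"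

lemma e_simps [simp]: "e * e = 1" "cnj e = e" "e * (e * x) = x"
  using e by auto

lemma dims [simp]:
  "dim_row H = n" "dim_col H = n" "dim_row P = n" "dim_col P = n" "dim_row U\<^sub>1 = n" "dim_col U\<^sub>1 = r"
  "dim_row U\<^sub>2 = n" "dim_col U\<^sub>2 = m" "dim_row Z = m" "dim_col Z = m"
  "dim_row A = r" "dim_col A = r" "dim_row B = m" "dim_col B = r" "dim_row R = r" "dim_col R = r"
  using H P U1 U2 Z by (auto simp: A_def B_def R_def)

lemma H_adjoint: "H\<^sup>H = e \<cdot>\<^sub>m c H"
proof -
  have "e \<cdot>\<^sub>m H\<^sup>H = c H"
    using arg_cong[OF H(2), of mat_adjoint] by (simp add: adjoint_smult)
  then show ?thesis using arg_cong[of _ _ "\<lambda>X. e \<cdot>\<^sub>m X"] by (metis e_simps(1) one_smult_mat smult_smult_mat)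
qed

lemma cP: "(c P)\<^sup>H = c P" "c P * c P = c P"
  using P by (simp_all flip: cj_adjoint cj_mult)

lemma cU: "c U\<^sub>1 * (c U\<^sub>1)\<^sup>H = c P" "c U\<^sub>2 * (c U\<^sub>2)\<^sup>H = 1\<^sub>m n - c P"
  using U1(2) U2(2) by (simp_all flip: cj_adjoint cj_mult add: cj_minus)

text \<open>The product of \<open>(1\<^sub>m n - P) * U\<^sub>1\<close> with its adjoint is
  \<open>(1\<^sub>m n - P) * P * (1\<^sub>m n - P) = 0\<close>, so the columns of
  \<open>U\<^sub>1\<close> lie in the range of \<open>P\<close>.\<close>

lemma PU1: "P * U\<^sub>1 = U\<^sub>1"
proof -
  have "(1\<^sub>m n - P) * U\<^sub>1 * ((1\<^sub>m n - P) * U\<^sub>1)\<^sup>H = (1\<^sub>m n - P) * (U\<^sub>1 * U\<^sub>1\<^sup>H) * (1\<^sub>m n - P)"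
    by (simp add: mult_assoc_dim adjoint_mult adjoint_minus P)
  also have "\<dots> = 0\<^sub>m n n"
    unfolding U1(2) using P by (simp add: minus_mult_dim mult_minus_dim)
  finally have "((1\<^sub>m n - P) * U\<^sub>1)\<^sup>H = 0\<^sub>m r n"
    using mat_eq_zero_if_gram_zero[of "((1\<^sub>m n - P) * U\<^sub>1)\<^sup>H"] by simp
  then have "(1\<^sub>m n - P) * U\<^sub>1 = 0\<^sub>m n r"
    using arg_cong[of _ _ mat_adjoint] by (metis adjoint_adjoint adjoint_zero)
  then have "U\<^sub>1 - P * U\<^sub>1 = 0\<^sub>m n r" by (simp add: minus_mult_dim)
  then show ?thesis by (rule minus_eq_zero_mat[symmetric]) simp_all
qed

lemma PU2: "P * U\<^sub>2 = 0\<^sub>m n m" "U\<^sub>2\<^sup>H * P = 0\<^sub>m m n"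
proof -
  have "P * U\<^sub>2 * (P * U\<^sub>2)\<^sup>H = P * (U\<^sub>2 * U\<^sub>2\<^sup>H) * P"
    by (simp add: mult_assoc_dim adjoint_mult P)
  also have "\<dots> = 0\<^sub>m n n"
    unfolding U2(2) using P by (simp add: minus_mult_dim mult_minus_dim)
  finally have "(P * U\<^sub>2)\<^sup>H = 0\<^sub>m m n"
    using mat_eq_zero_if_gram_zero[of "(P * U\<^sub>2)\<^sup>H"] by simp
  then show "P * U\<^sub>2 = 0\<^sub>m n m" "U\<^sub>2\<^sup>H * P = 0\<^sub>m m n"
    by (metis adjoint_adjoint adjoint_zero) (use \<open>(P * U\<^sub>2)\<^sup>H = 0\<^sub>m m n\<close> in \<open>simp add: adjoint_mult P\<close>)
qed

lemma star_A: "c A = e \<cdot>\<^sub>m A\<^sup>H" "(c A)\<^sup>H = e \<cdot>\<^sub>m A"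
  by (simp_all add: A_def cj_expand mat_expand H_adjoint H)

text \<open>The origin of the two signs in the definition of \<open>K\<close>: what is subtracted
  from the scalar \<mu> squared in the symmetric case and added in the skew case is \<open>e\<close>
  times a Gram matrix, so both cases produce \<open>R\<close>.\<close>

lemma gram_A: "U\<^sub>1\<^sup>H * c (H * P) * (H * P) * U\<^sub>1 = e \<cdot>\<^sub>m (A\<^sup>H * A)"
proof -
  have "A\<^sup>H * A = U\<^sub>1\<^sup>H * H\<^sup>H * (c U\<^sub>1 * (c U\<^sub>1)\<^sup>H) * (H * U\<^sub>1)"
    by (simp add: A_def mat_expand)
  also have "\<dots> = e \<cdot>\<^sub>m (U\<^sub>1\<^sup>H * c (H * P) * (H * P) * U\<^sub>1)"
    unfolding cU by (simp add: mat_expand cj_expand H_adjoint PU1)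
  finally show ?thesis by (simp add: smult_smult_mat)
qed

text \<open>The left side is the squared length of
  \<open>H *\<^sub>v (U\<^sub>1 *\<^sub>v x)\<close> in the coordinates of
  \<open>c U\<^sub>1\<close> and \<open>c U\<^sub>2\<close>, and
  \<open>P * U\<^sub>1 = U\<^sub>1\<close> lets \<open>H * P\<close> replace \<open>H\<close>. Both
  the positivity of \<open>R\<close> and the domination of \<open>B\<close> by \<open>S\<close> come
  from this inequality.\<close>

lemma nsq_AB_le:
  assumes x [simp]: "dim_vec x = r"
  shows "nsq (A *\<^sub>v x) + nsq (B *\<^sub>v x) \<le> \<mu>\<^sup>2 * nsq x"
proof -
  have "l2_bound 1 (U\<^sub>1\<^sup>H)"
    unfolding l2_bound_def
  proof (intro allI impI)
    fix y :: "complex vec" assume "dim_vec y = dim_col (U\<^sub>1\<^sup>H)"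
    then have y: "dim_vec y = n" by simp
    have "nsq (U\<^sub>1\<^sup>H *\<^sub>v y) + nsq (U\<^sub>2\<^sup>H *\<^sub>v y) = nsq y"
      by (rule column_isometry_nsq[of _ _ n]) (auto simp: U1(2) U2(2) y)
    then show "nsq (U\<^sub>1\<^sup>H *\<^sub>v y) \<le> 1\<^sup>2 * nsq y"
      using nsq_nonneg[of "U\<^sub>2\<^sup>H *\<^sub>v y"] unfolding one_power2 mult_1 by linarith
  qed
  from l2_bound_adjoint[OF this] have U: "l2_bound 1 U\<^sub>1" by simp
  define y where "y = H *\<^sub>v (U\<^sub>1 *\<^sub>v x)"
  have [simp]: "dim_vec y = n" by (simp add: y_def)
  have "A *\<^sub>v x = (c U\<^sub>1)\<^sup>H *\<^sub>v y" "B *\<^sub>v x = (c U\<^sub>2)\<^sup>H *\<^sub>v y"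
    by (simp_all add: A_def B_def y_def vec_expand)
  moreover have "nsq ((c U\<^sub>1)\<^sup>H *\<^sub>v y) + nsq ((c U\<^sub>2)\<^sup>H *\<^sub>v y) = nsq y"
    by (rule column_isometry_nsq[of _ _ n]) (auto simp: cU)
  moreover have "y = (H * P) *\<^sub>v (U\<^sub>1 *\<^sub>v x)"
    using arg_cong[OF PU1, of "\<lambda>X. X *\<^sub>v x"] by (simp add: y_def vec_expand)
  then have "nsq y \<le> \<mu>\<^sup>2 * nsq (U\<^sub>1 *\<^sub>v x)"
    using l2_boundD[OF \<mu>(2), of "U\<^sub>1 *\<^sub>v x"] by simp
  moreover have "\<mu>\<^sup>2 * nsq (U\<^sub>1 *\<^sub>v x) \<le> \<mu>\<^sup>2 * nsq x"
    using l2_boundD[OF U, of x] by (intro mult_left_mono) simp_all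
  ultimately show ?thesis by simp
qed

lemma rip_R:
  assumes x [simp]: "dim_vec x = r"
  shows "rip (R *\<^sub>v x) x = \<mu>\<^sup>2 * nsq x - nsq (A *\<^sub>v x)"
  by (simp add: R_def minus_mult_mat_vec_dim rip_minus smult_mult_mat_vec_dim rip_smult nsq_mult_mat_vec
      del: of_real_power)

lemma psd_R: "psd_mat R"
  unfolding psd_mat_iff
proof (intro conjI allI impI)
  show "square_mat R" by simp
  show "R\<^sup>H = R" by (simp add: R_def mat_expand)
  fix x :: "complex vec" assume "dim_vec x = dim_row R"
  then have x: "dim_vec x = r" by simp
  show "0 \<le> rip (R *\<^sub>v x) x"
    using nsq_AB_le[OF x] nsq_nonneg[of "B *\<^sub>v x"] unfolding rip_R[OF x] by linarith
qed

lemma R_carrier: "R \<in> carrier_mat r r"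
  by (intro carrier_matI) simp_all

lemma S: "dim_row S = r" "dim_col S = r" "psd_mat S" "S * S = R" "S\<^sup>H = S"
  using sqrt_mat[OF R_carrier psd_R] by (auto simp: S_def)

lemma B_le_S:
  assumes x: "dim_vec x = r"
  shows "nsq (B *\<^sub>v x) \<le> nsq (S *\<^sub>v x)"
proof -
  have "nsq (S *\<^sub>v x) = rip (R *\<^sub>v x) x"
    using S x by (subst nsq_mult_mat_vec) auto
  then show ?thesis using nsq_AB_le[OF x] rip_R[OF x] by simp
qed

lemma Y_dim [simp]: "dim_row Y = m" "dim_col Y = r"
  using S by (simp_all add: Y_def)

lemma YS: "Y * S = B" and l2_bound_Y: "l2_bound 1 Y"
  unfolding Y_def
  using contraction_factor[OF S(3) S(1), of B] B_le_S by simp_all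

lemma one_minus_gram_carrier: "1\<^sub>m m - Y * Y\<^sup>H \<in> carrier_mat m m"
  by (intro carrier_matI) simp_all

lemma D: "dim_row D = m" "dim_col D = m" "psd_mat D" "D * D = 1\<^sub>m m - Y * Y\<^sup>H" "D\<^sup>H = D"
  using sqrt_mat[OF one_minus_gram_carrier psd_one_minus_gram[OF l2_bound_Y Y_dim(1)]]
  by (auto simp: D_def)

lemma W_dim [simp]: "dim_row W = r" "dim_col W = m"
  by (simp_all add: W_def)

lemma X22_dim [simp]: "dim_row X\<^sub>2\<^sub>2 = m" "dim_col X\<^sub>2\<^sub>2 = m"
  using D by (simp_all add: X\<^sub>2\<^sub>2_def)

lemma G_dim [simp]: "dim_row G = n" "dim_col G = n"
  by (simp_all add: G_def)

text \<open>The symmetry of \<open>H\<close> reflects the (2,1) block \<open>Y * S\<close> into the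
  (1,2) block, which gives the second factorisation needed by the block bound.\<close>

lemma X12: "(c U\<^sub>1)\<^sup>H * H * U\<^sub>2 = c S * W"
proof -
  have "(c B)\<^sup>H = e \<cdot>\<^sub>m ((c U\<^sub>1)\<^sup>H * H * U\<^sub>2)"
    by (simp add: B_def cj_expand mat_expand H)
  then have "(c U\<^sub>1)\<^sup>H * H * U\<^sub>2 = e \<cdot>\<^sub>m (c (Y * S))\<^sup>H"
    by (simp add: smult_smult_mat YS)
  also have "\<dots> = c S * W"
    using S by (simp add: W_def cj_expand mat_expand flip: cj_adjoint)
  finally show ?thesis .
qed

lemma cR: "c R = complex_of_real (\<mu>\<^sup>2) \<cdot>\<^sub>m 1\<^sub>m r - A * A\<^sup>H"
  by (simp add: R_def cj_expand star_A mat_expand)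

text \<open>Since \<open>c A\<close> is \<open>e\<close> times \<open>A\<^sup>H\<close>, the matrix
  \<open>c R\<close> is built from \<open>A * A\<^sup>H\<close> as \<open>R\<close> is from
  \<open>A\<^sup>H * A\<close>. Hence \<open>A * R = c R * A\<close> by associativity, and positive
  roots inherit the relation.\<close>

lemma intertwine: "A * S = c S * A"
proof (rule psd_intertwine[of S r "c S" r])
  show "S \<in> carrier_mat r r" "c S \<in> carrier_mat r r" "A \<in> carrier_mat r r"
    using S by (auto intro!: carrier_matI)
  show "psd_mat S" "psd_mat (c S)" using S psd_cj by auto
  have "c S * c S = c R" using S by (simp flip: cj_mult)
  then show "A * (S * S) = c S * c S * A"
    using S by (simp add: cR) (simp add: R_def mat_expand)
qed

section \<open>Norm, symmetry and explicit form of the completion\<close>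

lemma G_blocks:
  "G = c U\<^sub>1 * A * U\<^sub>1\<^sup>H + c U\<^sub>1 * (c S * W) * U\<^sub>2\<^sup>H + c U\<^sub>2 * (Y * S) * U\<^sub>1\<^sup>H + c U\<^sub>2 * X\<^sub>2\<^sub>2 * U\<^sub>2\<^sup>H"
proof -
  have "c U\<^sub>1 * A * U\<^sub>1\<^sup>H = (c U\<^sub>1 * (c U\<^sub>1)\<^sup>H) * H * (U\<^sub>1 * U\<^sub>1\<^sup>H)"
    by (simp add: A_def mult_assoc_dim)
  then have 1: "c U\<^sub>1 * A * U\<^sub>1\<^sup>H = c P * H * P" by (simp only: cU U1)
  have "c U\<^sub>1 * (c S * W) * U\<^sub>2\<^sup>H = (c U\<^sub>1 * (c U\<^sub>1)\<^sup>H) * H * (U\<^sub>2 * U\<^sub>2\<^sup>H)"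
    unfolding X12[symmetric] by (simp add: mult_assoc_dim)
  then have 2: "c U\<^sub>1 * (c S * W) * U\<^sub>2\<^sup>H = c P * H * (1\<^sub>m n - P)" by (simp only: cU U2)
  have "c U\<^sub>2 * (Y * S) * U\<^sub>1\<^sup>H = (c U\<^sub>2 * (c U\<^sub>2)\<^sup>H) * H * (U\<^sub>1 * U\<^sub>1\<^sup>H)"
    unfolding YS B_def by (simp add: mult_assoc_dim)
  then have 3: "c U\<^sub>2 * (Y * S) * U\<^sub>1\<^sup>H = (1\<^sub>m n - c P) * H * P" by (simp only: cU U1)
  show ?thesis
    unfolding G_def 1 2 3
    by (simp add: mat_expand) (intro eq_matI, auto simp del: index_mult_mat(1))
qed

text \<open>The block matrix stands between the coisometry \<open>[c U\<^sub>1 c U\<^sub>2]\<close>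
  on the left and the isometry with rows \<open>U\<^sub>1\<^sup>H\<close> and
  \<open>U\<^sub>2\<^sup>H\<close> on the right, so its bound carries over to
  \<open>G\<close>.\<close>

lemma G_bound: "l2_bound \<mu> G"
  unfolding l2_bound_def
proof (intro allI impI)
  fix x :: "complex vec" assume "dim_vec x = dim_col G"
  then have x [simp]: "dim_vec x = n" by simp
  define x1 where "x1 = U\<^sub>1\<^sup>H *\<^sub>v x"
  define x2 where "x2 = U\<^sub>2\<^sup>H *\<^sub>v x"
  define a where "a = A *\<^sub>v x1 + (c S * W) *\<^sub>v x2"
  define d where "d = (Y * S) *\<^sub>v x1 + X\<^sub>2\<^sub>2 *\<^sub>v x2"
  have dv [simp]: "dim_vec x1 = r" "dim_vec x2 = m" "dim_vec a = r" "dim_vec d = m"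
    using S by (simp_all add: x1_def x2_def a_def d_def)
  have "G *\<^sub>v x = c U\<^sub>1 *\<^sub>v a + c U\<^sub>2 *\<^sub>v d"
    unfolding G_blocks a_def d_def x1_def x2_def
    using S by (simp add: vec_expand) (intro eq_vecI, auto simp del: index_mult_mat_vec)
  also have "nsq \<dots> \<le> nsq a + nsq d"
    by (rule row_coisometry_nsq[of _ _ n]) (auto simp: cU)
  also have "\<dots> \<le> \<mu>\<^sup>2 * (nsq x1 + nsq x2)"
    unfolding a_def d_def X\<^sub>2\<^sub>2_def
  proof (rule dkw_block_bound[of A r r S "c S" Y m D W m "c D" Z])
    show "(c S)\<^sup>H = c S" "(c D)\<^sup>H = c D" using S D by (simp_all flip: cj_adjoint)
    show "A\<^sup>H * A + S * S = complex_of_real (\<mu>\<^sup>2) \<cdot>\<^sub>m 1\<^sub>m r"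
      by (simp add: S(4) R_def) (intro eq_matI, auto simp del: index_mult_mat(1))
    have "c S * c S = c R" using S by (simp flip: cj_mult)
    then show "A * A\<^sup>H + c S * c S = complex_of_real (\<mu>\<^sup>2) \<cdot>\<^sub>m 1\<^sub>m r"
      by (simp add: cR) (intro eq_matI, auto simp del: index_mult_mat(1))
    show "Y * Y\<^sup>H + D * D = 1\<^sub>m m"
      by (simp add: D(4)) (intro eq_matI, auto simp del: index_mult_mat(1))
    have "c D * c D = 1\<^sub>m m - c Y * (c Y)\<^sup>H"
      using D by (simp add: cj_expand flip: cj_mult[of D D])
    then show "W\<^sup>H * W + c D * c D = 1\<^sub>m m"
      by (simp add: W_def mat_expand) (intro eq_matI, auto simp del: index_mult_mat(1))
  qed (use S D Z intertwine in simp_all)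
  also have "nsq x1 + nsq x2 = nsq x"
    unfolding x1_def x2_def by (rule column_isometry_nsq[of _ _ n]) (auto simp: U1 U2)
  finally show "nsq (G *\<^sub>v x) \<le> \<mu>\<^sup>2 * nsq x" .
qed

text \<open>The star operation exchanges \<open>D\<close> with \<open>c D\<close> and
  \<open>Y\<close> with a multiple of \<open>W\<close>, while \<open>Z\<close> and
  \<open>A\<^sup>H\<close> are reproduced with the sign \<open>e\<close>.\<close>

lemma star_X22: "(c X\<^sub>2\<^sub>2)\<^sup>H = e \<cdot>\<^sub>m X\<^sub>2\<^sub>2"
proof -
  have cD: "(c D)\<^sup>H = c D" using D by (simp flip: cj_adjoint)
  show ?thesis
    using D by (simp add: X\<^sub>2\<^sub>2_def W_def cj_expand mat_expand star_A Z cD mult.commute)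
qed

lemma star_G: "(c G)\<^sup>H = e \<cdot>\<^sub>m G"
  by (simp add: G_def cj_expand mat_expand H cP P star_X22)
    (intro eq_matI, auto simp: algebra_simps simp del: index_mult_mat(1))

lemma G_mult_P: "G * P = H * P"
  by (simp add: G_def mat_expand P PU2) (intro eq_matI, auto simp del: index_mult_mat(1))

lemma over_G:
  assumes "over \<KK> H" "over \<KK> P" "over \<KK> U\<^sub>1" "over \<KK> U\<^sub>2" "over \<KK> Z"
  shows "over \<KK> G"
proof -
  have A: "over \<KK> A" and B: "over \<KK> B"
    using assms by (auto simp: A_def B_def intro!: over_intros)
  have "over \<KK> R" using A by (auto simp: R_def intro!: over_intros)
  then have S': "over \<KK> S" unfolding S_def by (rule over_sqrt_mat[OF _ R_carrier psd_R])
  have Y: "over \<KK> Y" using B S' S by (auto simp: Y_def intro!: over_intros)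
  then have "over \<KK> (1\<^sub>m m - Y * Y\<^sup>H)" by (auto intro!: over_intros)
  then have D': "over \<KK> D"
    unfolding D_def
    by (rule over_sqrt_mat[OF _ one_minus_gram_carrier psd_one_minus_gram[OF l2_bound_Y Y_dim(1)]])
  have W: "over \<KK> W" using Y by (auto simp: W_def intro!: over_intros)
  have "over \<KK> X\<^sub>2\<^sub>2" using D D' A W Y assms by (auto simp: X\<^sub>2\<^sub>2_def intro!: over_intros)
  then show ?thesis using assms by (auto simp: G_def intro!: over_intros)
qed

text \<open>\<open>K\<close> equals \<open>H * U\<^sub>1 * S\<^sup>\<dagger>\<close>, which is
  \<open>Y\<close> before coordinates are taken: multiplication by
  \<open>(c U\<^sub>2)\<^sup>H\<close> gives \<open>Y\<close>. The two square roots thus become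
  \<open>D\<close> and \<open>c D\<close>, and the correction term becomes the part
  \<open>Y * A\<^sup>H * W\<close> of the free block.\<close>

lemma G_formula:
  defines "C \<equiv> H * P"
  defines "R' \<equiv> complex_of_real (\<mu>\<^sup>2) \<cdot>\<^sub>m 1\<^sub>m r - e \<cdot>\<^sub>m (U\<^sub>1\<^sup>H * c C * C * U\<^sub>1)"
  defines "K \<equiv> C * U\<^sub>1 * inv_sqrt_mat R'"
  shows "G = H * P + c P * H - c P * H * P
    - c (1\<^sub>m n - P) * K * U\<^sub>1\<^sup>H * c (C * U\<^sub>1) * (c K)\<^sup>H * (1\<^sub>m n - P)
    + complex_of_real \<mu> \<cdot>\<^sub>m (c U\<^sub>2 * sqrt_mat (1\<^sub>m m - (c U\<^sub>2)\<^sup>H * K * K\<^sup>H * c U\<^sub>2) * Z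
        * sqrt_mat (1\<^sub>m m - U\<^sub>2\<^sup>H * c K * (c K)\<^sup>H * U\<^sub>2) * U\<^sub>2\<^sup>H)"
proof -
  have "R' = R" unfolding R'_def R_def C_def gram_A by (simp add: smult_smult_mat)
  then have K: "K = H * U\<^sub>1 * S\<^sup>\<dagger>"
    unfolding K_def C_def S_def inv_sqrt_mat_pinv[OF R_carrier psd_R, symmetric]
    by (simp add: mult_assoc_dim PU1)
  have [simp]: "dim_row K = n" "dim_col K = r" using S by (simp_all add: K)
  have U2K: "(c U\<^sub>2)\<^sup>H * K = Y" using S by (simp add: K Y_def B_def mult_assoc_dim)
  have cU2K: "U\<^sub>2\<^sup>H * c K = c Y" by (simp add: cj_expand flip: U2K)
  have KU2: "K\<^sup>H * c U\<^sub>2 = Y\<^sup>H" by (simp add: adjoint_mult flip: U2K)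
  have cKU2: "(c K)\<^sup>H * U\<^sub>2 = (c Y)\<^sup>H" by (simp add: adjoint_mult flip: cU2K)
  have 1: "(c U\<^sub>2)\<^sup>H * K * K\<^sup>H * c U\<^sub>2 = Y * Y\<^sup>H"
    by (simp add: mult_assoc_dim KU2) (simp add: U2K flip: mult_assoc_dim)
  have 2: "U\<^sub>2\<^sup>H * c K * (c K)\<^sup>H * U\<^sub>2 = c (Y * Y\<^sup>H)"
    by (simp add: mult_assoc_dim cKU2 cj_expand) (simp add: cU2K flip: mult_assoc_dim)
  have D1: "sqrt_mat (1\<^sub>m m - (c U\<^sub>2)\<^sup>H * K * K\<^sup>H * c U\<^sub>2) = D"
    unfolding 1 D_def ..
  have "1\<^sub>m m - c (Y * Y\<^sup>H) = c (1\<^sub>m m - Y * Y\<^sup>H)" by (simp add: cj_minus)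
  then have D2: "sqrt_mat (1\<^sub>m m - U\<^sub>2\<^sup>H * c K * (c K)\<^sup>H * U\<^sub>2) = c D"
    unfolding 2 D_def
    using sqrt_mat_cj[OF one_minus_gram_carrier psd_one_minus_gram[OF l2_bound_Y Y_dim(1)]] by simp
  have mid: "U\<^sub>1\<^sup>H * c (C * U\<^sub>1) = e \<cdot>\<^sub>m A\<^sup>H"
    unfolding star_A(1)[symmetric] by (simp add: C_def A_def mult_assoc_dim PU1 cj_expand)
  have "c (1\<^sub>m n - P) * K * U\<^sub>1\<^sup>H * c (C * U\<^sub>1) * (c K)\<^sup>H * (1\<^sub>m n - P)
      = c U\<^sub>2 * ((c U\<^sub>2)\<^sup>H * K) * (U\<^sub>1\<^sup>H * c (C * U\<^sub>1)) * ((c K)\<^sup>H * U\<^sub>2) * U\<^sub>2\<^sup>H"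
    unfolding U2(2)[symmetric] by (simp add: cj_expand mult_assoc_dim C_def)
  also have "\<dots> = c U\<^sub>2 * (Y * A\<^sup>H * W) * U\<^sub>2\<^sup>H"
    unfolding U2K cKU2 mid by (simp add: W_def mat_expand)
  finally have 3: "c (1\<^sub>m n - P) * K * U\<^sub>1\<^sup>H * c (C * U\<^sub>1) * (c K)\<^sup>H * (1\<^sub>m n - P)
      = c U\<^sub>2 * (Y * A\<^sup>H * W) * U\<^sub>2\<^sup>H" .
  show ?thesis
    unfolding D1 D2 3 G_def X\<^sub>2\<^sub>2_def
    using D by (simp add: mat_expand) (intro eq_matI, auto simp del: index_mult_mat(1))
qed

end

section \<open>The structured Procrustes problem\<close>

text \<open>The trace form lets factors move to the other argument by cyclicity, so orthogonality of
  blocks reduces to vanishing products of complementary projections.\<close>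

definition fip :: "complex mat \<Rightarrow> complex mat \<Rightarrow> real" where
  "fip A B = Re (tr_mat (A * B\<^sup>H))"

abbreviation fsq :: "complex mat \<Rightarrow> real" where
  "fsq A \<equiv> fip A A"

lemma tr_mat_mult:
  "dim_col A = dim_row B \<Longrightarrow> dim_col B = dim_row A \<Longrightarrow>
    tr_mat (A * B) = (\<Sum>i<dim_row A. \<Sum>j<dim_row B. A $$ (i, j) * B $$ (j, i))"
  unfolding tr_mat_def by (auto simp: mult_index simp del: index_mult_mat(1) intro!: sum.cong)

lemma tr_mat_commute:
  assumes "dim_col A = dim_row B" "dim_col B = dim_row A"
  shows "tr_mat (A * B) = tr_mat (B * A)"
  using assms by (simp add: tr_mat_mult) (subst sum.swap, simp add: mult.commute)

lemma tr_mat_adjoint: "dim_row A = dim_col A \<Longrightarrow> tr_mat (A\<^sup>H) = cnj (tr_mat A)"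
  by (simp add: tr_mat_def)

lemma tr_mat_add: "dim_row A = dim_row B \<Longrightarrow> dim_col A = dim_row A \<Longrightarrow> dim_col B = dim_row B \<Longrightarrow>
    tr_mat (A + B) = tr_mat A + tr_mat B"
  by (simp add: tr_mat_def sum.distrib)

lemma fsq_sum: "fsq A = (\<Sum>i<dim_row A. \<Sum>j<dim_col A. (cmod (A $$ (i, j)))\<^sup>2)"
  by (simp add: fip_def tr_mat_mult complex_norm_square[symmetric] flip: of_real_power)

lemma fsq_nonneg [simp]: "0 \<le> fsq A"
  by (simp add: fsq_sum sum_nonneg)

lemma frob_norm_fsq: "frob_norm A = sqrt (fsq A)"
  by (simp add: frob_norm_def fsq_sum)

lemma fsq_eq_0: "fsq A = 0 \<Longrightarrow> A = 0\<^sub>m (dim_row A) (dim_col A)"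
  by (intro eq_matI) (auto simp: fsq_sum sum_nonneg_eq_0_iff sum_nonneg)

lemma fsq_add:
  assumes "dim_row A = dim_row B" "dim_col A = dim_col B"
  shows "fsq (A + B) = fsq A + 2 * fip A B + fsq B"
proof -
  have "tr_mat (B * A\<^sup>H) = cnj (tr_mat (A * B\<^sup>H))"
    using assms by (simp add: adjoint_mult flip: tr_mat_adjoint)
  then show ?thesis
    using assms by (simp add: fip_def mat_expand tr_mat_add)
qed

lemma fip_mult_left:
  assumes "dim_col A = dim_row B" "dim_row C = dim_row A" "dim_col C = dim_col B"
  shows "fip (A * B) C = fip B (A\<^sup>H * C)"
  using assms tr_mat_commute[of A "B * C\<^sup>H"] by (simp add: fip_def mat_expand)

lemma fip_mult_right:
  assumes "dim_col B = dim_row A" "dim_row C = dim_row B" "dim_col C = dim_col A"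
  shows "fip (B * A) C = fip B (C * A\<^sup>H)"
  using assms by (simp add: fip_def mat_expand)

lemma fip_zero [simp]: "dim_row A = n \<Longrightarrow> dim_col A = m \<Longrightarrow> fip A (0\<^sub>m n m) = 0"
  by (simp add: fip_def tr_mat_def)

lemma fsq_isometry_mult:
  assumes "M\<^sup>H * M = 1\<^sub>m (dim_row A)" "dim_col M = dim_row A"
  shows "fsq (M * A) = fsq A"
proof -
  have "fsq (M * A) = fip A (M\<^sup>H * M * A)"
    using assms(2) by (simp add: fip_mult_left mult_assoc_dim)
  then show ?thesis using assms by simp
qed

lemma fsq_star: "fsq ((cj k A)\<^sup>H) = fsq A"
  by (cases k) (simp_all add: fsq_sum, (subst sum.swap, simp)+)

text \<open>One description for the four target classes: \<open>k\<close> chooses transpose or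
  conjugate transpose, and \<open>e\<close> the sign.\<close>

definition star_class :: "complex set \<Rightarrow> nat \<Rightarrow> sp_kind \<Rightarrow> complex \<Rightarrow> complex mat set" where
  "star_class \<KK> n k e = {H \<in> kmat \<KK> n n. (cj k H)\<^sup>H = e \<cdot>\<^sub>m H}"

text \<open>Jordan and Lie algebras enter through the same membership test on \<open>M * A\<close>.
  The carrier condition is separate because the dimensions of \<open>M * A\<close> do not determine
  the number of rows of \<open>A\<close>.\<close>

locale structured_class =
  fixes \<KK> :: "complex set" and k :: sp_kind and n :: nat and M :: "complex mat"
    and \<S> :: "complex mat set" and e :: complex
  assumes \<KK>: "\<KK> = \<real> \<or> \<KK> = UNIV"
    and n: "0 < n"
    and M: "M \<in> kmat \<KK> n n" "M\<^sup>H * M = 1\<^sub>m n" "M * M\<^sup>H = 1\<^sub>m n"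
    and e: "e \<in> {1, -1}"
    and \<S>_iff: "A \<in> \<S> \<longleftrightarrow> A \<in> carrier_mat n n \<and> M * A \<in> star_class \<KK> n k e"
begin

abbreviation "c \<equiv> cj k"

lemma M_dim [simp]: "dim_row M = n" "dim_col M = n"
  using M(1) by (auto simp: kmat_def)

lemma inv_M: "inv_mat M = M\<^sup>H"
  using M by (intro inv_mat_eqI[of _ n]) (auto intro!: carrier_matI)

lemma M_cancel: "dim_row A = n \<Longrightarrow> M\<^sup>H * (M * A) = A" "dim_row A = n \<Longrightarrow> M * (M\<^sup>H * A) = A"
  by (simp_all add: M flip: mult_assoc_dim)

lemma lmult_class: "lmult M \<S> = star_class \<KK> n k e"
proof
  show "lmult M \<S> \<subseteq> star_class \<KK> n k e" by (auto simp: lmult_def \<S>_iff)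
  show "star_class \<KK> n k e \<subseteq> lmult M \<S>"
  proof
    fix H assume H: "H \<in> star_class \<KK> n k e"
    then have "dim_row H = n" "dim_col H = n" by (auto simp: star_class_def kmat_def)
    then have "M\<^sup>H * H \<in> \<S>" "H = M * (M\<^sup>H * H)"
      using H by (auto simp: \<S>_iff M_cancel intro!: carrier_matI)
    then show "H \<in> lmult M \<S>" unfolding lmult_def by blast
  qed
qed

lemma spectral_norm_inv_M: "dim_row A = n \<Longrightarrow> spectral_norm (M\<^sup>H * A) = spectral_norm A"
  by (rule spectral_norm_isometry_mult) (simp_all add: M)

lemma fsq_M: "dim_row A = n \<Longrightarrow> fsq (M * A) = fsq A"
  by (rule fsq_isometry_mult) (simp_all add: M)

lemma fsq_inv_M: "dim_row A = n \<Longrightarrow> fsq (M\<^sup>H * A) = fsq A"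
  by (rule fsq_isometry_mult) (simp_all add: M)

end

locale procrustes = structured_class +
  fixes p :: nat and X B A\<^sub>0 :: "complex mat"
  assumes X: "X \<in> kmat \<KK> n p" and B: "B \<in> kmat \<KK> n p" and A0: "A\<^sub>0 \<in> proc_sols \<S> X B"
begin

definition "P = X * X\<^sup>\<dagger>"
definition "Q = 1\<^sub>m n - P"
definition "H = M * A\<^sub>0"
text \<open>The structured map expressed by a solution \<open>A\<^sub>0\<close>. It does not depend
  on that choice: \<open>H * P\<close> is \<open>M * B * X\<^sup>\<dagger>\<close>, and
  \<open>c P * H\<close> is the star image of \<open>H * P\<close> up to the sign
  \<open>e\<close>.\<close>

definition "F = H * P + c P * H - c P * H * P"

lemma dims [simp]: "dim_row X = n" "dim_col X = p" "dim_row B = n" "dim_col B = p"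
  "dim_row A\<^sub>0 = n" "dim_col A\<^sub>0 = n" "dim_row P = n" "dim_col P = n" "dim_row Q = n" "dim_col Q = n"
  "dim_row H = n" "dim_col H = n" "dim_row F = n" "dim_col F = n"
  using X B A0 by (auto simp: kmat_def proc_sols_def \<S>_iff P_def Q_def H_def F_def)

lemma overs: "over \<KK> X" "over \<KK> B" "over \<KK> P" "over \<KK> Q" "over \<KK> H" "over \<KK> F"
proof -
  show X': "over \<KK> X" and "over \<KK> B" using X B \<KK> by (auto simp: kmat_iff)
  show P': "over \<KK> P" using X' unfolding P_def by (intro over_intros) simp_all
  then show "over \<KK> Q" unfolding Q_def by (intro over_intros) simp_all
  show H': "over \<KK> H" using A0 \<KK> by (auto simp: proc_sols_def \<S>_iff H_def star_class_def kmat_iff)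
  show "over \<KK> F" using P' H' unfolding F_def by (intro over_intros) simp_all
qed

lemma e_simps [simp]: "e * e = 1" "cnj e = e" "e * (e * x) = x"
  using e by auto

lemma P: "P\<^sup>H = P" "P * P = P" "P * X = X" "(c P)\<^sup>H = c P" "c P * c P = c P"
proof -
  show PH: "P\<^sup>H = P" and PX: "P * X = X" by (simp_all add: P_def pinv_mat_simps)
  show PP: "P * P = P" using PX by (subst (2 3) P_def) (simp flip: mult_assoc_dim)
  show "(c P)\<^sup>H = c P" "c P * c P = c P" using PH PP by (simp_all flip: cj_adjoint cj_mult)
qed

lemma Q: "Q\<^sup>H = Q" "Q * Q = Q" "Q * X = 0\<^sub>m n p" "P * Q = 0\<^sub>m n n" "Q * P = 0\<^sub>m n n"
  "(c Q)\<^sup>H = c Q" "c P * c Q = 0\<^sub>m n n" "c Q * c P = 0\<^sub>m n n"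
proof -
  show QH: "Q\<^sup>H = Q" and "Q * X = 0\<^sub>m n p" and PQ: "P * Q = 0\<^sub>m n n" and QP: "Q * P = 0\<^sub>m n n"
    by (simp_all add: Q_def mat_expand P)
  show "Q * Q = Q" unfolding Q_def by (simp add: mat_expand P) (intro eq_matI, auto)
  show "(c Q)\<^sup>H = c Q" using QH by (simp flip: cj_adjoint)
  show "c P * c Q = 0\<^sub>m n n" "c Q * c P = 0\<^sub>m n n" using PQ QP by (simp_all flip: cj_mult)
qed

lemma H: "(c H)\<^sup>H = e \<cdot>\<^sub>m H" "H * X = M * B"
  using A0 by (auto simp: proc_sols_def \<S>_iff H_def star_class_def mult_assoc_dim)

lemma MBX: "M * B * X\<^sup>\<dagger> = H * P"
  by (simp add: P_def mult_assoc_dim flip: H(2))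

lemma BX: "B * X\<^sup>\<dagger> = M\<^sup>H * (H * P)"
  unfolding MBX[symmetric] by (simp add: mult_assoc_dim M_cancel)

lemma star_classD:
  assumes "H' \<in> star_class \<KK> n k e"
  shows "dim_row H' = n" "dim_col H' = n" "over \<KK> H'" "(c H')\<^sup>H = e \<cdot>\<^sub>m H'"
  using assms \<KK> by (auto simp: star_class_def kmat_iff)

lemma star_classI:
  assumes "dim_row H' = n" "dim_col H' = n" "over \<KK> H'" "(c H')\<^sup>H = e \<cdot>\<^sub>m H'"
  shows "H' \<in> star_class \<KK> n k e"
  using assms \<KK> by (auto simp: star_class_def kmat_iff intro!: carrier_matI)

lemma proc_sols_iff:
  "A \<in> proc_sols \<S> X B \<longleftrightarrow> A \<in> carrier_mat n n \<and> M * A \<in> star_class \<KK> n k e \<and> M * A * X = M * B"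
proof -
  have "A * X = B \<longleftrightarrow> M * A * X = M * B" if "A \<in> carrier_mat n n"
  proof -
    have "dim_row A = n" "dim_col A = n" using that by auto
    then have "M * A * X = M * (A * X)" "M\<^sup>H * (M * (A * X)) = A * X" "M\<^sup>H * (M * B) = B"
      by (simp_all add: mult_assoc_dim M_cancel)
    then show ?thesis by metis
  qed
  then show ?thesis by (auto simp: proc_sols_def \<S>_iff)
qed

lemma F_class: "F \<in> star_class \<KK> n k e"
proof (rule star_classI)
  show "(c F)\<^sup>H = e \<cdot>\<^sub>m F"
    by (simp add: F_def cj_expand mat_expand H P) (intro eq_matI, auto simp: algebra_simps simp del: index_mult_mat(1))
qed (simp_all add: overs)

lemma F_mult_X: "F * X = M * B"
  by (simp add: F_def mat_expand P H) (intro eq_matI, auto simp del: index_mult_mat(1))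

lemma solution_shift:
  assumes Z: "Z \<in> star_class \<KK> n k e"
  shows "F + c Q * Z * Q \<in> star_class \<KK> n k e" "(F + c Q * Z * Q) * X = M * B"
proof -
  note Z = star_classD[OF Z]
  note [simp] = Z(1,2)
  show "F + c Q * Z * Q \<in> star_class \<KK> n k e"
  proof (rule star_classI)
    show "over \<KK> (F + c Q * Z * Q)" using Z by (intro over_intros overs) simp_all
    show "(c (F + c Q * Z * Q))\<^sup>H = e \<cdot>\<^sub>m (F + c Q * Z * Q)"
      using star_classD(4)[OF F_class] by (simp add: cj_expand mat_expand Z Q)
  qed simp_all
  show "(F + c Q * Z * Q) * X = M * B"
    by (simp add: mat_expand Q F_mult_X)
qed

lemma solution_decomp:
  assumes H': "H' \<in> star_class \<KK> n k e" "H' * X = M * B"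
  shows "H' = F + c Q * H' * Q"
proof -
  note Z = star_classD[OF H'(1)]
  note [simp] = Z(1,2)
  have 1: "H' * P = H * P" unfolding P_def using H'(2) H(2) by (simp flip: mult_assoc_dim)
  have "(c (H' * P))\<^sup>H = e \<cdot>\<^sub>m (c P * H')" "(c (H * P))\<^sup>H = e \<cdot>\<^sub>m (c P * H)"
    by (simp_all add: cj_expand mat_expand Z P H)
  then have "e \<cdot>\<^sub>m (e \<cdot>\<^sub>m (c P * H')) = e \<cdot>\<^sub>m (e \<cdot>\<^sub>m (c P * H))" by (simp only: 1)
  then have 2: "c P * H' = c P * H" by (simp add: smult_smult_mat)
  have "F = H' * P + c P * H' - c P * H' * P"
    unfolding F_def by (simp only: 1 2)
  then show ?thesis
    by (simp add: Q_def cj_expand mat_expand) (intro eq_matI, auto simp del: index_mult_mat(1))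
qed

lemma solutions:
  "A \<in> proc_sols \<S> X B \<longleftrightarrow> (\<exists>Z \<in> star_class \<KK> n k e. A = inv_mat M * F + inv_mat M * c Q * Z * Q)"
proof
  assume "A \<in> proc_sols \<S> X B"
  then have A: "A \<in> carrier_mat n n" and MA: "M * A \<in> star_class \<KK> n k e" "M * A * X = M * B"
    by (auto simp: proc_sols_iff)
  have [simp]: "dim_row A = n" "dim_col A = n" using A by auto
  have "A = M\<^sup>H * (F + c Q * (M * A) * Q)"
    using solution_decomp[OF MA] M_cancel(1)[of A] by simp
  also have "\<dots> = inv_mat M * F + inv_mat M * c Q * (M * A) * Q"
    by (simp add: inv_M mat_expand)
  finally show "\<exists>Z \<in> star_class \<KK> n k e. A = inv_mat M * F + inv_mat M * c Q * Z * Q"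
    using MA(1) by blast
next
  assume "\<exists>Z \<in> star_class \<KK> n k e. A = inv_mat M * F + inv_mat M * c Q * Z * Q"
  then obtain Z where Z: "Z \<in> star_class \<KK> n k e" and A: "A = inv_mat M * F + inv_mat M * c Q * Z * Q" by blast
  have [simp]: "dim_row Z = n" "dim_col Z = n" using star_classD[OF Z] by auto
  have [simp]: "dim_row A = n" "dim_col A = n" by (simp_all add: A inv_M)
  have "M * A = F + c Q * Z * Q"
    by (simp add: A inv_M mat_expand M_cancel)
  then show "A \<in> proc_sols \<S> X B"
    using solution_shift[OF Z] by (auto simp: proc_sols_iff intro!: carrier_matI)
qed

lemma inv_M_F_sol: "inv_mat M * F \<in> proc_sols \<S> X B"
  using F_class F_mult_X by (auto simp: proc_sols_iff inv_M M_cancel intro!: carrier_matI)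

lemma F_split: "F = H * P + c P * H * Q"
  by (simp add: F_def Q_def mat_expand) (intro eq_matI, auto simp del: index_mult_mat(1))

section \<open>Frobenius norm of the solutions\<close>

lemma fsq_solution:
  assumes A: "A \<in> proc_sols \<S> X B"
  shows "fsq A = fsq F + fsq (c Q * (M * A) * Q)"
proof -
  from A have A: "A \<in> carrier_mat n n" and MA: "M * A \<in> star_class \<KK> n k e" "M * A * X = M * B"
    by (auto simp: proc_sols_iff)
  have [simp]: "dim_row A = n" "dim_col A = n" using A by auto
  have "fip (H * P) (c Q * (M * A) * Q) = 0"
    by (subst fip_mult_right) (simp_all add: mult_assoc_dim P Q)
  moreover have "fip (c P * (H * Q)) (c Q * (M * A) * Q) = 0"
    by (subst fip_mult_left) (simp_all add: P Q flip: mult_assoc_dim)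
  moreover have "fip F (c Q * (M * A) * Q) = fip (H * P) (c Q * (M * A) * Q) + fip (c P * (H * Q)) (c Q * (M * A) * Q)"
    by (simp add: F_split fip_def mat_expand tr_mat_add)
  ultimately have 0: "fip F (c Q * (M * A) * Q) = 0" by simp
  have "fsq A = fsq (M * A)" by (simp add: fsq_M)
  also have "\<dots> = fsq (F + c Q * (M * A) * Q)" using solution_decomp[OF MA] by simp
  finally show ?thesis by (simp add: fsq_add 0)
qed

lemma fsq_F: "fsq (inv_mat M * F) = fsq F"
  by (simp add: inv_M fsq_inv_M)

lemma frob_dist: "proc_dist frob_norm \<S> X B = frob_norm (inv_mat M * F)"
  unfolding proc_dist_def
proof (rule cInf_eq_minimum)
  show "frob_norm (inv_mat M * F) \<in> frob_norm ` proc_sols \<S> X B" using inv_M_F_sol by blast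
  fix x assume "x \<in> frob_norm ` proc_sols \<S> X B"
  then show "frob_norm (inv_mat M * F) \<le> x"
    using fsq_solution by (auto simp: frob_norm_fsq fsq_F)
qed

lemma frob_unique:
  "A \<in> proc_sols \<S> X B \<and> A * X = B \<and> proc_dist frob_norm \<S> X B = frob_norm A \<longleftrightarrow> A = inv_mat M * F"
proof
  assume "A \<in> proc_sols \<S> X B \<and> A * X = B \<and> proc_dist frob_norm \<S> X B = frob_norm A"
  then have sol: "A \<in> proc_sols \<S> X B" and norm: "frob_norm (inv_mat M * F) = frob_norm A"
    by (auto simp: frob_dist)
  from sol have A: "A \<in> carrier_mat n n" and MA: "M * A \<in> star_class \<KK> n k e" "M * A * X = M * B"
    by (auto simp: proc_sols_iff)
  have [simp]: "dim_row A = n" "dim_col A = n" using A by auto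
  have "fsq (c Q * (M * A) * Q) = 0"
    using norm fsq_solution[OF sol] by (simp add: frob_norm_fsq fsq_F)
  from fsq_eq_0[OF this] have 0: "c Q * (M * A) * Q = 0\<^sub>m n n" by simp
  have "M * A = F + c Q * (M * A) * Q" by (rule solution_decomp[OF MA])
  also have "\<dots> = F" unfolding 0 by simp
  finally have "M * A = F" .
  then show "A = inv_mat M * F" using M_cancel(1)[of A] by (simp add: inv_M)
next
  assume "A = inv_mat M * F"
  then show "A \<in> proc_sols \<S> X B \<and> A * X = B \<and> proc_dist frob_norm \<S> X B = frob_norm A"
    using inv_M_F_sol frob_dist by (auto simp: proc_sols_def)
qed

text \<open>The trace in the value formula is a priori complex. Idempotence of \<open>c P\<close>
  and cyclicity turn it into the trace of a matrix times its own adjoint, which is the squared norm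
  of the block \<open>c P * H * P\<close>.\<close>

lemma frob_trace:
  defines "t \<equiv> tr_mat (H * P * (H * P)\<^sup>H * c P)"
  shows "t \<in> \<real>" "Re t = fsq (c P * H * P)"
proof -
  have "tr_mat (c P * (H * P) * (c P * (H * P))\<^sup>H) = tr_mat (c P * ((H * P) * (H * P)\<^sup>H * c P))"
    by (simp add: mat_expand P)
  also have "\<dots> = tr_mat ((H * P) * (H * P)\<^sup>H * c P * c P)"
    by (rule tr_mat_commute) simp_all
  also have "\<dots> = t"
    by (simp add: t_def mult_assoc_dim P)
  finally have t: "t = tr_mat (c P * H * P * (c P * H * P)\<^sup>H)" by (simp add: mult_assoc_dim)
  then show "Re t = fsq (c P * H * P)" by (simp add: fip_def)
  have "cnj t = t" unfolding t by (subst tr_mat_adjoint[symmetric]) (simp_all add: adjoint_mult mult_assoc_dim)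
  then show "t \<in> \<real>" by (simp add: Reals_cnj_iff)
qed

text \<open>The star operation preserves the Frobenius norm, so \<open>c P * H\<close> and
  \<open>H * P\<close> have equal norms. \<open>F\<close> is \<open>H * P\<close> plus the block
  \<open>c P * H * Q\<close>, and \<open>c P * H\<close> is that block plus
  \<open>c P * H * P\<close>; Pythagoras applied twice gives the factor 2 and the subtracted
  trace.\<close>

lemma frob_value:
  "frob_norm (inv_mat M * F) = sqrt (2 * (frob_norm (B * X\<^sup>\<dagger>))\<^sup>2 - Re (tr_mat (H * P * (H * P)\<^sup>H * c P)))"
proof -
  have 1: "fip (H * P) (c P * H * Q) = 0"
    by (subst fip_mult_right) (simp_all add: mult_assoc_dim P Q)
  have 2: "fip (c P * H * P) (c P * H * Q) = 0"
    by (subst fip_mult_right) (simp_all add: mult_assoc_dim P Q)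
  have "c P * H = c P * H * P + c P * H * Q"
    by (simp add: Q_def mat_expand) (intro eq_matI, auto simp del: index_mult_mat(1))
  then have "fsq (c P * H) = fsq (c P * H * P) + fsq (c P * H * Q)"
    using fsq_add[of "c P * H * P" "c P * H * Q"] 2 by simp
  moreover have "fsq (c P * H) = fsq (H * P)"
  proof -
    have "(c (H * P))\<^sup>H = e \<cdot>\<^sub>m (c P * H)" by (simp add: cj_expand mat_expand H P)
    then have "fsq (H * P) = fsq (e \<cdot>\<^sub>m (c P * H))" using fsq_star[of k "H * P"] by simp
    also have "\<dots> = fsq (c P * H)" using e by (auto simp: fsq_sum norm_mult simp del: index_mult_mat(1))
    finally show ?thesis by simp
  qed
  ultimately have "fsq F = 2 * fsq (H * P) - fsq (c P * H * P)"
    unfolding F_split using fsq_add[of "H * P" "c P * H * Q"] 1 by simp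
  moreover have "(frob_norm (B * X\<^sup>\<dagger>))\<^sup>2 = fsq (H * P)"
    by (simp add: frob_norm_fsq BX fsq_inv_M)
  ultimately show ?thesis by (simp add: frob_norm_fsq fsq_F frob_trace)
qed

section \<open>Spectral norm of the solutions\<close>

definition "\<mu> = spectral_norm (B * X\<^sup>\<dagger>)"

lemma mu: "0 \<le> \<mu>" "l2_bound \<mu> (H * P)"
proof -
  have "spectral_norm (H * P) = \<mu>" by (simp add: \<mu>_def BX spectral_norm_inv_M)
  then show "l2_bound \<mu> (H * P)" using l2_bound_spectral_norm[of "H * P"] by simp
qed (simp add: \<mu>_def)

lemma l2_bound_P: "l2_bound 1 P"
  unfolding l2_bound_def
proof (intro allI impI)
  fix x :: "complex vec" assume "dim_vec x = dim_col P"
  then have x [simp]: "dim_vec x = n" by simp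
  have "0 \<le> nsq (P *\<^sub>v x - x)" by simp
  moreover have "nsq (P *\<^sub>v x) = rip (P *\<^sub>v x) x" by (simp add: nsq_mult_mat_vec P)
  ultimately show "nsq (P *\<^sub>v x) \<le> 1\<^sup>2 * nsq x" by (simp add: nsq_minus)
qed

lemma mu_le_spectral_norm:
  assumes "A \<in> carrier_mat n n" "A * X = B"
  shows "\<mu> \<le> spectral_norm A"
proof -
  have [simp]: "dim_row A = n" "dim_col A = n" using assms by auto
  have "B * X\<^sup>\<dagger> = A * P" using assms(2) by (simp add: P_def flip: mult_assoc_dim)
  then show ?thesis using spectral_norm_mult_le[of A P] l2_bound_P by (simp add: \<mu>_def)
qed

lemma dkw_completion:
  assumes U1: "U\<^sub>1 \<in> carrier_mat n r" "U\<^sub>1 * U\<^sub>1\<^sup>H = P" "over \<KK> U\<^sub>1"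
    and U2: "U\<^sub>2 \<in> carrier_mat n m" "U\<^sub>2 * U\<^sub>2\<^sup>H = Q" "over \<KK> U\<^sub>2"
    and Z: "Z \<in> carrier_mat m m" "(c Z)\<^sup>H = e \<cdot>\<^sub>m Z" "l2_bound 1 Z" "over \<KK> Z"
  defines "R \<equiv> complex_of_real (\<mu>\<^sup>2) \<cdot>\<^sub>m 1\<^sub>m r - e \<cdot>\<^sub>m (U\<^sub>1\<^sup>H * c (H * P) * (H * P) * U\<^sub>1)"
  defines "K \<equiv> H * P * U\<^sub>1 * inv_sqrt_mat R"
  defines "A\<^sub>o \<equiv> inv_mat M * F
    - inv_mat M * c Q * K * U\<^sub>1\<^sup>H * c (H * P * U\<^sub>1) * (c K)\<^sup>H * Q
    + inv_mat M * (complex_of_real \<mu> \<cdot>\<^sub>m (c U\<^sub>2 * sqrt_mat (1\<^sub>m m - (c U\<^sub>2)\<^sup>H * K * K\<^sup>H * c U\<^sub>2) * Z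
        * sqrt_mat (1\<^sub>m m - U\<^sub>2\<^sup>H * c K * (c K)\<^sup>H * U\<^sub>2) * U\<^sub>2\<^sup>H))"
  shows "A\<^sub>o \<in> proc_sols \<S> X B" "spectral_norm A\<^sub>o = \<mu>"
proof -
  interpret D: dkw k e n r m H P U\<^sub>1 U\<^sub>2 Z \<mu>
    by unfold_locales (use e H P U1 U2 Z mu in \<open>auto simp: Q_def intro!: carrier_matI\<close>)
  have R: "R = D.R"
    unfolding R_def D.R_def D.gram_A by (simp only: smult_smult_mat e_simps one_smult_mat)
  have "D.G = F - c Q * K * U\<^sub>1\<^sup>H * c (H * P * U\<^sub>1) * (c K)\<^sup>H * Q
    + complex_of_real \<mu> \<cdot>\<^sub>m (c U\<^sub>2 * sqrt_mat (1\<^sub>m m - (c U\<^sub>2)\<^sup>H * K * K\<^sup>H * c U\<^sub>2) * Z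
        * sqrt_mat (1\<^sub>m m - U\<^sub>2\<^sup>H * c K * (c K)\<^sup>H * U\<^sub>2) * U\<^sub>2\<^sup>H)"
    unfolding F_def Q_def K_def R_def by (rule D.G_formula)
  moreover have [simp]: "dim_row K = n" "dim_row U\<^sub>1 = n" "dim_row U\<^sub>2 = n" "dim_col U\<^sub>1 = r" "dim_col U\<^sub>2 = m"
    using U1 U2 by (auto simp: K_def)
  moreover have "dim_col K = r"
    unfolding K_def R inv_sqrt_mat_pinv[OF D.R_carrier D.psd_R] by (simp add: D.S flip: D.S_def)
  ultimately have Ao: "A\<^sub>o = M\<^sup>H * D.G"
    by (simp add: A\<^sub>o_def inv_M mult_assoc_dim mult_add_dim mult_minus_dim)
  have "D.G * X = D.G * P * X" by (simp add: mult_assoc_dim P)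
  also have "\<dots> = M * B" unfolding D.G_mult_P by (simp add: mult_assoc_dim P H)
  finally have GX: "D.G * X = M * B" .
  have "D.G \<in> star_class \<KK> n k e"
    using U1 U2 Z by (intro star_classI D.over_G overs D.star_G) simp_all
  then show sol: "A\<^sub>o \<in> proc_sols \<S> X B"
    using GX by (auto simp: proc_sols_iff Ao M_cancel intro!: carrier_matI)
  have "spectral_norm A\<^sub>o \<le> \<mu>"
    using spectral_norm_le[OF mu(1) D.G_bound] by (simp add: Ao spectral_norm_inv_M)
  moreover have "\<mu> \<le> spectral_norm A\<^sub>o"
    using sol by (intro mu_le_spectral_norm) (auto simp: proc_sols_def \<S>_iff)
  ultimately show "spectral_norm A\<^sub>o = \<mu>" by simp
qed

text \<open>
  The blocks \<open>U\<^sub>1 = P\<close>, \<open>U\<^sub>2 = Q\<close> are admissible, so that no singular value decomposition is needed here.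
\<close>

lemma spectral_minimizer: "\<exists>A \<in> proc_sols \<S> X B. spectral_norm A = \<mu>"
proof -
  have "l2_bound 1 (0\<^sub>m n n)"
    by (simp add: l2_bound_def) (auto simp: nsq_sum scalar_prod_def sum_nonneg)
  moreover have "(c (0\<^sub>m n n))\<^sup>H = e \<cdot>\<^sub>m 0\<^sub>m n n" by simp
  moreover have "P \<in> carrier_mat n n" "Q \<in> carrier_mat n n" by (auto intro: carrier_matI)
  moreover have "P * P\<^sup>H = P" "Q * Q\<^sup>H = Q" using P Q by simp_all
  ultimately show ?thesis
    using dkw_completion[of P n Q n "0\<^sub>m n n"] overs by (blast intro: over_zero zero_carrier_mat)
qed

lemma spectral_dist: "proc_dist spectral_norm \<S> X B = \<mu>"
  unfolding proc_dist_def
proof (rule cInf_eq_minimum)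
  show "\<mu> \<in> spectral_norm ` proc_sols \<S> X B" using spectral_minimizer by force
  fix x assume "x \<in> spectral_norm ` proc_sols \<S> X B"
  then obtain A where "A \<in> proc_sols \<S> X B" "x = spectral_norm A" by blast
  then show "\<mu> \<le> x"
    using mu_le_spectral_norm[of A] by (simp add: proc_sols_def \<S>_iff)
qed

text \<open>Consistency makes \<open>B * X\<^sup>\<dagger>\<close> itself a solution, as writing
  \<open>B = A\<^sub>0 * X\<close> shows, and its norm is the lower bound.\<close>

lemma spectral_dist_unstructured: "proc_dist spectral_norm (kmat \<KK> n n) X B = \<mu>"
  unfolding proc_dist_def
proof (rule cInf_eq_minimum)
  have "B * X\<^sup>\<dagger> * X = A\<^sub>0 * X * X\<^sup>\<dagger> * X" using A0 by (simp add: proc_sols_def)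
  also have "\<dots> = A\<^sub>0 * (X * X\<^sup>\<dagger> * X)" by (simp add: mult_assoc_dim)
  also have "\<dots> = B" using A0 by (simp add: pinv_mat_simps proc_sols_def)
  finally have "B * X\<^sup>\<dagger> * X = B" .
  moreover have "B * X\<^sup>\<dagger> \<in> kmat \<KK> n n"
    using overs \<KK> by (auto simp: kmat_iff intro!: carrier_matI over_intros)
  ultimately show "\<mu> \<in> spectral_norm ` proc_sols (kmat \<KK> n n) X B"
    by (auto simp: proc_sols_def \<mu>_def)
  fix x assume "x \<in> spectral_norm ` proc_sols (kmat \<KK> n n) X B"
  then obtain A where "A \<in> proc_sols (kmat \<KK> n n) X B" "x = spectral_norm A" by blast
  then show "\<mu> \<le> x"
    using mu_le_spectral_norm[of A] by (simp add: proc_sols_def kmat_def)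
qed

text \<open>Solvability forces \<open>G\<close> to have star symmetry with sign \<open>e\<close>,
  which selects the formula. When \<open>G\<close> has both symmetries, \<open>W\<close> decides,
  and the hypothesis ties this decision to \<open>e\<close>.\<close>

lemma proc_map_F:
  assumes W: "W \<in> {sym_mats \<KK> n, Herm_mats n} \<longleftrightarrow> e = 1"
  shows "proc_map \<KK> n W k X (M * B) = F"
proof -
  define G where "G = (c X)\<^sup>H * (M * B)"
  have [simp]: "dim_row G = p" "dim_col G = p" by (simp_all add: G_def)
  have G: "(c G)\<^sup>H = e \<cdot>\<^sub>m G"
    by (simp add: G_def cj_expand mat_expand H flip: H(2))
  have 1: "M * B * X\<^sup>\<dagger> = H * P" by (rule MBX)
  have 2: "(c (H * P))\<^sup>H = e \<cdot>\<^sub>m (c P * H)" by (simp add: cj_expand mat_expand H P)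
  have "(c (X\<^sup>\<dagger>))\<^sup>H * G * X\<^sup>\<dagger> = (c (X * X\<^sup>\<dagger>))\<^sup>H * H * (X * X\<^sup>\<dagger>)"
    by (simp add: G_def cj_expand mat_expand flip: H(2))
  then have 3: "(c (X\<^sup>\<dagger>))\<^sup>H * G * X\<^sup>\<dagger> = c P * H * P"
    by (simp add: P flip: P_def)
  have minus: "H * P - (-1) \<cdot>\<^sub>m (c P * H) - c P * H * P = F"
    unfolding F_def by (intro eq_matI) (auto simp del: index_mult_mat(1))
  consider "e = 1" | "e = -1" using e by auto
  then show ?thesis
  proof cases
    case pos: 1
    then have "(c G)\<^sup>H = G" using G by simp
    then show ?thesis
      using pos W unfolding proc_map_def star_mat_cj Let_def G_def[symmetric] 1 2 3
      by (auto simp: F_def)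
  next
    case neg: 2
    then have "(c G)\<^sup>H = - G" using G by (simp add: uminus_mat_smult)
    then show ?thesis
      using neg W unfolding proc_map_def star_mat_cj Let_def G_def[symmetric] 1 2 3
      by (auto simp: minus)
  qed
qed

end

section \<open>Singular value decompositions\<close>

text \<open>Factoring each matrix through the other makes the column spaces of \<open>A\<close> and
  \<open>U\<close> equal, and orthonormal columns are independent. This serves to identify the rank
  with the number of positive singular values.\<close>

lemma rank_isometry_factorization:
  fixes A :: "complex mat"
  assumes A: "A \<in> carrier_mat n p" and U: "U \<in> carrier_mat n t" and UU: "U\<^sup>H * U = 1\<^sub>m t"
    and N: "N \<in> carrier_mat t p" "A = U * N" and N': "N' \<in> carrier_mat p t" "U = A * N'"
  shows "vec_space.rank n A = t"
proof -
  interpret vec_space "TYPE(complex)" n .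
  have dU: "dim_row U = n" "dim_col U = t" using U by auto
  have sub: "span (set (cols X)) \<subseteq> span (set (cols Y))"
    if fac: "X \<in> carrier_mat n a" "Y \<in> carrier_mat n b" "L \<in> carrier_mat b a" "X = Y * L" for X Y L a b
  proof
    fix y assume "y \<in> span (set (cols X))"
    then obtain x where x: "x \<in> carrier_vec a" "y = X *\<^sub>v x"
      using col_space_eq[OF fac(1)] fac(1) unfolding col_space_def by auto
    then have "y = Y *\<^sub>v (L *\<^sub>v x)" using fac by (simp add: assoc_mult_mat_vec)
    moreover have "L *\<^sub>v x \<in> carrier_vec b" using fac x by simp
    ultimately show "y \<in> span (set (cols Y))"
      using col_space_eq[OF fac(2)] fac(2) unfolding col_space_def by auto
  qed
  have "span (set (cols A)) = span (set (cols U))"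
    using sub[OF A U N] sub[OF U A N'] by blast
  then have "rank A = rank U" by (simp add: rank_def)
  also have "rank U = t"
  proof (rule lin_indpt_full_rank[OF U])
    show dist: "distinct (cols U)"
      unfolding distinct_conv_nth
    proof (intro allI impI)
      fix i j assume ij: "i < length (cols U)" "j < length (cols U)" "i \<noteq> j"
      then have ij': "i < t" "j < t" using dU by auto
      \<comment> \<open>Row \<open>i\<close> of \<open>U\<^sup>H\<close> pairs to 1 with column
        \<open>i\<close> and to 0 with column \<open>j\<close>, so these columns differ.\<close>
      have entry: "(U\<^sup>H * U) $$ (i, l) = row (U\<^sup>H) i \<bullet> (cols U ! l)" if "l < t" for l
        using that ij' dU by simp
      show "cols U ! i \<noteq> cols U ! j"
        using entry[of i] entry[of j] ij ij' by (auto simp: UU)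
    qed
    show "lin_indpt (set (cols U))"
    proof
      assume "lin_dep (set (cols U))"
      from lin_depE[OF U this dist] obtain v where v: "v \<in> carrier_vec t" "v \<noteq> 0\<^sub>v t" "U *\<^sub>v v = 0\<^sub>v n" .
      have "v = (U\<^sup>H * U) *\<^sub>v v" using v by (simp add: UU)
      also have "\<dots> = U\<^sup>H *\<^sub>v 0\<^sub>v n"
        using v dU by (simp add: mult_mat_vec_assoc_dim)
      also have "\<dots> = 0\<^sub>v t" using dU by (intro eq_vecI) auto
      finally show False using v by simp
    qed
  qed
  finally show ?thesis .
qed

lemma left_right_cols_dim [simp]:
  "dim_row (left_cols r U) = dim_row U" "dim_col (left_cols r U) = r"
  "dim_row (right_cols r U) = dim_row U" "dim_col (right_cols r U) = dim_col U - r"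
  by (simp_all add: left_cols_def right_cols_def)

lemma left_right_cols_gram:
  assumes "dim_col U = n" "r \<le> n"
  shows "left_cols r U * (left_cols r U)\<^sup>H + right_cols r U * (right_cols r U)\<^sup>H = U * U\<^sup>H"
proof (rule eq_matI)
  fix i j assume "i < dim_row (U * U\<^sup>H)" "j < dim_col (U * U\<^sup>H)"
  then have ij: "i < dim_row U" "j < dim_row U" by auto
  define f where "f l = U $$ (i, l) * cnj (U $$ (j, l))" for l
  have "(\<Sum>l<n - r. f (l + r)) = (\<Sum>l=r..<n. f l)"
    using assms(2) sum.shift_bounds_nat_ivl[of f 0 r "n - r"] by (simp add: lessThan_atLeast0)
  then have "(\<Sum>l<n. f l) = (\<Sum>l<r. f l) + (\<Sum>l<n - r. f (l + r))"
    using assms(2) sum.atLeastLessThan_concat[of 0 r n f] by (simp add: lessThan_atLeast0)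
  then show "(left_cols r U * (left_cols r U)\<^sup>H + right_cols r U * (right_cols r U)\<^sup>H) $$ (i, j) = (U * U\<^sup>H) $$ (i, j)"
    using ij assms
    by (simp add: mult_index del: index_mult_mat(1)) (simp add: left_cols_def right_cols_def f_def)
qed auto

lemma over_index: "over \<real> U \<Longrightarrow> i < dim_row U \<Longrightarrow> j < dim_col U \<Longrightarrow> cnj (U $$ (i, j)) = U $$ (i, j)"
  unfolding over_def by (metis index_map_mat(1))

lemma over_left_cols: "over \<KK> U \<Longrightarrow> r \<le> dim_col U \<Longrightarrow> over \<KK> (left_cols r U)"
  unfolding over_def[of _ "left_cols r U"]
  by (intro impI eq_matI) (simp_all add: left_cols_def over_index)

lemma over_right_cols: "over \<KK> U \<Longrightarrow> over \<KK> (right_cols r U)"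
  unfolding over_def[of _ "right_cols r U"]
  by (intro impI eq_matI) (simp_all add: right_cols_def over_index)

text \<open>Both sides are orthogonal projections onto the column space of \<open>X\<close>. Each
  fixes the range of the other, and taking adjoints in \<open>P * E = E\<close> against
  \<open>E * P = P\<close> gives equality.\<close>

lemma isometry_factorization_projection:
  assumes dims [simp]: "dim_row X = n" "dim_col X = p" "dim_row U = n" "dim_col U = t"
      "dim_row N = t" "dim_col N = p" "dim_row N' = p" "dim_col N' = t"
    and UU: "U\<^sup>H * U = 1\<^sub>m t" and N: "X = U * N" and N': "U = X * N'"
  shows "U * U\<^sup>H = X * X\<^sup>\<dagger>"
proof -
  define E where "E = U * U\<^sup>H"
  define P where "P = X * X\<^sup>\<dagger>"
  have dE [simp]: "dim_row E = n" "dim_col E = n" "dim_row P = n" "dim_col P = n" by (simp_all add: E_def P_def)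
  have PH: "P\<^sup>H = P" and EH: "E\<^sup>H = E" by (simp_all add: P_def E_def pinv_mat_simps adjoint_mult)
  have "E * X = U * (U\<^sup>H * U) * N" by (subst N) (simp add: E_def mult_assoc_dim)
  then have EX: "E * X = X" by (simp add: UU flip: N)
  have "E * P = E * X * X\<^sup>\<dagger>" by (simp add: P_def mult_assoc_dim)
  then have EP: "E * P = P" by (simp add: EX flip: P_def)
  have "P * U = X * X\<^sup>\<dagger> * X * N'" by (subst N') (simp add: P_def mult_assoc_dim)
  then have "P * U = U" by (simp add: pinv_mat_simps flip: N')
  then have "P * E = E" by (simp add: E_def flip: mult_assoc_dim)
  then have "E = (P * E)\<^sup>H" by (simp add: EH)
  also have "\<dots> = E * P" by (simp add: adjoint_mult PH EH)
  finally have "E = P" by (simp only: EP)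
  then show ?thesis by (simp only: E_def P_def)
qed

text \<open>\<open>r\<close> is given as the dimension of a column space, whereas the block split
  has to match the positive singular values. Their number \<open>t\<close> is therefore shown to be
  the rank, by factoring \<open>X\<close> and the first \<open>t\<close> columns of \<open>U\<close>
  through each other.\<close>

lemma svd_blocks:
  assumes X: "X \<in> carrier_mat n p" and svd: "is_svd \<KK> n p X U \<Sigma> V" and rank: "vec_space.rank n X = r"
    and \<KK>: "\<KK> = \<real> \<or> \<KK> = UNIV"
  shows "left_cols r U \<in> carrier_mat n r" "left_cols r U * (left_cols r U)\<^sup>H = X * X\<^sup>\<dagger>" "over \<KK> (left_cols r U)"
    "right_cols r U \<in> carrier_mat n (n - r)" "right_cols r U * (right_cols r U)\<^sup>H = 1\<^sub>m n - X * X\<^sup>\<dagger>"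
    "over \<KK> (right_cols r U)"
proof -
  from svd obtain s :: "nat \<Rightarrow> real" where U: "U \<in> carrier_mat n n" "over \<KK> U" "unitary_mat U"
    and V: "V \<in> carrier_mat p p" "unitary_mat V"
    and s: "\<And>i. i < min n p \<Longrightarrow> 0 \<le> s i" "\<And>i j. i \<le> j \<Longrightarrow> j < min n p \<Longrightarrow> s j \<le> s i"
    and \<Sigma>: "\<Sigma> = mat n p (\<lambda>(i, j). if i = j then complex_of_real (s i) else 0)" and XU: "X = U * \<Sigma> * V\<^sup>H"
    using \<KK> by (auto simp: is_svd_def kmat_iff)
  have dims [simp]: "dim_row U = n" "dim_col U = n" "dim_row V = p" "dim_col V = p" "dim_row \<Sigma> = n" "dim_col \<Sigma> = p"
    "dim_row X = n" "dim_col X = p"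
    using U V X by (auto simp: \<Sigma>)
  have UU: "U\<^sup>H * U = 1\<^sub>m n" "U * U\<^sup>H = 1\<^sub>m n" and VV: "V\<^sup>H * V = 1\<^sub>m p"
    using U V by (auto simp: unitary_mat_def inverts_mat_def)
  obtain t where t: "t \<le> min n p" "\<And>i. i < t \<Longrightarrow> 0 < s i" "\<And>i. t \<le> i \<Longrightarrow> i < min n p \<Longrightarrow> s i = 0"
  proof -
    \<comment> \<open>The index of the first vanishing singular value; the candidate
      \<open>min n p\<close> covers full rank. The decreasing order makes all later values
      vanish.\<close>
    define t where "t = (LEAST i. i = min n p \<or> s i = 0)"
    have ex: "t = min n p \<or> s t = 0" unfolding t_def by (rule LeastI[of _ "min n p"]) simp
    have le: "t \<le> min n p" unfolding t_def by (rule Least_le) simp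
    have "0 < s i" if "i < t" for i
    proof -
      have "s i \<noteq> 0" using not_less_Least[OF that[unfolded t_def]] by blast
      then show ?thesis using s(1)[of i] that le by simp
    qed
    moreover have "s i = 0" if "t \<le> i" "i < min n p" for i
    proof -
      have "s t = 0" using ex that by auto
      then show ?thesis using s(1)[of i] s(2)[of t i] that by simp
    qed
    ultimately show thesis using that le by blast
  qed
  define U1 where "U1 = left_cols t U"
  \<comment> \<open>\<open>N\<close> is the nonzero part of \<open>\<Sigma> * V\<^sup>H\<close>, so
    \<open>X = U1 * N\<close>. \<open>J\<close> divides by the positive singular values, so
    \<open>V * J\<close> leads back from \<open>X\<close> to \<open>U1\<close>.\<close>
  define N where "N = mat t p (\<lambda>(i, j). complex_of_real (s i) * cnj (V $$ (j, i)))"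
  define J where "J = mat p t (\<lambda>(i, j). if i = j then complex_of_real (1 / s i) else 0)"
  have dU1 [simp]: "dim_row U1 = n" "dim_col U1 = t" "dim_row N = t" "dim_col N = p" "dim_row J = p" "dim_col J = t"
    by (simp_all add: U1_def N_def J_def)
  have tn: "t \<le> n" "t \<le> p" using t by auto
  have U1U1: "U1\<^sup>H * U1 = 1\<^sub>m t"
  proof (rule eq_matI)
    fix i j assume "i < dim_row (1\<^sub>m t :: complex mat)" "j < dim_col (1\<^sub>m t :: complex mat)"
    then have ij: "i < t" "j < t" by auto
    have "(U1\<^sup>H * U1) $$ (i, j) = (U\<^sup>H * U) $$ (i, j)"
      using ij tn by (auto simp: mult_index U1_def left_cols_def simp del: index_mult_mat(1) intro!: sum.cong)
    then show "(U1\<^sup>H * U1) $$ (i, j) = 1\<^sub>m t $$ (i, j)" using ij tn by (simp add: UU)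
  qed auto
  have SV: "(\<Sigma> * V\<^sup>H) $$ (l, j) = (if l < t then N $$ (l, j) else 0)" if "l < n" "j < p" for l j
  proof -
    have "(\<Sigma> * V\<^sup>H) $$ (l, j) = (\<Sum>q<p. if q = l then complex_of_real (s l) * cnj (V $$ (j, l)) else 0)"
      using that by (subst mult_index) (auto simp: \<Sigma> simp del: sum.delta sum.delta' intro!: sum.cong)
    also have "\<dots> = (if l < t then N $$ (l, j) else 0)"
      using that tn t(3)[of l] by (auto simp: sum.delta N_def)
    finally show ?thesis .
  qed
  have XN: "X = U1 * N"
  proof (rule eq_matI)
    fix i j assume "i < dim_row (U1 * N)" "j < dim_col (U1 * N)"
    then have ij: "i < n" "j < p" by auto
    have "X $$ (i, j) = (\<Sum>l<n. U $$ (i, l) * (\<Sigma> * V\<^sup>H) $$ (l, j))"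
      unfolding XU using ij by (subst mult_assoc_dim) (simp_all add: mult_index[of _ U] del: index_mult_mat(1))
    also have "\<dots> = (\<Sum>l<n. if l < t then U $$ (i, l) * N $$ (l, j) else 0)"
      using ij SV by (intro sum.cong) auto
    also have "\<dots> = (\<Sum>l<t. U $$ (i, l) * N $$ (l, j))"
      using tn by (intro sum.mono_neutral_cong_right) auto
    also have "\<dots> = (U1 * N) $$ (i, j)"
      using ij tn by (simp add: mult_index U1_def left_cols_def del: index_mult_mat(1))
    finally show "X $$ (i, j) = (U1 * N) $$ (i, j)" .
  qed simp_all
  have "\<Sigma> * J = mat n t (\<lambda>(i, j). if i = j then 1 else 0)"
  proof (rule eq_matI)
    fix i j assume "i < dim_row (mat n t (\<lambda>(i, j). if i = j then 1 else 0 :: complex))"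
      "j < dim_col (mat n t (\<lambda>(i, j). if i = j then 1 else 0 :: complex))"
    then have ij: "i < n" "j < t" by auto
    have "s j \<noteq> 0" using t(2)[OF ij(2)] by simp
    then have "(\<Sigma> * J) $$ (i, j) = (\<Sum>q<p. if q = j then (if i = j then 1 else 0) else 0)"
      using ij tn by (subst mult_index) (auto simp: \<Sigma> J_def simp del: sum.delta sum.delta' intro!: sum.cong)
    then show "(\<Sigma> * J) $$ (i, j) = mat n t (\<lambda>(i, j). if i = j then 1 else 0) $$ (i, j)"
      using ij tn by simp
  qed simp_all
  moreover have "U * mat n t (\<lambda>(i, j). if i = j then 1 else 0) = U1"
  proof (rule eq_matI)
    fix i j assume "i < dim_row U1" "j < dim_col U1"
    then have ij: "i < n" "j < t" by auto
    have "(U * mat n t (\<lambda>(i, j). if i = j then 1 else 0)) $$ (i, j) = (\<Sum>q<n. if q = j then U $$ (i, j) else 0)"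
      using ij by (subst mult_index) (auto simp del: sum.delta sum.delta' intro!: sum.cong)
    then show "(U * mat n t (\<lambda>(i, j). if i = j then 1 else 0)) $$ (i, j) = U1 $$ (i, j)"
      using ij tn by (simp add: U1_def left_cols_def)
  qed simp_all
  moreover have "X * (V * J) = U * (\<Sigma> * ((V\<^sup>H * V) * J))"
    by (simp add: XU mult_assoc_dim)
  ultimately have XJ: "U1 = X * (V * J)" by (simp add: VV)
  have "vec_space.rank n X = t"
    by (rule rank_isometry_factorization[OF X _ U1U1 _ XN _ XJ]) (auto intro!: carrier_matI)
  then have r: "r = t" using rank by simp
  show *: "left_cols r U * (left_cols r U)\<^sup>H = X * X\<^sup>\<dagger>"
    unfolding r U1_def[symmetric]
    by (rule isometry_factorization_projection[of _ n p _ t N "V * J", OF _ _ _ _ _ _ _ _ U1U1 XN XJ]) simp_all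
  show "left_cols r U \<in> carrier_mat n r" "right_cols r U \<in> carrier_mat n (n - r)"
    by (auto intro!: carrier_matI)
  show "over \<KK> (left_cols r U)" "over \<KK> (right_cols r U)"
    using U tn r by (auto intro: over_left_cols over_right_cols)
  have "X * X\<^sup>\<dagger> + right_cols r U * (right_cols r U)\<^sup>H = 1\<^sub>m n"
    using left_right_cols_gram[of U n r] * UU tn r by simp
  then show "right_cols r U * (right_cols r U)\<^sup>H = 1\<^sub>m n - X * X\<^sup>\<dagger>"
    by (simp flip: \<open>X * X\<^sup>\<dagger> + right_cols r U * (right_cols r U)\<^sup>H = 1\<^sub>m n\<close>)
      (intro eq_matI, auto simp del: index_mult_mat(1))
qed

context procrustes
begin

lemma svd_minimizer:
  assumes svd: "is_svd \<KK> n p X U \<Sigma> V" and rank: "vec_space.rank n X = r"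
    and Z: "contraction_mat \<KK> (n - r) Z" "(c Z)\<^sup>H = e \<cdot>\<^sub>m Z"
  defines "C \<equiv> M * B * X\<^sup>\<dagger>" and "U\<^sub>1 \<equiv> left_cols r U" and "U\<^sub>2 \<equiv> right_cols r U"
  defines "R \<equiv> complex_of_real (\<mu>\<^sup>2) \<cdot>\<^sub>m 1\<^sub>m r - e \<cdot>\<^sub>m (U\<^sub>1\<^sup>H * c C * C * U\<^sub>1)"
  defines "K \<equiv> C * U\<^sub>1 * inv_sqrt_mat R"
  defines "A\<^sub>o \<equiv> inv_mat M * F
    - inv_mat M * c Q * K * U\<^sub>1\<^sup>H * c (C * U\<^sub>1) * (c K)\<^sup>H * Q
    + inv_mat M * (complex_of_real \<mu> \<cdot>\<^sub>m (c U\<^sub>2 * sqrt_mat (1\<^sub>m (n - r) - (c U\<^sub>2)\<^sup>H * K * K\<^sup>H * c U\<^sub>2) * Z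
        * sqrt_mat (1\<^sub>m (n - r) - U\<^sub>2\<^sup>H * c K * (c K)\<^sup>H * U\<^sub>2) * U\<^sub>2\<^sup>H))"
  shows "A\<^sub>o \<in> proc_sols \<S> X B \<and> spectral_norm A\<^sub>o = \<mu>"
proof -
  have X: "X \<in> carrier_mat n p" by (intro carrier_matI) simp_all
  note U = svd_blocks[OF X svd rank \<KK>, folded P_def, folded Q_def]
  have ZK: "Z \<in> carrier_mat (n - r) (n - r)" "over \<KK> Z" "l2_bound 1 Z"
  proof -
    show "Z \<in> carrier_mat (n - r) (n - r)" "over \<KK> Z"
      using Z(1) \<KK> by (auto simp: contraction_mat_def kmat_iff)
    show "l2_bound 1 Z"
      unfolding l2_bound_def
    proof (intro allI impI)
      fix x :: "complex vec" assume "dim_vec x = dim_col Z"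
      from l2_boundD[OF l2_bound_spectral_norm this]
      have "nsq (Z *\<^sub>v x) \<le> (spectral_norm Z)\<^sup>2 * nsq x" .
      also have "\<dots> \<le> 1\<^sup>2 * nsq x"
        using Z(1) by (intro mult_right_mono power_mono) (auto simp: contraction_mat_def)
      finally show "nsq (Z *\<^sub>v x) \<le> 1\<^sup>2 * nsq x" .
    qed
  qed
  show ?thesis
    using dkw_completion[OF U(1,2,3,4,5,6) ZK(1) Z(2) ZK(3,2)]
    unfolding A\<^sub>o_def K_def R_def U\<^sub>1_def U\<^sub>2_def C_def MBX by blast
qed

end

section \<open>Jordan and Lie algebras\<close>

text \<open>Multiplication by \<open>M\<close> turns the adjoint condition into
  \<open>star_mat k A * M = s \<cdot>\<^sub>m (M * A)\<close>, whose left side is the star of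
  \<open>M * A\<close> up to the sign \<delta> of \<open>M\<close>. The value 1 of \<open>s\<close>
  gives the Jordan algebra and -1 the Lie algebra.\<close>

lemma eigen_class_structured:
  assumes \<KK>: "\<KK> = \<real> \<or> \<KK> = UNIV" and n: "0 < n" and M: "M \<in> kmat \<KK> n n" "unitary_mat M"
    and \<delta>: "(cj k M)\<^sup>H = \<delta> \<cdot>\<^sub>m M" "\<delta> \<in> {1, -1}" and s: "s \<in> {1, -1}"
  shows "structured_class \<KK> k n M {A \<in> kmat \<KK> n n. sp_adjoint k M A = s \<cdot>\<^sub>m A} (\<delta> * s)"
proof -
  have dM [simp]: "dim_row M = n" "dim_col M = n" and oM: "over \<KK> M" using M \<KK> by (auto simp: kmat_iff)
  have MM: "M\<^sup>H * M = 1\<^sub>m n" "M * M\<^sup>H = 1\<^sub>m n"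
    using M by (auto simp: unitary_mat_def inverts_mat_def)
  have cancel: "M\<^sup>H * (M * A) = A" "M * (M\<^sup>H * A) = A" if "dim_row A = n" for A
    using that by (simp_all add: MM flip: mult_assoc_dim)
  have inv: "inv_mat M = M\<^sup>H" using MM by (intro inv_mat_eqI[of _ n]) (auto intro!: carrier_matI)
  have \<delta>\<delta>: "\<delta> * \<delta> = 1" "\<delta> * (\<delta> * s) = s" "\<delta> * s \<in> {1, -1}" using \<delta>(2) s by auto
  show ?thesis
  proof unfold_locales
    fix A :: "complex mat"
    show "A \<in> {A \<in> kmat \<KK> n n. sp_adjoint k M A = s \<cdot>\<^sub>m A} \<longleftrightarrow> A \<in> carrier_mat n n \<and> M * A \<in> star_class \<KK> n k (\<delta> * s)"
    proof (cases "A \<in> carrier_mat n n")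
      case True
      then have [simp]: "dim_row A = n" "dim_col A = n" by auto
      have "over \<KK> (M * A) \<longleftrightarrow> over \<KK> A"
      proof
        assume "over \<KK> (M * A)"
        then have "over \<KK> (M\<^sup>H * (M * A))" by (intro over_mult[of _ "M\<^sup>H"] over_adjoint oM) simp_all
        then show "over \<KK> A" by (simp add: cancel)
      qed (auto intro: over_mult oM)
      moreover have "M * A \<in> carrier_mat n n" by (intro carrier_matI) simp_all
      moreover have "sp_adjoint k M A = s \<cdot>\<^sub>m A \<longleftrightarrow> (cj k (M * A))\<^sup>H = (\<delta> * s) \<cdot>\<^sub>m (M * A)"
      proof
        assume "sp_adjoint k M A = s \<cdot>\<^sub>m A"
        then have "M * (M\<^sup>H * ((cj k A)\<^sup>H * M)) = M * (s \<cdot>\<^sub>m A)"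
          by (simp add: sp_adjoint_def inv star_mat_cj mult_assoc_dim)
        then have "(cj k A)\<^sup>H * M = s \<cdot>\<^sub>m (M * A)" by (simp add: cancel mult_smult_dim)
        then show "(cj k (M * A))\<^sup>H = (\<delta> * s) \<cdot>\<^sub>m (M * A)"
          by (simp add: cj_expand mat_expand \<delta>)
      next
        assume "(cj k (M * A))\<^sup>H = (\<delta> * s) \<cdot>\<^sub>m (M * A)"
        then have "\<delta> \<cdot>\<^sub>m ((cj k A)\<^sup>H * M) = (\<delta> * s) \<cdot>\<^sub>m (M * A)"
          by (simp add: cj_expand mat_expand \<delta>)
        then have "\<delta> \<cdot>\<^sub>m (\<delta> \<cdot>\<^sub>m ((cj k A)\<^sup>H * M)) = \<delta> \<cdot>\<^sub>m ((\<delta> * s) \<cdot>\<^sub>m (M * A))" by simp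
        then have "(cj k A)\<^sup>H * M = s \<cdot>\<^sub>m (M * A)" by (simp only: smult_smult_mat \<delta>\<delta> one_smult_mat)
        then show "sp_adjoint k M A = s \<cdot>\<^sub>m A"
          by (simp add: sp_adjoint_def inv star_mat_cj mat_expand cancel)
      qed
      ultimately show ?thesis using True \<KK> by (simp add: star_class_def kmat_iff)
    qed (auto simp: kmat_def)
  qed (use assms MM \<delta>\<delta> in auto)
qed

lemma jordan_lie_structured:
  assumes "\<KK> = \<real> \<or> \<KK> = UNIV" "0 < n" "scalar_product \<KK> n k M"
  shows "\<exists>\<delta> \<in> {1, -1}. structured_class \<KK> k n M (Jordan_alg \<KK> n k M) \<delta>
    \<and> structured_class \<KK> k n M (Lie_alg \<KK> n k M) (- \<delta>)"
proof -
  from assms(3) have M: "M \<in> kmat \<KK> n n" "unitary_mat M"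
    and "(cj k M)\<^sup>H = M \<or> (cj k M)\<^sup>H = - M"
    by (auto simp: scalar_product_def star_mat_cj)
  then obtain \<delta> where \<delta>: "(cj k M)\<^sup>H = \<delta> \<cdot>\<^sub>m M" "\<delta> \<in> {1, -1}"
    by (metis insertI1 insertI2 one_smult_mat uminus_mat_smult)
  have "structured_class \<KK> k n M (Jordan_alg \<KK> n k M) \<delta>"
    using eigen_class_structured[OF assms(1,2) M \<delta>, of 1] by (simp add: Jordan_alg_def)
  moreover have "structured_class \<KK> k n M (Lie_alg \<KK> n k M) (- \<delta>)"
    using eigen_class_structured[OF assms(1,2) M \<delta>, of "-1"]
    by (simp add: Lie_alg_def flip: uminus_mat_smult)
  ultimately show ?thesis using \<delta>(2) by blast
qed

text \<open>
  A bilinear form over \<open>\<real>\<close> can meet the Hermitian hypothesis, because \<open>sym_mats \<real> 1 = Herm_mats 1\<close>.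
\<close>

lemma star_class_real: "star_class \<real> n k e = star_class \<real> n k' e"
proof -
  have "cj k H = H" if "H \<in> kmat \<real> n n" for k H
    using that by (cases k) (auto simp: kmat_iff over_def)
  then show ?thesis by (auto simp: star_class_def)
qed

lemma matrix_classes:
  "sym_mats \<KK> n = star_class \<KK> n Bilinear 1" "skew_sym_mats \<KK> n = star_class \<KK> n Bilinear (-1)"
  "Herm_mats n = star_class UNIV n Sesquilinear 1" "skew_Herm_mats n = star_class UNIV n Sesquilinear (-1)"
  by (auto simp: sym_mats_def skew_sym_mats_def Herm_mats_def skew_Herm_mats_def star_class_def kmat_def
      transpose_conj simp flip: uminus_mat_smult)

text \<open>The identity as a test matrix for the sign: two descriptions of the same set as a star
  class share \<open>e\<close>.\<close>

lemma one_in_star_class: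
  assumes "0 < n" "\<KK> = \<real> \<or> \<KK> = UNIV" "e \<in> {1, -1}"
  shows "1\<^sub>m n \<in> star_class \<KK> n k e \<longleftrightarrow> e = 1"
proof -
  have "e = 1" if "1\<^sub>m n = e \<cdot>\<^sub>m 1\<^sub>m n"
    using arg_cong[OF that, of "\<lambda>A. A $$ (0, 0)"] assms(1) by simp
  then show ?thesis using assms by (auto simp: star_class_def kmat_iff over_one)
qed

text \<open>A second test matrix, for the kind: over the complex numbers a factor \<i> keeps the
  identity symmetric but makes it skew-Hermitian.\<close>

lemma i_in_star_class:
  assumes "0 < n" "\<KK> = \<real> \<or> \<KK> = UNIV" "e \<in> {1, -1}"
  shows "\<i> \<cdot>\<^sub>m 1\<^sub>m n \<in> star_class \<KK> n k e \<longleftrightarrow>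
    \<KK> = UNIV \<and> (if k = Bilinear then e = 1 else e = -1)"
proof -
  have *: "a \<cdot>\<^sub>m 1\<^sub>m n = b \<cdot>\<^sub>m (1\<^sub>m n :: complex mat) \<longleftrightarrow> a = b" for a b
    using assms(1) by (auto dest!: arg_cong[of _ _ "\<lambda>A. A $$ (0, 0)"])
  have conj: "conj_mat (\<i> \<cdot>\<^sub>m 1\<^sub>m n) = (- \<i>) \<cdot>\<^sub>m 1\<^sub>m n"
    by (intro eq_matI) auto
  have "(UNIV :: complex set) \<noteq> \<real>" by (metis UNIV_I complex_is_Real_iff imaginary_unit.sel(2) zero_neq_one)
  moreover have "\<i> \<cdot>\<^sub>m 1\<^sub>m n \<in> kmat \<KK> n n \<longleftrightarrow> \<KK> \<noteq> \<real>"
    using assms(2) by (auto simp: kmat_iff over_def conj *)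
  moreover have "(cj k (\<i> \<cdot>\<^sub>m 1\<^sub>m n))\<^sup>H = e \<cdot>\<^sub>m (\<i> \<cdot>\<^sub>m 1\<^sub>m n) \<longleftrightarrow> (if k = Bilinear then e = 1 else e = -1)"
    using assms(3) by (cases k) (auto simp: conj adjoint_smult smult_smult_mat *)
  ultimately show ?thesis using assms(2) by (auto simp: star_class_def)
qed

lemma star_class_eqD:
  assumes "star_class \<KK> n k e = star_class \<KK>' n k' e'" and n: "0 < n"
    and "\<KK> = \<real> \<or> \<KK> = UNIV" "\<KK>' = \<real> \<or> \<KK>' = UNIV" "e \<in> {1, -1}" "e' \<in> {1, -1}"
  shows "e = e'" "\<KK> = UNIV \<and> (if k = Bilinear then e = 1 else e = -1) \<longleftrightarrow>
    \<KK>' = UNIV \<and> (if k' = Bilinear then e' = 1 else e' = -1)"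
proof -
  have "e = 1 \<longleftrightarrow> e' = 1"
    using assms(1) one_in_star_class[OF n assms(3,5), of k] one_in_star_class[OF n assms(4,6), of k'] by blast
  then show "e = e'" using assms(5,6) by auto
  show "\<KK> = UNIV \<and> (if k = Bilinear then e = 1 else e = -1) \<longleftrightarrow>
    \<KK>' = UNIV \<and> (if k' = Bilinear then e' = 1 else e' = -1)"
    using assms(1) i_in_star_class[OF n assms(3,5), of k] i_in_star_class[OF n assms(4,6), of k'] by blast
qed

text \<open>A purely imaginary factor exchanges Hermitian and skew-Hermitian matrices. The factor
  \<i> carries a given solution to the Hermitian class, and -\<i> brings a minimiser back.\<close>

lemma imaginary_multiple_solution:
  assumes \<S>: "structured_class UNIV Sesquilinear n M \<S> e" and \<S>': "structured_class UNIV Sesquilinear n M \<S>' (- e)"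
    and A: "A \<in> proc_sols \<S> X B" and X: "X \<in> carrier_mat n p" and z: "cnj z = - z"
  shows "z \<cdot>\<^sub>m A \<in> proc_sols \<S>' X (z \<cdot>\<^sub>m B)"
proof -
  interpret s: structured_class UNIV Sesquilinear n M \<S> e by fact
  interpret s': structured_class UNIV Sesquilinear n M \<S>' "- e" by fact
  have AX: "A * X = B" and AS: "A \<in> \<S>" using A by (auto simp: proc_sols_def)
  then have cA: "A \<in> carrier_mat n n" and MA: "(M * A)\<^sup>H = e \<cdot>\<^sub>m (M * A)"
    by (auto simp: s.\<S>_iff star_class_def)
  have [simp]: "dim_row A = n" "dim_col A = n" "dim_row X = n" using cA X by auto
  have "z \<cdot>\<^sub>m A \<in> \<S>'"
    using cA MA z by (auto simp: s'.\<S>_iff star_class_def kmat_def mult_smult_dim adjoint_smult smult_smult_mat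
        mult.commute intro!: carrier_matI)
  then show ?thesis by (simp add: proc_sols_def smult_mult_dim AX)
qed

lemma smult_solution_norm:
  assumes "cmod z = 1" "dim_col B = dim_row Y"
  shows "spectral_norm ((z \<cdot>\<^sub>m B) * Y) = spectral_norm (B * Y)"
  using assms by (simp add: smult_mult_dim spectral_norm_smult)

context procrustes
begin

lemma proc_map_class:
  assumes W: "star_class \<KK> n k e \<in> {sym_mats \<KK> n, skew_sym_mats \<KK> n} \<or> star_class \<KK> n k e \<in> {Herm_mats n, skew_Herm_mats n}"
  shows "proc_map \<KK> n (star_class \<KK> n k e) k X (M * B) = F"
proof (rule proc_map_F)
  have 1: "star_class \<KK> n k e = sym_mats \<KK> n \<Longrightarrow> e = 1" "star_class \<KK> n k e = Herm_mats n \<Longrightarrow> e = 1"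
    "star_class \<KK> n k e = skew_sym_mats \<KK> n \<Longrightarrow> e = -1" "star_class \<KK> n k e = skew_Herm_mats n \<Longrightarrow> e = -1"
    unfolding matrix_classes using n \<KK> e by (blast intro: star_class_eqD(1))+
  have "e \<noteq> 1" if "e = -1" using that by simp
  then show "star_class \<KK> n k e \<in> {sym_mats \<KK> n, Herm_mats n} \<longleftrightarrow> e = 1"
    using W 1 by blast
qed

end

theorem theorem3p3:
  fixes \<KK> :: "complex set" and n p :: nat and k :: sp_kind
    and M X B :: "complex mat" and \<S> :: "complex mat set"
  assumes "\<KK> = \<real> \<or> \<KK> = UNIV"
    and "0 < n" and "0 < p"
    and "scalar_product \<KK> n k M"
    and "\<S> \<in> {Jordan_alg \<KK> n k M, Lie_alg \<KK> n k M}"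
    and "X \<in> kmat \<KK> n p" and "B \<in> kmat \<KK> n p"
    and "proc_sols \<S> X B \<noteq> {}"
  shows
    "let W = lmult M \<S>; I = 1\<^sub>m n; P = X * X\<^sup>\<dagger>; C = M * B * X\<^sup>\<dagger>;
         \<sigma>\<^sub>F = proc_dist frob_norm \<S> X B; \<sigma>\<^sub>2 = proc_dist spectral_norm \<S> X B
     in
      \<comment> \<open>all solutions\<close>
      (W \<in> {sym_mats \<KK> n, skew_sym_mats \<KK> n} \<longrightarrow>
        (\<forall>A. A \<in> proc_sols \<S> X B \<longleftrightarrow>
          (\<exists>Z \<in> W. A = inv_mat M * proc_map \<KK> n W Bilinear X (M * B)
                      + inv_mat M * (I - P)\<^sup>T * Z * (I - P)))) \<and>
      (W \<in> {Herm_mats n, skew_Herm_mats n} \<longrightarrow>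
        (\<forall>A. A \<in> proc_sols \<S> X B \<longleftrightarrow>
          (\<exists>Z \<in> W. A = inv_mat M * proc_map \<KK> n W Sesquilinear X (M * B)
                      + inv_mat M * (I - P) * Z * (I - P)))) \<and>
      \<comment> \<open>(a) Frobenius norm\<close>
      (W \<in> {sym_mats \<KK> n, skew_sym_mats \<KK> n} \<longrightarrow>
        (let A\<^sub>o = inv_mat M * proc_map \<KK> n W Bilinear X (M * B); t = tr_mat (C * C\<^sup>H * P\<^sup>T) in
          (\<forall>A. A \<in> proc_sols \<S> X B \<and> A * X = B \<and> \<sigma>\<^sub>F = frob_norm A \<longleftrightarrow> A = A\<^sub>o) \<and>
          t \<in> \<real> \<and> frob_norm A\<^sub>o = sqrt (2 * (frob_norm (B * X\<^sup>\<dagger>))\<^sup>2 - Re t))) \<and>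
      (W \<in> {Herm_mats n, skew_Herm_mats n} \<longrightarrow>
        (let A\<^sub>o = inv_mat M * proc_map \<KK> n W Sesquilinear X (M * B); t = tr_mat (C * C\<^sup>H * P) in
          (\<forall>A. A \<in> proc_sols \<S> X B \<and> A * X = B \<and> \<sigma>\<^sub>F = frob_norm A \<longleftrightarrow> A = A\<^sub>o) \<and>
          t \<in> \<real> \<and> frob_norm A\<^sub>o = sqrt (2 * (frob_norm (B * X\<^sup>\<dagger>))\<^sup>2 - Re t))) \<and>
      \<comment> \<open>(b) spectral norm\<close>
      \<sigma>\<^sub>2 = spectral_norm (B * X\<^sup>\<dagger>) \<and>
      spectral_norm (B * X\<^sup>\<dagger>) = proc_dist spectral_norm (kmat \<KK> n n) X B \<and>
      (\<forall>r U \<Sigma> V. vec_space.rank n X = r \<and> is_svd \<KK> n p X U \<Sigma> V \<longrightarrow>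
        (let U\<^sub>1 = left_cols r U; U\<^sub>2 = right_cols r U;
             \<mu> = spectral_norm (B * X\<^sup>\<dagger>); m2 = complex_of_real (\<mu>\<^sup>2)
         in
          (W \<in> {sym_mats \<KK> n, skew_sym_mats \<KK> n} \<longrightarrow>
            (\<forall>Z. contraction_mat \<KK> (n - r) Z \<and>
                 (W = sym_mats \<KK> n \<longrightarrow> Z = Z\<^sup>T) \<and> (W = skew_sym_mats \<KK> n \<longrightarrow> Z = - Z\<^sup>T) \<longrightarrow>
              (let R = (if W = sym_mats \<KK> n
                        then m2 \<cdot>\<^sub>m 1\<^sub>m r - U\<^sub>1\<^sup>H * conj_mat C * C * U\<^sub>1
                        else m2 \<cdot>\<^sub>m 1\<^sub>m r + U\<^sub>1\<^sup>H * conj_mat C * C * U\<^sub>1);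
                   K = C * U\<^sub>1 * inv_sqrt_mat R;
                   fZ = complex_of_real \<mu> \<cdot>\<^sub>m
                     (conj_mat U\<^sub>2 * sqrt_mat (1\<^sub>m (n - r) - U\<^sub>2\<^sup>T * K * K\<^sup>H * conj_mat U\<^sub>2) * Z
                        * sqrt_mat (1\<^sub>m (n - r) - U\<^sub>2\<^sup>H * conj_mat K * K\<^sup>T * U\<^sub>2) * U\<^sub>2\<^sup>H);
                   A\<^sub>o = inv_mat M * proc_map \<KK> n W Bilinear X (M * B)
                        - inv_mat M * (I - P)\<^sup>T * K * U\<^sub>1\<^sup>H * conj_mat (C * U\<^sub>1) * K\<^sup>T * (I - P)
                        + inv_mat M * fZ
               in A\<^sub>o \<in> proc_sols \<S> X B \<and> spectral_norm A\<^sub>o = \<sigma>\<^sub>2))) \<and>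
          (W = Herm_mats n \<longrightarrow>
            (\<forall>Z. contraction_mat \<KK> (n - r) Z \<and> Z = Z\<^sup>H \<longrightarrow>
              (let R = m2 \<cdot>\<^sub>m 1\<^sub>m r - U\<^sub>1\<^sup>H * C * C * U\<^sub>1;
                   K = C * U\<^sub>1 * inv_sqrt_mat R;
                   Q = sqrt_mat (1\<^sub>m (n - r) - U\<^sub>2\<^sup>H * K * K\<^sup>H * U\<^sub>2);
                   fZ = complex_of_real \<mu> \<cdot>\<^sub>m (U\<^sub>2 * Q * Z * Q * U\<^sub>2\<^sup>H);
                   A\<^sub>o = inv_mat M * proc_map \<KK> n W Sesquilinear X (M * B)
                        - inv_mat M * (I - P) * K * U\<^sub>1\<^sup>H * C * U\<^sub>1 * K\<^sup>H * (I - P)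
                        + inv_mat M * fZ
               in A\<^sub>o \<in> proc_sols \<S> X B \<and> spectral_norm A\<^sub>o = \<sigma>\<^sub>2))))) \<and>
      (W = skew_Herm_mats n \<longrightarrow>
        (\<exists>\<S>' \<in> {Jordan_alg \<KK> n k M, Lie_alg \<KK> n k M}. lmult M \<S>' = Herm_mats n \<and>
          (\<exists>G \<in> proc_sols \<S>' X (\<i> \<cdot>\<^sub>m B).
             spectral_norm G = proc_dist spectral_norm \<S>' X (\<i> \<cdot>\<^sub>m B))) \<and>
        (\<forall>\<S>' \<in> {Jordan_alg \<KK> n k M, Lie_alg \<KK> n k M}. lmult M \<S>' = Herm_mats n \<longrightarrow>
          (\<forall>G \<in> proc_sols \<S>' X (\<i> \<cdot>\<^sub>m B).
             spectral_norm G = proc_dist spectral_norm \<S>' X (\<i> \<cdot>\<^sub>m B) \<longrightarrow>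
               - \<i> \<cdot>\<^sub>m G \<in> proc_sols \<S> X B \<and> spectral_norm (- \<i> \<cdot>\<^sub>m G) = \<sigma>\<^sub>2)))"
proof -
  note \<KK> = assms(1) and n = assms(2)
  from assms(8) obtain A\<^sub>0 where A0: "A\<^sub>0 \<in> proc_sols \<S> X B" by blast
  from jordan_lie_structured[OF \<KK> n assms(4)] obtain \<delta> where \<delta>: "\<delta> \<in> {1, -1}"
    and J: "structured_class \<KK> k n M (Jordan_alg \<KK> n k M) \<delta>"
    and L: "structured_class \<KK> k n M (Lie_alg \<KK> n k M) (- \<delta>)" by blast
  obtain e where sc: "structured_class \<KK> k n M \<S> e" using assms(5) J L by auto
  interpret g: structured_class \<KK> k n M \<S> e by fact
  let ?W = "lmult M \<S>" and ?I = "1\<^sub>m n :: complex mat" and ?P = "X * X\<^sup>\<dagger>" and ?C = "M * B * X\<^sup>\<dagger>"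
  note W = g.lmult_class and e = g.e
  have kS: "k = Sesquilinear \<Longrightarrow> \<KK> = UNIV" using assms(4) by (simp add: scalar_product_def)
  have W_sym: "?W = sym_mats \<KK> n \<Longrightarrow> e = 1" and W_skew: "?W = skew_sym_mats \<KK> n \<Longrightarrow> e = -1"
    and W_Herm: "?W = Herm_mats n \<Longrightarrow> e = 1" and W_skew_Herm: "?W = skew_Herm_mats n \<Longrightarrow> e = -1"
    unfolding W matrix_classes using n \<KK> e by (blast intro: star_class_eqD(1))+
  \<comment> \<open>The name of the class already fixes the sign, so the set can be rewritten as the
    class of the named kind with the same \<open>e\<close>.\<close>
  have W_bil: "star_class \<KK> n k e = star_class \<KK> n Bilinear e" if "?W \<in> {sym_mats \<KK> n, skew_sym_mats \<KK> n}"
  proof -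
    from that consider (s) "?W = sym_mats \<KK> n" | (a) "?W = skew_sym_mats \<KK> n" by blast
    then show ?thesis
    proof cases
      case s
      from s W_sym[OF s] show ?thesis unfolding W matrix_classes by simp
    next
      case a
      from a W_skew[OF a] show ?thesis unfolding W matrix_classes by simp
    qed
  qed
  have W_ses: "star_class \<KK> n k e = star_class UNIV n Sesquilinear e" if "?W \<in> {Herm_mats n, skew_Herm_mats n}"
  proof -
    from that consider (s) "?W = Herm_mats n" | (a) "?W = skew_Herm_mats n" by blast
    then show ?thesis
    proof cases
      case s
      from s W_Herm[OF s] show ?thesis unfolding W matrix_classes by simp
    next
      case a
      from a W_skew_Herm[OF a] show ?thesis unfolding W matrix_classes by simp
    qed
  qed
  \<comment> \<open>A sesquilinear form has complex scalars, and over these the test matrix \<i>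
    times the identity tells the two kinds apart.\<close>
  have bil: "k = Bilinear" if "?W \<in> {sym_mats \<KK> n, skew_sym_mats \<KK> n}"
  proof (rule ccontr)
    assume "k \<noteq> Bilinear"
    then have "k = Sesquilinear" "\<KK> = UNIV" using kS by (cases k; simp)+
    then show False
      using star_class_eqD(2)[OF W_bil[OF that] n \<KK> \<KK> e e] e by auto
  qed
  have real: "\<KK> = \<real>" if "?W \<in> {Herm_mats n, skew_Herm_mats n}" "k = Bilinear"
  proof (rule ccontr)
    assume "\<KK> \<noteq> \<real>"
    then have "\<KK> = UNIV" using \<KK> by blast
    then show False
      using star_class_eqD(2)[OF W_ses[OF that(1)] n \<KK> _ e e] e that(2) by auto
  qed
  \<comment> \<open>If the form is bilinear in the Hermitian case, the scalars are real and
    conjugation is trivial, so \<S> is a structured class of the sesquilinear kind as well.\<close>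
  have ses: "structured_class \<KK> Sesquilinear n M \<S> e" if "?W \<in> {Herm_mats n, skew_Herm_mats n}"
  proof (cases k)
    case Bilinear
    show ?thesis
      using sc real[OF that Bilinear] star_class_real[of n k e Sesquilinear] by (simp add: structured_class_def)
  qed (use sc in simp)
  have proc: "procrustes \<KK> k' n M \<S> e p X B A\<^sub>0" if "structured_class \<KK> k' n M \<S> e" for k'
    using that assms(6,7) A0 by (simp add: procrustes_def procrustes_axioms_def)
  interpret g: procrustes \<KK> k n M \<S> e p X B A\<^sub>0 by (rule proc[OF sc])

  have bil_simps:
    "procrustes \<KK> Bilinear n M \<S> e p X B A\<^sub>0"
    "proc_map \<KK> n ?W Bilinear X (M * B) = procrustes.F Bilinear M X A\<^sub>0"
    "(?I - ?P)\<^sup>T = conj_mat (?I - ?P)" "?P\<^sup>T = conj_mat ?P"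
    if W': "?W \<in> {sym_mats \<KK> n, skew_sym_mats \<KK> n}"
  proof -
    show b: "procrustes \<KK> Bilinear n M \<S> e p X B A\<^sub>0" using proc sc bil[OF W'] by simp
    interpret b: procrustes \<KK> Bilinear n M \<S> e p X B A\<^sub>0 by (rule b)
    show "proc_map \<KK> n ?W Bilinear X (M * B) = b.F"
      using b.proc_map_class W' unfolding b.lmult_class by blast
    show "(?I - ?P)\<^sup>T = conj_mat (?I - ?P)"
      using b.Q(6) unfolding transpose_conj by (simp add: b.Q_def b.P_def)
    show "?P\<^sup>T = conj_mat ?P"
      using b.P(4) unfolding transpose_conj by (simp add: b.P_def)
  qed
  have ses_simps:
    "procrustes \<KK> Sesquilinear n M \<S> e p X B A\<^sub>0"
    "proc_map \<KK> n ?W Sesquilinear X (M * B) = procrustes.F Sesquilinear M X A\<^sub>0"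
    if W': "?W \<in> {Herm_mats n, skew_Herm_mats n}"
  proof -
    show b: "procrustes \<KK> Sesquilinear n M \<S> e p X B A\<^sub>0" using proc ses[OF W'] by simp
    interpret b: procrustes \<KK> Sesquilinear n M \<S> e p X B A\<^sub>0 by (rule b)
    show "proc_map \<KK> n ?W Sesquilinear X (M * B) = b.F"
      using b.proc_map_class W' unfolding b.lmult_class by blast
  qed

  have 1: "?W \<in> {sym_mats \<KK> n, skew_sym_mats \<KK> n} \<longrightarrow>
        (\<forall>A. A \<in> proc_sols \<S> X B \<longleftrightarrow>
          (\<exists>Z \<in> ?W. A = inv_mat M * proc_map \<KK> n ?W Bilinear X (M * B)
                      + inv_mat M * (?I - ?P)\<^sup>T * Z * (?I - ?P)))"
  proof (intro impI allI)
    fix A assume W': "?W \<in> {sym_mats \<KK> n, skew_sym_mats \<KK> n}"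
    interpret b: procrustes \<KK> Bilinear n M \<S> e p X B A\<^sub>0 by (rule bil_simps[OF W'])
    show "A \<in> proc_sols \<S> X B \<longleftrightarrow> (\<exists>Z \<in> ?W. A = inv_mat M * proc_map \<KK> n ?W Bilinear X (M * B)
                      + inv_mat M * (?I - ?P)\<^sup>T * Z * (?I - ?P))"
      unfolding bil_simps(2,3)[OF W'] unfolding b.lmult_class using b.solutions[of A] by (simp only: b.Q_def b.P_def cj.simps)
  qed
  have 2: "?W \<in> {Herm_mats n, skew_Herm_mats n} \<longrightarrow>
        (\<forall>A. A \<in> proc_sols \<S> X B \<longleftrightarrow>
          (\<exists>Z \<in> ?W. A = inv_mat M * proc_map \<KK> n ?W Sesquilinear X (M * B)
                      + inv_mat M * (?I - ?P) * Z * (?I - ?P)))"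
  proof (intro impI allI)
    fix A assume W': "?W \<in> {Herm_mats n, skew_Herm_mats n}"
    interpret b: procrustes \<KK> Sesquilinear n M \<S> e p X B A\<^sub>0 by (rule ses_simps[OF W'])
    show "A \<in> proc_sols \<S> X B \<longleftrightarrow> (\<exists>Z \<in> ?W. A = inv_mat M * proc_map \<KK> n ?W Sesquilinear X (M * B)
                      + inv_mat M * (?I - ?P) * Z * (?I - ?P))"
      unfolding ses_simps(2)[OF W'] unfolding b.lmult_class using b.solutions[of A] by (simp only: b.Q_def b.P_def cj.simps)
  qed
  have 3: "?W \<in> {sym_mats \<KK> n, skew_sym_mats \<KK> n} \<longrightarrow>
        (let A\<^sub>o = inv_mat M * proc_map \<KK> n ?W Bilinear X (M * B); t = tr_mat (?C * ?C\<^sup>H * ?P\<^sup>T) in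
          (\<forall>A. A \<in> proc_sols \<S> X B \<and> A * X = B \<and> proc_dist frob_norm \<S> X B = frob_norm A \<longleftrightarrow> A = A\<^sub>o) \<and>
          t \<in> \<real> \<and> frob_norm A\<^sub>o = sqrt (2 * (frob_norm (B * X\<^sup>\<dagger>))\<^sup>2 - Re t))"
  proof
    assume W': "?W \<in> {sym_mats \<KK> n, skew_sym_mats \<KK> n}"
    interpret b: procrustes \<KK> Bilinear n M \<S> e p X B A\<^sub>0 by (rule bil_simps[OF W'])
    show "let A\<^sub>o = inv_mat M * proc_map \<KK> n ?W Bilinear X (M * B); t = tr_mat (?C * ?C\<^sup>H * ?P\<^sup>T) in
          (\<forall>A. A \<in> proc_sols \<S> X B \<and> A * X = B \<and> proc_dist frob_norm \<S> X B = frob_norm A \<longleftrightarrow> A = A\<^sub>o) \<and>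
          t \<in> \<real> \<and> frob_norm A\<^sub>o = sqrt (2 * (frob_norm (B * X\<^sup>\<dagger>))\<^sup>2 - Re t)"
      unfolding Let_def bil_simps(2,4)[OF W']
      using b.frob_unique b.frob_trace(1) b.frob_value 
      unfolding b.MBX[symmetric] unfolding cj.simps b.P_def
      by (intro conjI allI)
  qed
  have 4: "?W \<in> {Herm_mats n, skew_Herm_mats n} \<longrightarrow>
        (let A\<^sub>o = inv_mat M * proc_map \<KK> n ?W Sesquilinear X (M * B); t = tr_mat (?C * ?C\<^sup>H * ?P) in
          (\<forall>A. A \<in> proc_sols \<S> X B \<and> A * X = B \<and> proc_dist frob_norm \<S> X B = frob_norm A \<longleftrightarrow> A = A\<^sub>o) \<and>
          t \<in> \<real> \<and> frob_norm A\<^sub>o = sqrt (2 * (frob_norm (B * X\<^sup>\<dagger>))\<^sup>2 - Re t))"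
  proof
    assume W': "?W \<in> {Herm_mats n, skew_Herm_mats n}"
    interpret b: procrustes \<KK> Sesquilinear n M \<S> e p X B A\<^sub>0 by (rule ses_simps[OF W'])
    show "let A\<^sub>o = inv_mat M * proc_map \<KK> n ?W Sesquilinear X (M * B); t = tr_mat (?C * ?C\<^sup>H * ?P) in
          (\<forall>A. A \<in> proc_sols \<S> X B \<and> A * X = B \<and> proc_dist frob_norm \<S> X B = frob_norm A \<longleftrightarrow> A = A\<^sub>o) \<and>
          t \<in> \<real> \<and> frob_norm A\<^sub>o = sqrt (2 * (frob_norm (B * X\<^sup>\<dagger>))\<^sup>2 - Re t)"
      unfolding Let_def ses_simps(2)[OF W']
      using b.frob_unique b.frob_trace(1) b.frob_value 
      unfolding b.MBX[symmetric] unfolding cj.simps b.P_def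
      by (intro conjI allI)
  qed
  have 5: "proc_dist spectral_norm \<S> X B = spectral_norm (B * X\<^sup>\<dagger>)"
    "spectral_norm (B * X\<^sup>\<dagger>) = proc_dist spectral_norm (kmat \<KK> n n) X B"
    using g.spectral_dist g.spectral_dist_unstructured by (simp_all add: g.\<mu>_def)
  have 6: "let U\<^sub>1 = left_cols r U; U\<^sub>2 = right_cols r U;
             \<mu> = spectral_norm (B * X\<^sup>\<dagger>); m2 = complex_of_real (\<mu>\<^sup>2); K = ?C * U\<^sub>1 * inv_sqrt_mat R;
                   fZ = complex_of_real \<mu> \<cdot>\<^sub>m
                     (conj_mat U\<^sub>2 * sqrt_mat (1\<^sub>m (n - r) - U\<^sub>2\<^sup>T * K * K\<^sup>H * conj_mat U\<^sub>2) * Z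
                        * sqrt_mat (1\<^sub>m (n - r) - U\<^sub>2\<^sup>H * conj_mat K * K\<^sup>T * U\<^sub>2) * U\<^sub>2\<^sup>H);
                   A\<^sub>o = inv_mat M * proc_map \<KK> n ?W Bilinear X (M * B)
                        - inv_mat M * (?I - ?P)\<^sup>T * K * U\<^sub>1\<^sup>H * conj_mat (?C * U\<^sub>1) * K\<^sup>T * (?I - ?P)
                        + inv_mat M * fZ
               in A\<^sub>o \<in> proc_sols \<S> X B \<and> spectral_norm A\<^sub>o = proc_dist spectral_norm \<S> X B"
    if svd: "vec_space.rank n X = r \<and> is_svd \<KK> n p X U \<Sigma> V"
      and W': "?W \<in> {sym_mats \<KK> n, skew_sym_mats \<KK> n}"
      and Z: "contraction_mat \<KK> (n - r) Z \<and>
                 (?W = sym_mats \<KK> n \<longrightarrow> Z = Z\<^sup>T) \<and> (?W = skew_sym_mats \<KK> n \<longrightarrow> Z = - Z\<^sup>T)"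
      and R: "R = (if ?W = sym_mats \<KK> n
          then complex_of_real ((spectral_norm (B * X\<^sup>\<dagger>))\<^sup>2) \<cdot>\<^sub>m 1\<^sub>m r - (left_cols r U)\<^sup>H * conj_mat ?C * ?C * left_cols r U
          else complex_of_real ((spectral_norm (B * X\<^sup>\<dagger>))\<^sup>2) \<cdot>\<^sub>m 1\<^sub>m r + (left_cols r U)\<^sup>H * conj_mat ?C * ?C * left_cols r U)"
    for r U \<Sigma> V Z R
  proof -
    interpret b: procrustes \<KK> Bilinear n M \<S> e p X B A\<^sub>0 by (rule bil_simps[OF W'])
    have We: "?W = sym_mats \<KK> n \<longleftrightarrow> e = 1" "?W = skew_sym_mats \<KK> n \<longleftrightarrow> e = -1"
    proof -
      have "\<not> (e = 1 \<and> e = -1)" by auto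
      then show "?W = sym_mats \<KK> n \<longleftrightarrow> e = 1" "?W = skew_sym_mats \<KK> n \<longleftrightarrow> e = -1"
        using W' W_sym W_skew by blast+
    qed
    have cZ: "(cj Bilinear Z)\<^sup>H = e \<cdot>\<^sub>m Z"
    proof -
      consider "e = 1" | "e = -1" using e by auto
      then show ?thesis
      proof cases
        case 1
        then have "Z\<^sup>T = Z" using Z We(1) by metis
        then show ?thesis unfolding 1 by (simp add: transpose_conj)
      next
        case 2
        then have "Z = - Z\<^sup>T" using Z We(2) by blast
        then have "Z\<^sup>T = - Z" by (metis uminus_uminus_mat)
        then show ?thesis unfolding 2 by (simp add: transpose_conj flip: uminus_mat_smult)
      qed
    qed
    \<comment> \<open>The two branches become one formula carrying the sign \<open>e\<close>, the
      form used by \<open>svd_minimizer\<close>.\<close>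
    have R': "R = complex_of_real ((spectral_norm (B * X\<^sup>\<dagger>))\<^sup>2) \<cdot>\<^sub>m 1\<^sub>m r
        - e \<cdot>\<^sub>m ((left_cols r U)\<^sup>H * conj_mat ?C * ?C * left_cols r U)"
      unfolding R We using e by (auto intro!: eq_matI simp del: index_mult_mat(1))
    note sm = b.svd_minimizer[OF conjunct2[OF svd] conjunct1[OF svd] conjunct1[OF Z] cZ]
    show ?thesis
      unfolding Let_def R' bil_simps(2,3)[OF W'] unfolding transpose_conj 5(1)
      using sm unfolding cj.simps b.\<mu>_def b.Q_def b.P_def .
  qed
  have 7: "let U\<^sub>1 = left_cols r U; U\<^sub>2 = right_cols r U;
             \<mu> = spectral_norm (B * X\<^sup>\<dagger>); m2 = complex_of_real (\<mu>\<^sup>2);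
             R = m2 \<cdot>\<^sub>m 1\<^sub>m r - U\<^sub>1\<^sup>H * ?C * ?C * U\<^sub>1;
                   K = ?C * U\<^sub>1 * inv_sqrt_mat R;
                   Q = sqrt_mat (1\<^sub>m (n - r) - U\<^sub>2\<^sup>H * K * K\<^sup>H * U\<^sub>2);
                   fZ = complex_of_real \<mu> \<cdot>\<^sub>m (U\<^sub>2 * Q * Z * Q * U\<^sub>2\<^sup>H);
                   A\<^sub>o = inv_mat M * proc_map \<KK> n ?W Sesquilinear X (M * B)
                        - inv_mat M * (?I - ?P) * K * U\<^sub>1\<^sup>H * ?C * U\<^sub>1 * K\<^sup>H * (?I - ?P)
                        + inv_mat M * fZ
               in A\<^sub>o \<in> proc_sols \<S> X B \<and> spectral_norm A\<^sub>o = proc_dist spectral_norm \<S> X B"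
    if svd: "vec_space.rank n X = r \<and> is_svd \<KK> n p X U \<Sigma> V" and W': "?W = Herm_mats n"
      and Z: "contraction_mat \<KK> (n - r) Z \<and> Z = Z\<^sup>H" for r U \<Sigma> V Z
  proof -
    have W'': "?W \<in> {Herm_mats n, skew_Herm_mats n}" using W' by simp
    interpret b: procrustes \<KK> Sesquilinear n M \<S> e p X B A\<^sub>0 by (rule ses_simps[OF W''])
    have e1: "e = 1" using W_Herm W' by simp
    have cZ: "(cj Sesquilinear Z)\<^sup>H = e \<cdot>\<^sub>m Z" unfolding e1 cj.simps one_smult_mat using Z by metis
    have "dim_row U = n" using svd by (auto simp: is_svd_def kmat_def)
    \<comment> \<open>Only the bracketing of the middle product differs from
      \<open>svd_minimizer\<close>.\<close>
    then have assoc: "Y * (left_cols r U)\<^sup>H * (?C * left_cols r U) = Y * (left_cols r U)\<^sup>H * ?C * left_cols r U"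
      for Y by (simp add: mult_assoc_dim[symmetric])
    note sm = b.svd_minimizer[OF conjunct2[OF svd] conjunct1[OF svd] conjunct1[OF Z] cZ]
    show ?thesis
      unfolding Let_def ses_simps(2)[OF W''] 5(1)
      using sm unfolding cj.simps b.\<mu>_def b.Q_def b.P_def e1 one_smult_mat assoc .
  qed
  have 8: "(\<exists>\<S>' \<in> {Jordan_alg \<KK> n k M, Lie_alg \<KK> n k M}. lmult M \<S>' = Herm_mats n \<and>
          (\<exists>G \<in> proc_sols \<S>' X (\<i> \<cdot>\<^sub>m B).
             spectral_norm G = proc_dist spectral_norm \<S>' X (\<i> \<cdot>\<^sub>m B))) \<and>
        (\<forall>\<S>' \<in> {Jordan_alg \<KK> n k M, Lie_alg \<KK> n k M}. lmult M \<S>' = Herm_mats n \<longrightarrow>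
          (\<forall>G \<in> proc_sols \<S>' X (\<i> \<cdot>\<^sub>m B).
             spectral_norm G = proc_dist spectral_norm \<S>' X (\<i> \<cdot>\<^sub>m B) \<longrightarrow>
               - \<i> \<cdot>\<^sub>m G \<in> proc_sols \<S> X B \<and> spectral_norm (- \<i> \<cdot>\<^sub>m G) = proc_dist spectral_norm \<S> X B))"
    if W': "?W = skew_Herm_mats n"
  proof -
    have e1: "e = -1" using W_skew_Herm W' by simp
    \<comment> \<open>\<i> times the identity is skew-Hermitian, so it lies in the class. This
      forces complex scalars and a sesquilinear form, and makes \<i> times \<open>B\<close>
      admissible.\<close>
    have "star_class \<KK> n k e = star_class UNIV n Sesquilinear (-1)" using W W' by (simp add: matrix_classes)
    from star_class_eqD(2)[OF this n \<KK> _ e] have "\<KK> = UNIV" "k \<noteq> Bilinear" using e1 by auto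
    then have KU: "\<KK> = UNIV" and kSes: "k = Sesquilinear" by (cases k; simp)+
    have iB: "\<i> \<cdot>\<^sub>m B \<in> kmat \<KK> n p" using assms(7) KU by (auto simp: kmat_def)
    have cX: "X \<in> carrier_mat n p" using assms(6) by (simp add: kmat_def)
    have norm_iB: "spectral_norm (\<i> \<cdot>\<^sub>m B * X\<^sup>\<dagger>) = spectral_norm (B * X\<^sup>\<dagger>)"
      by (rule smult_solution_norm) simp_all
    have Herm: "structured_class UNIV Sesquilinear n M \<S>' (- e)"
      if T: "\<S>' \<in> {Jordan_alg \<KK> n k M, Lie_alg \<KK> n k M}" "lmult M \<S>' = Herm_mats n" for \<S>'
    proof -
      obtain e' where sc': "structured_class \<KK> k n M \<S>' e'" using T(1) J L by auto
      interpret s': structured_class \<KK> k n M \<S>' e' by fact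
      have "star_class \<KK> n k e' = star_class UNIV n Sesquilinear 1"
        using s'.lmult_class T(2) by (simp add: matrix_classes)
      then have "e' = 1" using star_class_eqD(1) n \<KK> s'.e by blast
      then show ?thesis using sc' KU kSes e1 by simp
    qed
    have sc': "structured_class UNIV Sesquilinear n M \<S> e" using sc KU kSes by simp
    have iB_proc: "procrustes UNIV Sesquilinear n M \<S>' (- e) p X (\<i> \<cdot>\<^sub>m B) (\<i> \<cdot>\<^sub>m A\<^sub>0)"
      if "structured_class UNIV Sesquilinear n M \<S>' (- e)" for \<S>'
      using that assms(6) iB KU imaginary_multiple_solution[OF sc' that A0 cX]
      by (simp add: procrustes_def procrustes_axioms_def)
    have dist: "proc_dist spectral_norm \<S>' X (\<i> \<cdot>\<^sub>m B) = spectral_norm (B * X\<^sup>\<dagger>)"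
      if "structured_class UNIV Sesquilinear n M \<S>' (- e)" for \<S>'
    proof -
      interpret b: procrustes UNIV Sesquilinear n M \<S>' "- e" p X "\<i> \<cdot>\<^sub>m B" "\<i> \<cdot>\<^sub>m A\<^sub>0" by (rule iB_proc[OF that])
      show ?thesis using b.spectral_dist norm_iB by (simp add: b.\<mu>_def)
    qed
    \<comment> \<open>The Jordan and Lie algebras carry opposite signs, so one of them has the
      Hermitian sign \<open>- e = 1\<close>.\<close>
    obtain \<S>' where S': "\<S>' \<in> {Jordan_alg \<KK> n k M, Lie_alg \<KK> n k M}"
      "structured_class UNIV Sesquilinear n M \<S>' (- e)"
    proof (cases "\<delta> = 1")
      case True
      then show ?thesis using that[of "Jordan_alg \<KK> n k M"] J e1 KU kSes by simp
    next
      case False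
      then have "\<delta> = -1" using \<delta> by simp
      then show ?thesis using that[of "Lie_alg \<KK> n k M"] L e1 KU kSes by simp
    qed
    interpret b: procrustes UNIV Sesquilinear n M \<S>' "- e" p X "\<i> \<cdot>\<^sub>m B" "\<i> \<cdot>\<^sub>m A\<^sub>0" by (rule iB_proc[OF S'(2)])
    have "lmult M \<S>' = Herm_mats n" by (simp add: b.lmult_class matrix_classes e1)
    moreover have "\<exists>G \<in> proc_sols \<S>' X (\<i> \<cdot>\<^sub>m B). spectral_norm G = proc_dist spectral_norm \<S>' X (\<i> \<cdot>\<^sub>m B)"
      unfolding b.spectral_dist by (rule b.spectral_minimizer)
    moreover have "- \<i> \<cdot>\<^sub>m G \<in> proc_sols \<S> X B \<and> spectral_norm (- \<i> \<cdot>\<^sub>m G) = proc_dist spectral_norm \<S> X B"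
      if T: "\<T> \<in> {Jordan_alg \<KK> n k M, Lie_alg \<KK> n k M}" "lmult M \<T> = Herm_mats n"
        and G: "G \<in> proc_sols \<T> X (\<i> \<cdot>\<^sub>m B)"
        and norm: "spectral_norm G = proc_dist spectral_norm \<T> X (\<i> \<cdot>\<^sub>m B)" for \<T> G
    proof -
      \<comment> \<open>The two imaginary factors multiply to 1, so the right-hand side is
        \<open>B\<close> again; the norm is unchanged and both minimal values are the norm of
        \<open>B * X\<^sup>\<dagger>\<close>.\<close>
      have "- \<i> \<cdot>\<^sub>m G \<in> proc_sols \<S> X (- \<i> \<cdot>\<^sub>m (\<i> \<cdot>\<^sub>m B))"
        by (rule imaginary_multiple_solution[OF Herm[OF T] _ G cX]) (use sc' in simp_all)
      then show ?thesis using norm dist[OF Herm[OF T]] 5(1) by (simp add: smult_smult_mat spectral_norm_smult)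
    qed
    ultimately show ?thesis using S'(1) by blast
  qed
  show ?thesis
    unfolding Let_def
    by (intro conjI)
      (rule 1 2 3[unfolded Let_def] 4[unfolded Let_def] 5 impI[OF 8], assumption?
        | (intro allI impI, rule conjI, (intro impI allI, rule 6[unfolded Let_def, OF _ _ _ refl]; assumption),
            intro impI allI, rule 7[unfolded Let_def]; assumption))+
qed

end
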